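(* Let $\Gamma$ be a finite oriented graph with totally ordered vertex set $V$ and edge set $E$, let $G$ be a connected compact Lie group, let $K_v\subseteq G$ ($v\in V$) be subgroups and $\mathbf{K}=\prod_{v\in V}K_v$. For each $e\in E$ let $\pi_e:G\to\mathrm{GL}(M^{\pi_e})$ be an irreducible finite dimensional continuous complex representation, and for each $v\in V$ let $\sigma_v:K_v\to\mathrm{GL}(S_v)$ be a finite dimensional complex representation. Let $\Psi^{\bm{\pi}}$ be the linear map $$\Psi^{\bm{\pi}}:\ \bigotimes_{v\in V}\bigl(\mathbf{M}^{\pi_{\mathcal{S}(v)}}\otimes S_v\bigr)\longrightarrow\mathcal{R}^{\bm{\pi}}(G^E)\otimes\mathbf{S}$$ defined on pure tensors ($\phi_e\in M^{\pi_e^*}$, $m_e\in M^{\pi_e}$, $u_v\in S_v$) by $$\Psi^{\bm{\pi}}\Bigl(\bigotimes_{v\in V}\Bigl(\Bigl(\bigotimes_{e\in\mathcal{S}(v|s)}\phi_e\Bigr)\otimes\Bigl(\bigotimes_{e\in\mathcal{S}(v|t)}m_e\Bigr)\otimes u_v\Bigr)\Bigr):=c^{\bm{\pi}}_{\bm{\phi},\bm{m}}\otimes\bm{u},$$ with $\bm{\phi}=\bigotimes_{e\in E}\phi_e$, $\bm{m}=\bigotimes_{e\in E}m_e$, $\bm{u}=\bigotimes_{v\in V}u_v$. Then $\Psi^{\bm{\pi}}$ is a $\mathbf{K}$-linear isomorphism $$\Psi^{\bm{\pi}}:\ \bigotimes_{v\in V}\bigl(\mathbf{M}^{\pi_{\mathcal{S}(v)}}\otimes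 S_v\bigr)\overset{\sim}{\longrightarrow}\mathcal{R}^{\bm{\pi}}(G^E)\otimes\mathbf{S},$$ and it restricts to a linear isomorphism $$\Psi^{\bm{\pi}}:\ \bigotimes_{v\in V}\bigl(\mathbf{M}^{\pi_{\mathcal{S}(v)}}\otimes S_v\bigr)^{K_v}\overset{\sim}{\longrightarrow}\bigl(\mathcal{R}^{\bm{\pi}}(G^E)\otimes\mathbf{S}\bigr)^{\mathbf{K}}.$$
   Context: $s,t:E\to V$ are the source and target maps of $\Gamma$ (loops and multiple edges allowed). For $v\in V$, $\mathcal{S}(v|s)=\{e\in E\mid s(e)=v\}$ and $\mathcal{S}(v|t)=\{e\in E\mid t(e)=v\}$. All tensor products over subsets of $E$ or $V$ are ordered by the chosen total orders; an empty tensor product is $\mathbb{C}$. Write $E=\{e_1<\dots<e_n\}$. The tensor product representation $\bm{\pi}:G^E\to\mathrm{GL}(\mathbf{M}^{\bm\pi})$ is $\mathbf{M}^{\bm\pi}=M^{\pi_{e_1}}\otimes\cdots\otimes M^{\pi_{e_n}}$, $\bm{\pi}(\bm{g})=\pi_{e_1}(g_{e_1})\otimes\cdots\otimes\pi_{e_n}(g_{e_n})$. For $\bm{\phi}\in(\mathbf{M}^{\bm\pi})^*\simeq\bigotimes_{e\in E}(M^{\pi_e})^*$ and $\bm{m}\in\mathbf{M}^{\bm\pi}$ the matrix coefficient is $c^{\bm\pi}_{\bm\phi,\bm m}(\bm{g})=\bm{\phi}(\bm{\pi}(\bm{g})\bm{m})$; $\mathcal{R}^{\bm\pi}(G^E)$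 is the linear span of all these functions on $G^E$. $\pi_e^*$ denotes the dual representation, on $M^{\pi_e^*}=(M^{\pi_e})^*$. $\mathbf{M}^{\pi_{\mathcal{S}(v)}}:=\bigl(\bigotimes_{e\in\mathcal{S}(v|s)}M^{\pi_e^*}\bigr)\otimes\bigl(\bigotimes_{e\in\mathcal{S}(v|t)}M^{\pi_e}\bigr)$, with $K_v$ acting diagonally (through restriction of the $G$-representations $\pi_e^*$, $\pi_e$ to $K_v$); $\mathbf{M}^{\pi_{\mathcal{S}(v)}}\otimes S_v$ carries the diagonal $K_v$-action, and $\bigotimes_{v\in V}(\mathbf{M}^{\pi_{\mathcal{S}(v)}}\otimes S_v)$ carries the tensor product action of $\mathbf{K}=\prod_vK_v$, the factor $K_v$ acting on the $v$-th tensor factor. $\mathbf{S}=\bigotimes_{v\in V}S_v$ carries the tensor product representation $\bm{\sigma}$ of $\mathbf{K}$, $\bm\sigma(\bm k)=\bigotimes_{v\in V}\sigma_v(k_v)$. $\mathbf{K}$ acts on $G^E$ by $\bm{k}\cdot\bm{g}=(k_{s(e)}g_ek_{t(e)}^{-1})_{e\in E}$, and on $\mathbf{S}$-valued functions by $(\bm{k}\cdot f)(\bm{g})=\bm{\sigma}(\bm{k})f(\bm{k}^{-1}\cdot\bm{g})$; this action preserves $\mathcal{R}^{\bm\pi}(G^E)\otimes\mathbf{S}$. Superscripts $K_v$ and $\mathbf{K}$ denote invariants. *)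

theory Defs
  imports
    "HOL-Analysis.Analysis"
    "HOL-Algebra.Bij"
    "HOL-Algebra.Product_Groups"
    "HOL-Library.Function_Algebras"
    "Graph_Theory.Digraph"
begin

section \<open>Complex vector spaces\<close>

text \<open>
  A type of class \<open>complex_vector\<close> is an ambient space; the vector spaces of a family are
  subspaces of it. This is no restriction, since every family of vector spaces embeds into its
  direct sum.
\<close>

class complex_vector = ab_group_add +
  fixes scaleC :: "complex \<Rightarrow> 'a \<Rightarrow> 'a"  (infixr \<open>*\<^sub>C\<close> 75)
  assumes scaleC_add_right: "a *\<^sub>C (x + y) = a *\<^sub>C x + a *\<^sub>C y"
    and scaleC_add_left: "(a + b) *\<^sub>C x = a *\<^sub>C x + b *\<^sub>C x"
    and scaleC_scaleC: "a *\<^sub>C b *\<^sub>C x = (a * b) *\<^sub>C x"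
    and scaleC_one: "1 *\<^sub>C x = x"

global_interpretation cvec: vector_space "scaleC :: complex \<Rightarrow> 'a \<Rightarrow> 'a::complex_vector"
  by unfold_locales (rule scaleC_add_right scaleC_add_left scaleC_scaleC scaleC_one)+

global_interpretation cvec: vector_space_pair
  "scaleC :: complex \<Rightarrow> 'a \<Rightarrow> 'a::complex_vector"
  "scaleC :: complex \<Rightarrow> 'b \<Rightarrow> 'b::complex_vector"
  by unfold_locales

instantiation complex :: complex_vector
begin
definition scaleC_complex_def [simp]: "a *\<^sub>C (z::complex) = a * z"
instance by standard (simp_all add: algebra_simps)
end

instantiation "fun" :: (type, complex_vector) complex_vector
begin
definition scaleC_fun_def: "a *\<^sub>C f = (\<lambda>x. a *\<^sub>C f x)"
instance
  by standard (simp_all add: scaleC_fun_def fun_eq_iff scaleC_add_right scaleC_add_left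
      scaleC_scaleC scaleC_one)
end

lemma scaleC_fun_apply [simp]: "(a *\<^sub>C f) x = a *\<^sub>C f x"
  by (simp add: scaleC_fun_def)

definition linear_on :: "'a::complex_vector set \<Rightarrow> ('a \<Rightarrow> 'b::complex_vector) \<Rightarrow> bool" where
  "linear_on V f \<longleftrightarrow>
     (\<forall>x\<in>V. \<forall>y\<in>V. f (x + y) = f x + f y) \<and> (\<forall>c. \<forall>x\<in>V. f (c *\<^sub>C x) = c *\<^sub>C f x)"

definition linear_iso :: "'a::complex_vector set \<Rightarrow> 'b::complex_vector set \<Rightarrow> ('a \<Rightarrow> 'b) \<Rightarrow> bool"
  where "linear_iso V W f \<longleftrightarrow> linear_on V f \<and> bij_betw f V W"

definition fin_dim_space :: "'a::complex_vector set \<Rightarrow> bool" where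
  "fin_dim_space V \<longleftrightarrow> (\<exists>B. finite B \<and> V = cvec.span B)"

text \<open>Functionals on a subspace are extended by zero, so that they form a subspace of the
  function space. The same convention is used for multilinear forms and for functions on a group.\<close>

definition dual :: "'a::complex_vector set \<Rightarrow> ('a \<Rightarrow> complex) set" where
  "dual V = {\<phi>. linear_on V \<phi> \<and> (\<forall>x. x \<notin> V \<longrightarrow> \<phi> x = 0)}"


section \<open>Tensor products\<close>

text \<open>
  The tensor product of a family \<open>V\<close> of vector spaces over a finite index set \<open>I\<close> is realised
  inside the dual of the space of multilinear forms: the pure tensor \<open>\<Otimes>x\<^sub>i\<close> is evaluation at
  \<open>x\<close>, and the tensor product is the span of the pure tensors. The usual universal
  property is proved below. The construction is indexed by the set \<open>I\<close> itself (an element of the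
  product is a function on \<open>I\<close>), so no order on \<open>I\<close> enters; for \<open>I = {}\<close> it is the complex line.
\<close>

definition multilinear_on ::
    "'i set \<Rightarrow> ('i \<Rightarrow> 'a::complex_vector set) \<Rightarrow> (('i \<Rightarrow> 'a) \<Rightarrow> 'b::complex_vector) \<Rightarrow> bool" where
  "multilinear_on I V F \<longleftrightarrow> (\<forall>x\<in>Pi\<^sub>E I V. \<forall>i\<in>I. linear_on (V i) (\<lambda>a. F (x(i := a))))"

definition multilinear_forms ::
    "'i set \<Rightarrow> ('i \<Rightarrow> 'a::complex_vector set) \<Rightarrow> (('i \<Rightarrow> 'a) \<Rightarrow> complex) set" where
  "multilinear_forms I V = {F. multilinear_on I V F \<and> (\<forall>x. x \<notin> Pi\<^sub>E I V \<longrightarrow> F x = 0)}"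

type_synonym ('i, 'a) tens = "(('i \<Rightarrow> 'a) \<Rightarrow> complex) \<Rightarrow> complex"

definition tensor_vec ::
    "'i set \<Rightarrow> ('i \<Rightarrow> 'a::complex_vector set) \<Rightarrow> ('i \<Rightarrow> 'a) \<Rightarrow> ('i, 'a) tens" where
  "tensor_vec I V x = (\<lambda>F. if F \<in> multilinear_forms I V then F x else 0)"

definition tensor :: "'i set \<Rightarrow> ('i \<Rightarrow> 'a::complex_vector set) \<Rightarrow> ('i, 'a) tens set" where
  "tensor I V = cvec.span (tensor_vec I V ` Pi\<^sub>E I V)"

text \<open>The linear map \<open>\<Otimes>f\<^sub>i\<close> from \<open>\<Otimes>V\<^sub>i\<close> to \<open>\<Otimes>W\<^sub>i\<close>; see \<open>tensor_map_vec\<close> below.\<close>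

definition tensor_map ::
    "'i set \<Rightarrow> ('i \<Rightarrow> 'a::complex_vector set) \<Rightarrow> ('i \<Rightarrow> 'b::complex_vector set) \<Rightarrow>
     ('i \<Rightarrow> 'a \<Rightarrow> 'b) \<Rightarrow> ('i, 'a) tens \<Rightarrow> ('i, 'b) tens" where
  "tensor_map I V W f t = (\<lambda>F. if F \<in> multilinear_forms I W
     then t (\<lambda>x. if x \<in> Pi\<^sub>E I V then F (\<lambda>i\<in>I. f i (x i)) else 0) else 0)"

text \<open>For subspaces \<open>U\<^sub>i\<close> of \<open>V\<^sub>i\<close>, the canonical injection of \<open>\<Otimes>U\<^sub>i\<close> into \<open>\<Otimes>V\<^sub>i\<close>, which in
  this realisation is not a set inclusion.\<close>

definition tensor_incl ::
    "'i set \<Rightarrow> ('i \<Rightarrow> 'a::complex_vector set) \<Rightarrow> ('i \<Rightarrow> 'a set) \<Rightarrow> ('i, 'a) tens \<Rightarrow> ('i, 'a) tens" where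
  "tensor_incl I U V = tensor_map I U V (\<lambda>_ x. x)"

text \<open>The functional \<open>\<Otimes>\<phi>\<^sub>i\<close> on \<open>\<Otimes>V\<^sub>i\<close>, for \<open>\<phi>\<^sub>i\<close> in the dual of \<open>V\<^sub>i\<close>; see
  \<open>tensor_functional_vec\<close> below.\<close>

definition tensor_functional ::
    "'i set \<Rightarrow> ('i \<Rightarrow> 'a::complex_vector set) \<Rightarrow> ('i \<Rightarrow> 'a \<Rightarrow> complex) \<Rightarrow> ('i, 'a) tens \<Rightarrow> complex"
  where "tensor_functional I V \<phi> t =
    (if t \<in> tensor I V then t (\<lambda>x. if x \<in> Pi\<^sub>E I V then \<Prod>i\<in>I. \<phi> i (x i) else 0) else 0)"

definition bilinear_on ::
    "'a::complex_vector set \<Rightarrow> 'b::complex_vector set \<Rightarrow> ('a \<Rightarrow> 'b \<Rightarrow> 'c::complex_vector) \<Rightarrow> bool" where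
  "bilinear_on V W F \<longleftrightarrow> (\<forall>b\<in>W. linear_on V (\<lambda>a. F a b)) \<and> (\<forall>a\<in>V. linear_on W (\<lambda>b. F a b))"

definition bilinear_forms ::
    "'a::complex_vector set \<Rightarrow> 'b::complex_vector set \<Rightarrow> ('a \<Rightarrow> 'b \<Rightarrow> complex) set" where
  "bilinear_forms V W = {F. bilinear_on V W F \<and> (\<forall>a b. a \<notin> V \<or> b \<notin> W \<longrightarrow> F a b = 0)}"

type_synonym ('a, 'b) tens2 = "('a \<Rightarrow> 'b \<Rightarrow> complex) \<Rightarrow> complex"

definition tensor2_vec ::
    "'a::complex_vector set \<Rightarrow> 'b::complex_vector set \<Rightarrow> 'a \<Rightarrow> 'b \<Rightarrow> ('a, 'b) tens2" where
  "tensor2_vec V W a b = (\<lambda>F. if F \<in> bilinear_forms V W then F a b else 0)"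

definition tensor2 :: "'a::complex_vector set \<Rightarrow> 'b::complex_vector set \<Rightarrow> ('a, 'b) tens2 set" where
  "tensor2 V W = cvec.span {tensor2_vec V W a b | a b. a \<in> V \<and> b \<in> W}"

definition tensor2_map ::
    "'a::complex_vector set \<Rightarrow> 'b::complex_vector set \<Rightarrow> 'c::complex_vector set \<Rightarrow>
     'd::complex_vector set \<Rightarrow> ('a \<Rightarrow> 'c) \<Rightarrow> ('b \<Rightarrow> 'd) \<Rightarrow> ('a, 'b) tens2 \<Rightarrow> ('c, 'd) tens2" where
  "tensor2_map V W V' W' f h t = (\<lambda>F. if F \<in> bilinear_forms V' W'
     then t (\<lambda>a b. if a \<in> V \<and> b \<in> W then F (f a) (h b) else 0) else 0)"

text \<open>
  For a space \<open>R\<close> of complex functions on a set, \<open>R \<otimes> S\<close> is identified with the space of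
  \<open>S\<close>-valued functions spanned by the functions \<open>x \<mapsto> c(x) u\<close>; see \<open>fun_tensor_iso\<close> below.
\<close>

definition fun_tensor_vec :: "('x \<Rightarrow> complex) \<Rightarrow> 's::complex_vector \<Rightarrow> 'x \<Rightarrow> 's" where
  "fun_tensor_vec c u = (\<lambda>x. c x *\<^sub>C u)"

definition fun_tensor :: "('x \<Rightarrow> complex) set \<Rightarrow> 's::complex_vector set \<Rightarrow> ('x \<Rightarrow> 's) set" where
  "fun_tensor R S = cvec.span {fun_tensor_vec c u | c u. c \<in> R \<and> u \<in> S}"


section \<open>Basic properties of the tensor products\<close>

lemma separating_functional:
  fixes w :: "'w::complex_vector"
  assumes "w \<noteq> 0"
  obtains \<psi> :: "'w \<Rightarrow> complex" where "linear_on UNIV \<psi>" "\<psi> w \<noteq> 0"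
proof -
  have "cvec.independent {w}"
    using assms by simp
  then obtain \<psi> :: "'w \<Rightarrow> complex" where \<psi>: "Vector_Spaces.linear scaleC scaleC \<psi>"
      "\<forall>x\<in>{w}. \<psi> x = (\<lambda>_. 1) x"
    using cvec.linear_independent_extend[of "{w}" "\<lambda>_. 1::complex"] by blast
  interpret l: Vector_Spaces.linear scaleC scaleC \<psi> by (rule \<psi>(1))
  have "linear_on UNIV \<psi>"
    unfolding linear_on_def using l.add l.scale by blast
  with \<psi>(2) that show thesis by simp
qed

lemma span_extension_unique:
  assumes "linear_on (cvec.span X) L" "linear_on (cvec.span X) L'" "\<And>x. x \<in> X \<Longrightarrow> L x = L' x"
    and t: "t \<in> cvec.span X"
  shows "L t = L' t"
proof -
  have "t \<in> cvec.span X \<and> L t = L' t"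
    using t
  proof (induction rule: cvec.span_induct_alt)
    case base
    have "L 0 = 0" "L' 0 = 0"
      using assms(1,2) cvec.span_zero[of X] unfolding linear_on_def
      by (metis cvec.scale_zero_left)+
    then show ?case by (simp add: cvec.span_zero)
  next
    case (step c x y)
    have "x \<in> cvec.span X" using step.hyps by (rule cvec.span_base)
    then show ?case
      using step assms(1-3) unfolding linear_on_def
      by (metis cvec.span_add cvec.span_scale)
  qed
  then show ?thesis ..
qed

lemma span_extension:
  fixes \<tau> :: "'x \<Rightarrow> 'f \<Rightarrow> complex" and B :: "'x \<Rightarrow> 'w::complex_vector"
  assumes rep: "\<And>\<psi> :: 'w \<Rightarrow> complex. linear_on UNIV \<psi> \<Longrightarrow> \<exists>F. \<forall>x\<in>X. \<tau> x F = \<psi> (B x)"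
  shows "\<exists>!L. L \<in> extensional (cvec.span (\<tau> ` X)) \<and> linear_on (cvec.span (\<tau> ` X)) L \<and>
           (\<forall>x\<in>X. L (\<tau> x) = B x)"
proof -
  let ?T = "cvec.span (\<tau> ` X)"
  define Q where "Q t w \<longleftrightarrow>
    (\<forall>\<psi> F. linear_on UNIV \<psi> \<and> (\<forall>x\<in>X. \<tau> x F = \<psi> (B x)) \<longrightarrow> t F = \<psi> w)" for t w
  have uniq: "w = w'" if "Q t w" "Q t w'" for t w w'
  proof (rule ccontr)
    assume "w \<noteq> w'"
    then obtain \<psi> :: "'w \<Rightarrow> complex" where \<psi>: "linear_on UNIV \<psi>" "\<psi> (w - w') \<noteq> 0"
      using separating_functional[of "w - w'"] by auto
    obtain F where "\<forall>x\<in>X. \<tau> x F = \<psi> (B x)" using rep[OF \<psi>(1)] by blast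
    with that \<psi>(1) have "\<psi> w = \<psi> w'" unfolding Q_def by metis
    moreover have "\<psi> w = \<psi> (w - w') + \<psi> w'"
      using \<psi>(1) unfolding linear_on_def by (metis UNIV_I diff_add_cancel)
    ultimately show False using \<psi>(2) by simp
  qed
  have Qadd: "Q (t + t') (w + w')" if Q: "Q t w" "Q t' w'" for t t' w w'
    unfolding Q_def
  proof (intro allI impI)
    fix \<psi> F assume *: "linear_on UNIV \<psi> \<and> (\<forall>x\<in>X. \<tau> x F = \<psi> (B x))"
    then have "t F = \<psi> w" "t' F = \<psi> w'" using Q unfolding Q_def by blast+
    with * show "(t + t') F = \<psi> (w + w')" by (simp add: linear_on_def)
  qed
  have Qscale: "Q (c *\<^sub>C t) (c *\<^sub>C w)" if Q: "Q t w" for c t w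
    unfolding Q_def
  proof (intro allI impI)
    fix \<psi> F assume *: "linear_on UNIV \<psi> \<and> (\<forall>x\<in>X. \<tau> x F = \<psi> (B x))"
    then have "t F = \<psi> w" using Q unfolding Q_def by blast
    with * show "(c *\<^sub>C t) F = \<psi> (c *\<^sub>C w)" by (simp add: linear_on_def)
  qed
  have Q0: "Q 0 0"
    unfolding Q_def
  proof (intro allI impI)
    fix \<psi> F assume *: "linear_on UNIV \<psi> \<and> (\<forall>x\<in>X. \<tau> x F = \<psi> (B x))"
    then have "\<psi> (0 *\<^sub>C 0) = 0 *\<^sub>C \<psi> 0" unfolding linear_on_def by blast
    then show "0 F = \<psi> 0" by simp
  qed
  have Qgen: "Q (\<tau> x) (B x)" if "x \<in> X" for x
    using that unfolding Q_def by blast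
  have ex: "\<exists>w. Q t w" if "t \<in> ?T" for t
    using that
  proof (induction rule: cvec.span_induct_alt)
    case base
    show ?case using Q0 by blast
  next
    case (step c x y)
    then show ?case using Qadd Qscale Qgen by blast
  qed
  define L where "L = (\<lambda>t\<in>?T. THE w. Q t w)"
  have L: "L t = w" if "t \<in> ?T" "Q t w" for t w
    using that uniq unfolding L_def by (simp add: the_equality)
  have QL: "Q t (L t)" if "t \<in> ?T" for t
    using ex[OF that] L[OF that] by auto
  have "L \<in> extensional ?T" by (simp add: L_def)
  moreover have "linear_on ?T L"
    unfolding linear_on_def
  proof safe
    fix t t' assume t: "t \<in> ?T" "t' \<in> ?T"
    show "L (t + t') = L t + L t'"
      by (rule L) (use t in \<open>auto intro: cvec.span_add Qadd QL\<close>)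
  next
    fix c t assume t: "t \<in> ?T"
    show "L (c *\<^sub>C t) = c *\<^sub>C L t"
      by (rule L) (use t in \<open>auto intro: cvec.span_scale Qscale QL\<close>)
  qed
  moreover have "\<forall>x\<in>X. L (\<tau> x) = B x"
    by (intro ballI L Qgen cvec.span_base imageI)
  ultimately have main: "L \<in> extensional ?T \<and> linear_on ?T L \<and> (\<forall>x\<in>X. L (\<tau> x) = B x)"
    by blast
  show ?thesis
  proof (rule ex1I[of _ L])
    fix L' assume L': "L' \<in> extensional ?T \<and> linear_on ?T L' \<and> (\<forall>x\<in>X. L' (\<tau> x) = B x)"
    show "L' = L"
    proof (rule extensionalityI[of _ ?T])
      fix t assume "t \<in> ?T"
      then show "L' t = L t"
        by (rule span_extension_unique[rotated 3]) (use L' main in auto)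
    qed (use L' main in auto)
  qed (rule main)
qed

lemma tensor_vec_in_tensor: "x \<in> Pi\<^sub>E I V \<Longrightarrow> tensor_vec I V x \<in> tensor I V"
  unfolding tensor_def by (rule cvec.span_base) simp

lemma multilinear_on_tensor_vec: "multilinear_on I V (tensor_vec I V)"
  by (auto simp: multilinear_on_def tensor_vec_def linear_on_def fun_eq_iff multilinear_forms_def)

theorem tensor_universal:
  assumes V: "\<And>i. i \<in> I \<Longrightarrow> cvec.subspace (V i)" and B: "multilinear_on I V B"
  shows "\<exists>!L. L \<in> extensional (tensor I V) \<and> linear_on (tensor I V) L \<and>
           (\<forall>x\<in>Pi\<^sub>E I V. L (tensor_vec I V x) = B x)"
  unfolding tensor_def
proof (rule span_extension)
  fix \<psi> :: "'c \<Rightarrow> complex" assume \<psi>: "linear_on UNIV \<psi>"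
  define F where "F = (\<lambda>x. if x \<in> Pi\<^sub>E I V then \<psi> (B x) else 0)"
  have upd: "x(i := a) \<in> Pi\<^sub>E I V" if "x \<in> Pi\<^sub>E I V" "i \<in> I" "a \<in> V i" for x i a
    using that by (auto simp: PiE_iff extensional_def)
  have "linear_on (V i) (\<lambda>a. F (x(i := a)))" if x: "x \<in> Pi\<^sub>E I V" and i: "i \<in> I" for x i
  proof -
    have lin: "linear_on (V i) (\<lambda>a. B (x(i := a)))"
      using B x i unfolding multilinear_on_def by blast
    show ?thesis
      unfolding linear_on_def
    proof safe
      fix a b assume ab: "a \<in> V i" "b \<in> V i"
      then have "a + b \<in> V i" using V[OF i] by (rule_tac cvec.subspace_add)
      then show "F (x(i := a + b)) = F (x(i := a)) + F (x(i := b))"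
        using upd[OF x i] ab lin \<psi> unfolding F_def linear_on_def by simp
    next
      fix c a assume a: "a \<in> V i"
      then have "c *\<^sub>C a \<in> V i" using V[OF i] by (rule_tac cvec.subspace_scale)
      then show "F (x(i := c *\<^sub>C a)) = c *\<^sub>C F (x(i := a))"
        using upd[OF x i] a lin \<psi> unfolding F_def linear_on_def by simp
    qed
  qed
  then have "F \<in> multilinear_forms I V"
    unfolding multilinear_forms_def multilinear_on_def by (simp add: F_def)
  then have "\<forall>x\<in>Pi\<^sub>E I V. tensor_vec I V x F = \<psi> (B x)"
    by (simp add: tensor_vec_def F_def)
  then show "\<exists>F. \<forall>x\<in>Pi\<^sub>E I V. tensor_vec I V x F = \<psi> (B x)" by (rule exI[of _ F])
qed

lemma linear_on_tensor_map: "linear_on U (tensor_map I V W f)"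
  by (auto simp: linear_on_def tensor_map_def fun_eq_iff)

lemma tensor_map_vec:
  fixes V :: "'i \<Rightarrow> 'a::complex_vector set" and W :: "'i \<Rightarrow> 'b::complex_vector set"
  assumes V: "\<And>i. i \<in> I \<Longrightarrow> cvec.subspace (V i)"
    and f: "\<And>i. i \<in> I \<Longrightarrow> linear_on (V i) (f i)" "\<And>i. i \<in> I \<Longrightarrow> f i ` V i \<subseteq> W i"
    and x: "x \<in> Pi\<^sub>E I V"
  shows "tensor_map I V W f (tensor_vec I V x) = tensor_vec I W (\<lambda>i\<in>I. f i (x i))"
proof
  fix F :: "('i \<Rightarrow> 'b) \<Rightarrow> complex"
  let ?F = "\<lambda>x. if x \<in> Pi\<^sub>E I V then F (\<lambda>i\<in>I. f i (x i)) else 0"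
  show "tensor_map I V W f (tensor_vec I V x) F = tensor_vec I W (\<lambda>i\<in>I. f i (x i)) F"
  proof (cases "F \<in> multilinear_forms I W")
    case True
    have "linear_on (V i) (\<lambda>a. ?F (y(i := a)))" if y: "y \<in> Pi\<^sub>E I V" and i: "i \<in> I" for y i
    proof -
      let ?y = "\<lambda>j\<in>I. f j (y j)"
      have "?y \<in> Pi\<^sub>E I W" using y f(2) by (fastforce simp: PiE_iff)
      then have lin: "linear_on (W i) (\<lambda>a. F (?y(i := a)))"
        using True i unfolding multilinear_forms_def multilinear_on_def by blast
      have eq: "?F (y(i := a)) = F (?y(i := f i a))" if "a \<in> V i" for a
      proof -
        have "y(i := a) \<in> Pi\<^sub>E I V" using y i that by (auto simp: PiE_iff extensional_def)
        moreover have "(\<lambda>j\<in>I. f j ((y(i := a)) j)) = ?y(i := f i a)"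
          using i by (auto simp: fun_eq_iff)
        ultimately show ?thesis by simp
      qed
      show ?thesis
        unfolding linear_on_def
      proof (intro conjI ballI allI)
        fix a b assume ab: "a \<in> V i" "b \<in> V i"
        then have "a + b \<in> V i" "f i a \<in> W i" "f i b \<in> W i" "f i (a + b) = f i a + f i b"
          using f(1)[OF i] f(2)[OF i] V[OF i] by (auto simp: linear_on_def cvec.subspace_add)
        then show "?F (y(i := a + b)) = ?F (y(i := a)) + ?F (y(i := b))"
          using lin unfolding linear_on_def eq[OF ab(1)] eq[OF ab(2)] eq[OF \<open>a + b \<in> V i\<close>] by metis
      next
        fix c a assume a: "a \<in> V i"
        then have "c *\<^sub>C a \<in> V i" "f i a \<in> W i" "f i (c *\<^sub>C a) = c *\<^sub>C f i a"
          using f(1)[OF i] f(2)[OF i] V[OF i] by (auto simp: linear_on_def cvec.subspace_scale)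
        then show "?F (y(i := c *\<^sub>C a)) = c *\<^sub>C ?F (y(i := a))"
          using lin unfolding linear_on_def eq[OF a] eq[OF \<open>c *\<^sub>C a \<in> V i\<close>] by metis
      qed
    qed
    then have "?F \<in> multilinear_forms I V"
      unfolding multilinear_forms_def multilinear_on_def by simp
    with True x show ?thesis by (simp add: tensor_map_def tensor_vec_def)
  qed (simp add: tensor_map_def tensor_vec_def)
qed

lemma tensor_functional_dual: "tensor_functional I V \<phi> \<in> dual (tensor I V)"
  unfolding dual_def linear_on_def tensor_functional_def tensor_def
  by (simp add: cvec.span_add cvec.span_scale)

lemma tensor_functional_vec:
  assumes fin: "finite I" and V: "\<And>i. i \<in> I \<Longrightarrow> cvec.subspace (V i)"
    and \<phi>: "\<And>i. i \<in> I \<Longrightarrow> \<phi> i \<in> dual (V i)" and x: "x \<in> Pi\<^sub>E I V"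
  shows "tensor_functional I V \<phi> (tensor_vec I V x) = (\<Prod>i\<in>I. \<phi> i (x i))"
proof -
  let ?F = "\<lambda>x. if x \<in> Pi\<^sub>E I V then \<Prod>i\<in>I. \<phi> i (x i) else 0"
  have "linear_on (V i) (\<lambda>a. ?F (y(i := a)))" if y: "y \<in> Pi\<^sub>E I V" and i: "i \<in> I" for y i
  proof -
    let ?c = "\<Prod>j\<in>I - {i}. \<phi> j (y j)"
    have eq: "?F (y(i := a)) = \<phi> i a * ?c" if "a \<in> V i" for a
    proof -
      have "y(i := a) \<in> Pi\<^sub>E I V" using y i that by (auto simp: PiE_iff extensional_def)
      moreover have "(\<Prod>j\<in>I. \<phi> j ((y(i := a)) j)) = \<phi> i a * ?c"
        using i fin by (subst prod.remove[of I i]) (auto intro!: prod.cong)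
      ultimately show ?thesis by simp
    qed
    have lin: "linear_on (V i) (\<phi> i)" using \<phi>[OF i] by (simp add: dual_def)
    show ?thesis
      unfolding linear_on_def
    proof (intro conjI ballI allI)
      fix a b assume ab: "a \<in> V i" "b \<in> V i"
      have "a + b \<in> V i" using ab V[OF i] by (simp add: cvec.subspace_add)
      moreover have "\<phi> i (a + b) = \<phi> i a + \<phi> i b" using lin ab unfolding linear_on_def by blast
      ultimately show "?F (y(i := a + b)) = ?F (y(i := a)) + ?F (y(i := b))"
        unfolding eq[OF ab(1)] eq[OF ab(2)] eq[OF \<open>a + b \<in> V i\<close>] by (simp add: distrib_right)
    next
      fix c a assume a: "a \<in> V i"
      have "c *\<^sub>C a \<in> V i" using a V[OF i] by (simp add: cvec.subspace_scale)
      moreover have "\<phi> i (c *\<^sub>C a) = c *\<^sub>C \<phi> i a" using lin a unfolding linear_on_def by blast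
      ultimately show "?F (y(i := c *\<^sub>C a)) = c *\<^sub>C ?F (y(i := a))"
        unfolding eq[OF a] eq[OF \<open>c *\<^sub>C a \<in> V i\<close>] by simp
    qed
  qed
  then have "?F \<in> multilinear_forms I V"
    unfolding multilinear_forms_def multilinear_on_def by simp
  with x tensor_vec_in_tensor[OF x] show ?thesis
    by (simp add: tensor_functional_def tensor_vec_def)
qed

lemma tensor2_vec_in_tensor2: "a \<in> V \<Longrightarrow> b \<in> W \<Longrightarrow> tensor2_vec V W a b \<in> tensor2 V W"
  unfolding tensor2_def by (rule cvec.span_base) blast

lemma bilinear_on_tensor2_vec: "bilinear_on V W (tensor2_vec V W)"
  by (auto simp: bilinear_on_def tensor2_vec_def linear_on_def fun_eq_iff bilinear_forms_def)

theorem tensor2_universal: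
  fixes V :: "'a::complex_vector set" and W :: "'b::complex_vector set"
    and B :: "'a \<Rightarrow> 'b \<Rightarrow> 'c::complex_vector"
  assumes V: "cvec.subspace V" and W: "cvec.subspace W" and B: "bilinear_on V W B"
  shows "\<exists>!L. L \<in> extensional (tensor2 V W) \<and> linear_on (tensor2 V W) L \<and>
           (\<forall>a\<in>V. \<forall>b\<in>W. L (tensor2_vec V W a b) = B a b)"
proof -
  let ?\<tau> = "\<lambda>(a, b). tensor2_vec V W a b"
  have T: "tensor2 V W = cvec.span (?\<tau> ` (V \<times> W))"
    unfolding tensor2_def by (rule arg_cong[where f = cvec.span]) auto
  have "\<exists>!L. L \<in> extensional (cvec.span (?\<tau> ` (V \<times> W))) \<and> linear_on (cvec.span (?\<tau> ` (V \<times> W))) L \<and>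
           (\<forall>x\<in>V \<times> W. L (?\<tau> x) = (\<lambda>(a, b). B a b) x)"
  proof (rule span_extension)
    fix \<psi> :: "'c \<Rightarrow> complex" assume \<psi>: "linear_on UNIV \<psi>"
    define F where "F = (\<lambda>a b. if a \<in> V \<and> b \<in> W then \<psi> (B a b) else 0)"
    have "F \<in> bilinear_forms V W"
      using \<psi> B cvec.subspace_add[OF V] cvec.subspace_scale[OF V]
        cvec.subspace_add[OF W] cvec.subspace_scale[OF W]
      unfolding bilinear_forms_def bilinear_on_def linear_on_def F_def by auto
    then show "\<exists>F. \<forall>x\<in>V \<times> W. ?\<tau> x F = \<psi> ((\<lambda>(a, b). B a b) x)"
      by (intro exI[of _ F]) (auto simp: tensor2_vec_def F_def)
  qed
  moreover have "(\<forall>x\<in>V \<times> W. L (?\<tau> x) = (\<lambda>(a, b). B a b) x) \<longleftrightarrow>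
      (\<forall>a\<in>V. \<forall>b\<in>W. L (tensor2_vec V W a b) = B a b)" for L :: "('a, 'b) tens2 \<Rightarrow> 'c"
    by auto
  ultimately show ?thesis unfolding T by simp
qed

lemma linear_on_tensor2_map: "linear_on U (tensor2_map V W V' W' f h)"
  by (auto simp: linear_on_def tensor2_map_def fun_eq_iff)

lemma tensor2_map_vec:
  fixes V' :: "'c::complex_vector set" and W' :: "'d::complex_vector set"
  assumes V: "cvec.subspace V" and W: "cvec.subspace W"
    and f: "linear_on V f" "f ` V \<subseteq> V'" and h: "linear_on W h" "h ` W \<subseteq> W'"
    and a: "a \<in> V" and b: "b \<in> W"
  shows "tensor2_map V W V' W' f h (tensor2_vec V W a b) = tensor2_vec V' W' (f a) (h b)"
proof
  fix F :: "'c \<Rightarrow> 'd \<Rightarrow> complex"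
  let ?F = "\<lambda>a b. if a \<in> V \<and> b \<in> W then F (f a) (h b) else 0"
  have "?F \<in> bilinear_forms V W" if "F \<in> bilinear_forms V' W'"
    using that f h cvec.subspace_add[OF V] cvec.subspace_scale[OF V]
      cvec.subspace_add[OF W] cvec.subspace_scale[OF W]
    unfolding bilinear_forms_def bilinear_on_def linear_on_def by (auto simp: image_subset_iff)
  with a b show "tensor2_map V W V' W' f h (tensor2_vec V W a b) F = tensor2_vec V' W' (f a) (h b) F"
    by (simp add: tensor2_map_def tensor2_vec_def)
qed

lemma tensor2_basis_expansion:
  assumes V: "cvec.subspace V" and B: "cvec.span B = W" and t: "t \<in> tensor2 V W"
  shows "\<exists>D c. finite D \<and> D \<subseteq> B \<and> c ` D \<subseteq> V \<and> t = (\<Sum>d\<in>D. tensor2_vec V W (c d) d)"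
proof -
  let ?\<tau> = "tensor2_vec V W"
  define P where "P t \<longleftrightarrow> (\<exists>D c. finite D \<and> D \<subseteq> B \<and> c ` D \<subseteq> V \<and> t = (\<Sum>d\<in>D. ?\<tau> (c d) d))" for t
  have PI: "P t" if "finite D" "D \<subseteq> B" "c ` D \<subseteq> V" "t = (\<Sum>d\<in>D. ?\<tau> (c d) d)" for t D c
    unfolding P_def using that by blast
  have V0: "0 \<in> V" by (rule cvec.subspace_0[OF V])
  have BW: "B \<subseteq> W" using B cvec.span_superset by blast
  have addl: "?\<tau> (a + a') b = ?\<tau> a b + ?\<tau> a' b" if "a \<in> V" "a' \<in> V" "b \<in> W" for a a' b
    using bilinear_on_tensor2_vec[of V W] that unfolding bilinear_on_def linear_on_def by blast
  have scl: "?\<tau> (c *\<^sub>C a) b = c *\<^sub>C ?\<tau> a b" if "a \<in> V" "b \<in> W" for a b c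
    using bilinear_on_tensor2_vec[of V W] that unfolding bilinear_on_def linear_on_def by blast
  have addr: "?\<tau> a (b + b') = ?\<tau> a b + ?\<tau> a b'" if "a \<in> V" "b \<in> W" "b' \<in> W" for a b b'
    using bilinear_on_tensor2_vec[of V W] that unfolding bilinear_on_def linear_on_def by blast
  have scr: "?\<tau> a (c *\<^sub>C b) = c *\<^sub>C ?\<tau> a b" if "a \<in> V" "b \<in> W" for a b c
    using bilinear_on_tensor2_vec[of V W] that unfolding bilinear_on_def linear_on_def by blast
  have \<tau>0: "?\<tau> 0 b = 0" if "b \<in> W" for b
    using scl[OF V0 that, of 0] by simp
  have Padd: "P (t + t')" if "P t" "P t'" for t t'
  proof -
    obtain D c where D: "finite D" "D \<subseteq> B" "c ` D \<subseteq> V" "t = (\<Sum>d\<in>D. ?\<tau> (c d) d)"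
      using \<open>P t\<close> unfolding P_def by blast
    obtain D' c' where D': "finite D'" "D' \<subseteq> B" "c' ` D' \<subseteq> V" "t' = (\<Sum>d\<in>D'. ?\<tau> (c' d) d)"
      using \<open>P t'\<close> unfolding P_def by blast
    define e where "e d = (if d \<in> D then c d else 0)" for d
    define e' where "e' d = (if d \<in> D' then c' d else 0)" for d
    have e: "e d \<in> V" "e' d \<in> V" for d
      using D(3) D'(3) V0 unfolding e_def e'_def by auto
    have "t = (\<Sum>d\<in>D \<union> D'. ?\<tau> (e d) d)"
      unfolding D(4) using D D' BW
      by (intro sum.mono_neutral_cong_left) (auto simp: e_def \<tau>0 subset_iff)
    moreover have "t' = (\<Sum>d\<in>D \<union> D'. ?\<tau> (e' d) d)"
      unfolding D'(4) using D D' BW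
      by (intro sum.mono_neutral_cong_left) (auto simp: e'_def \<tau>0 subset_iff)
    ultimately have "t + t' = (\<Sum>d\<in>D \<union> D'. ?\<tau> (e d) d + ?\<tau> (e' d) d)"
      by (simp only: sum.distrib)
    also have "\<dots> = (\<Sum>d\<in>D \<union> D'. ?\<tau> (e d + e' d) d)"
      using D(2) D'(2) BW e by (intro sum.cong refl addl[symmetric]) auto
    finally have "t + t' = (\<Sum>d\<in>D \<union> D'. ?\<tau> (e d + e' d) d)" .
    moreover have "(\<lambda>d. e d + e' d) ` (D \<union> D') \<subseteq> V"
      using e cvec.subspace_add[OF V] by blast
    ultimately show ?thesis
      using D(1,2) D'(1,2) by (intro PI[of "D \<union> D'" "\<lambda>d. e d + e' d"]) blast+
  qed
  have Pscale: "P (k *\<^sub>C t)" if "P t" for k t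
  proof -
    obtain D c where D: "finite D" "D \<subseteq> B" "c ` D \<subseteq> V" "t = (\<Sum>d\<in>D. ?\<tau> (c d) d)"
      using \<open>P t\<close> unfolding P_def by blast
    have "k *\<^sub>C t = (\<Sum>d\<in>D. ?\<tau> (k *\<^sub>C c d) d)"
      unfolding D(4) cvec.scale_sum_right using D BW
      by (intro sum.cong refl scl[symmetric]) auto
    moreover have "(\<lambda>d. k *\<^sub>C c d) ` D \<subseteq> V"
      using D(3) cvec.subspace_scale[OF V] by blast
    ultimately show ?thesis
      using D(1,2) by (intro PI[of D "\<lambda>d. k *\<^sub>C c d"])
  qed
  have P0: "P 0"
    by (rule PI[of "{}"]) (simp_all only: finite.emptyI empty_subsetI image_empty sum.empty)
  have Pgen: "P (?\<tau> a b)" if a: "a \<in> V" and b: "b \<in> W" for a b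
  proof -
    have "b \<in> cvec.span B" using b B by simp
    then have "b \<in> W \<and> P (?\<tau> a b)"
    proof (induction rule: cvec.span_induct_alt)
      case base
      have "0 \<in> W" using B cvec.span_zero by blast
      then have "?\<tau> a 0 = 0" using scr[OF a, of 0 0] by simp
      with P0 \<open>0 \<in> W\<close> show ?case by (simp only:)
    next
      case (step k x y)
      have x: "x \<in> W" using step BW by blast
      have kx: "k *\<^sub>C x \<in> W" using x B cvec.span_scale by blast
      have "P (?\<tau> a x)"
        using a step by (intro PI[of "{x}" "\<lambda>_. a"]) auto
      then have "P (k *\<^sub>C ?\<tau> a x + ?\<tau> a y)" using Padd Pscale step by blast
      moreover have "?\<tau> a (k *\<^sub>C x + y) = k *\<^sub>C ?\<tau> a x + ?\<tau> a y"
        using addr[OF a kx] scr[OF a x] step by simp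
      moreover have "k *\<^sub>C x + y \<in> W" using kx step B cvec.span_add by blast
      ultimately show ?case by (simp only:)
    qed
    then show ?thesis ..
  qed
  have "P t"
    using t unfolding tensor2_def
  proof (induction rule: cvec.span_induct_alt)
    case base
    show ?case by (rule P0)
  next
    case (step k x y)
    then obtain a b where "x = ?\<tau> a b" "a \<in> V" "b \<in> W" by blast
    then have "P (k *\<^sub>C x)" using Pscale Pgen by blast
    with step show ?case using Padd by blast
  qed
  then show ?thesis unfolding P_def .
qed

theorem fun_tensor_iso:
  fixes R :: "('x \<Rightarrow> complex) set" and S :: "'s::complex_vector set"
  assumes R: "cvec.subspace R" and S: "cvec.subspace S"
  shows "\<exists>L. linear_iso (tensor2 R S) (fun_tensor R S) L \<and>
           (\<forall>c\<in>R. \<forall>u\<in>S. L (tensor2_vec R S c u) = fun_tensor_vec c u)"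
proof -
  have "bilinear_on R S fun_tensor_vec"
    by (auto simp: bilinear_on_def linear_on_def fun_tensor_vec_def fun_eq_iff
        scaleC_add_left scaleC_add_right scaleC_scaleC mult.commute)
  then obtain L where lin: "linear_on (tensor2 R S) L"
    and L: "\<forall>c\<in>R. \<forall>u\<in>S. L (tensor2_vec R S c u) = fun_tensor_vec c u"
    using tensor2_universal[OF R S] by blast
  have sub: "cvec.subspace (tensor2 R S)" unfolding tensor2_def by simp
  have L0: "L 0 = 0"
    using lin cvec.subspace_0[OF sub] unfolding linear_on_def by (metis cvec.scale_zero_left)
  have Lsum: "sum f D \<in> tensor2 R S \<and> L (sum f D) = (\<Sum>d\<in>D. L (f d))"
    if "finite D" "f ` D \<subseteq> tensor2 R S" for f and D :: "'s set"
    using that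
  proof (induction D rule: finite_induct)
    case empty
    show ?case unfolding sum.empty using L0 cvec.subspace_0[OF sub] by blast
  next
    case (insert d D)
    then have d: "f d \<in> tensor2 R S" and D: "sum f D \<in> tensor2 R S"
      and LD: "L (sum f D) = (\<Sum>d\<in>D. L (f d))"
      by blast+
    have "L (f d + sum f D) = L (f d) + L (sum f D)"
      using lin d D unfolding linear_on_def by blast
    then show ?case
      unfolding sum.insert[OF insert.hyps] LD using cvec.subspace_add[OF sub d D] by blast
  qed
  obtain B where "B \<subseteq> S" "cvec.independent B" "S \<subseteq> cvec.span B"
    using cvec.maximal_independent_subset by blast
  then have B: "cvec.independent B" "cvec.span B = S"
    using cvec.span_minimal[OF _ S] by auto
  have ker: "t = 0" if t: "t \<in> tensor2 R S" and Lt: "L t = 0" for t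
  proof -
    obtain D c where D: "finite D" "D \<subseteq> B" "c ` D \<subseteq> R" "t = (\<Sum>d\<in>D. tensor2_vec R S (c d) d)"
      using tensor2_basis_expansion[OF R B(2) t] by blast
    have DS: "D \<subseteq> S" using D(2) B(2) cvec.span_superset by blast
    have "(\<Sum>d\<in>D. fun_tensor_vec (c d) d) = (\<Sum>d\<in>D. L (tensor2_vec R S (c d) d))"
      using L D DS by (intro sum.cong refl) (auto simp: subset_iff)
    also have "\<dots> = L t"
      unfolding D(4) using D DS
      by (intro Lsum[THEN conjunct2, symmetric]) (auto intro!: tensor2_vec_in_tensor2)
    finally have *: "(\<Sum>d\<in>D. fun_tensor_vec (c d) d) x = 0" for x
      using Lt by simp
    have sum_app: "(\<Sum>d\<in>D. fun_tensor_vec (c d) d) x = (\<Sum>d\<in>D. c d x *\<^sub>C d)" for x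
      using D(1) by (induction D rule: finite_induct) (auto simp: fun_tensor_vec_def)
    have indep: "cvec.independent D" using B(1) D(2) cvec.independent_mono by blast
    have "c d = 0" if "d \<in> D" for d
    proof
      fix x
      show "c d x = 0 x"
        using cvec.independentD[OF indep D(1) subset_refl _ that, of "\<lambda>d. c d x"] * sum_app by simp
    qed
    moreover have "tensor2_vec R S 0 d = 0" if "d \<in> D" for d
    proof -
      have "tensor2_vec R S (0 *\<^sub>C 0) d = 0 *\<^sub>C tensor2_vec R S 0 d"
        using bilinear_on_tensor2_vec[of R S] cvec.subspace_0[OF R] that DS
        unfolding bilinear_on_def linear_on_def by blast
      then show ?thesis by simp
    qed
    ultimately show "t = 0" unfolding D(4) by simp
  qed
  have "inj_on L (tensor2 R S)"
  proof (rule inj_onI)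
    fix t t' assume t: "t \<in> tensor2 R S" "t' \<in> tensor2 R S" "L t = L t'"
    have d: "t - t' \<in> tensor2 R S" using t sub by (simp add: cvec.subspace_diff)
    have "L t = L (t - t') + L t'"
      using lin d t(2) unfolding linear_on_def by (metis diff_add_cancel)
    with t(3) ker[OF d] show "t = t'" by simp
  qed
  moreover have "L ` tensor2 R S = fun_tensor R S"
  proof
    show "L ` tensor2 R S \<subseteq> fun_tensor R S"
    proof (rule image_subsetI)
      fix t assume "t \<in> tensor2 R S"
      then have "t \<in> tensor2 R S \<and> L t \<in> fun_tensor R S"
        unfolding tensor2_def
      proof (induction rule: cvec.span_induct_alt)
        case base
        show ?case
          unfolding L0 fun_tensor_def by (rule conjI; rule cvec.span_zero)
      next
        case (step k x y)
        then obtain a b where x: "x = tensor2_vec R S a b" "a \<in> R" "b \<in> S" by blast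
        have xT: "x \<in> tensor2 R S" using x tensor2_vec_in_tensor2 by blast
        have yT: "y \<in> tensor2 R S" using step unfolding tensor2_def by blast
        have kT: "k *\<^sub>C x \<in> tensor2 R S" using xT sub by (simp add: cvec.subspace_scale)
        have "L (k *\<^sub>C x + y) = k *\<^sub>C fun_tensor_vec a b + L y"
          using lin xT yT kT L x unfolding linear_on_def by simp
        moreover have "fun_tensor_vec a b \<in> fun_tensor R S"
          unfolding fun_tensor_def by (rule cvec.span_base) (use x in blast)
        ultimately have "L (k *\<^sub>C x + y) \<in> fun_tensor R S"
          using step unfolding fun_tensor_def by (simp add: cvec.span_add cvec.span_scale)
        then show ?case
          using cvec.subspace_add[OF sub kT yT] unfolding tensor2_def by blast
      qed
      then show "L t \<in> fun_tensor R S" ..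
    qed
    show "fun_tensor R S \<subseteq> L ` tensor2 R S"
    proof
      fix h assume "h \<in> fun_tensor R S"
      then show "h \<in> L ` tensor2 R S"
        unfolding fun_tensor_def
      proof (induction rule: cvec.span_induct_alt)
        case base
        show ?case using imageI[OF cvec.subspace_0[OF sub], of L] unfolding L0 .
      next
        case (step k x y)
        then obtain a b where x: "x = fun_tensor_vec a b" "a \<in> R" "b \<in> S" by blast
        obtain t where t: "t \<in> tensor2 R S" "y = L t" using step by blast
        have \<tau>: "tensor2_vec R S a b \<in> tensor2 R S" using x tensor2_vec_in_tensor2 by blast
        have kT: "k *\<^sub>C tensor2_vec R S a b \<in> tensor2 R S"
          using \<tau> sub by (simp add: cvec.subspace_scale)
        have "L (k *\<^sub>C tensor2_vec R S a b + t) = k *\<^sub>C x + y"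
          using lin \<tau> t kT L x unfolding linear_on_def by simp
        then show ?case
          using imageI[OF cvec.subspace_add[OF sub kT t(1)], of L] by (simp only:)
      qed
    qed
  qed
  ultimately show ?thesis
    using lin L unfolding linear_iso_def bij_betw_def by blast
qed


section \<open>Lie groups\<close>

text \<open>\<open>C\<^sup>k\<close> functions on an open subset \<open>U\<close> of \<open>\<real>\<^sup>n\<close>, by iterated partial derivatives. Points of
  \<open>\<real>\<^sup>n\<close> are sequences vanishing from index \<open>n\<close> on, as in \<^const>\<open>Euclidean_space\<close>, which allows
  dimension 0.\<close>

primrec Ck_on :: "nat \<Rightarrow> nat \<Rightarrow> (nat \<Rightarrow> real) set \<Rightarrow> ((nat \<Rightarrow> real) \<Rightarrow> real) \<Rightarrow> bool" where
  "Ck_on n 0 U f \<longleftrightarrow> continuous_map (subtopology (Euclidean_space n) U) euclideanreal f"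
| "Ck_on n (Suc k) U f \<longleftrightarrow>
     continuous_map (subtopology (Euclidean_space n) U) euclideanreal f \<and>
     (\<forall>i<n. \<exists>f'. (\<forall>x\<in>U. ((\<lambda>y. f (x(i := y))) has_real_derivative f' x) (at (x i))) \<and> Ck_on n k U f')"

definition smooth_on ::
    "nat \<Rightarrow> nat \<Rightarrow> (nat \<Rightarrow> real) set \<Rightarrow> ((nat \<Rightarrow> real) \<Rightarrow> (nat \<Rightarrow> real)) \<Rightarrow> bool" where
  "smooth_on n m U F \<longleftrightarrow> (\<forall>j<m. \<forall>k. Ck_on n k U (\<lambda>x. F x j))"

definition chart :: "nat \<Rightarrow> 'p topology \<Rightarrow> 'p set \<times> ('p \<Rightarrow> nat \<Rightarrow> real) \<Rightarrow> bool" where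
  "chart n T = (\<lambda>(U, x). openin T U \<and> openin (Euclidean_space n) (x ` U) \<and>
     homeomorphic_map (subtopology T U) (subtopology (Euclidean_space n) (x ` U)) x)"

definition smooth_atlas :: "nat \<Rightarrow> 'p topology \<Rightarrow> ('p set \<times> ('p \<Rightarrow> nat \<Rightarrow> real)) set \<Rightarrow> bool" where
  "smooth_atlas n T A \<longleftrightarrow>
     (\<forall>c\<in>A. chart n T c) \<and> (\<Union>c\<in>A. fst c) = topspace T \<and>
     (\<forall>(U, x)\<in>A. \<forall>(U', x')\<in>A. smooth_on n n (x ` (U \<inter> U')) (\<lambda>p. x' (inv_into U x p)))"

text \<open>A point \<open>z\<close> of \<open>\<real>\<^sup>2\<^sup>n\<close> is split into two points of \<open>\<real>\<^sup>n\<close>, giving product charts for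
  the smoothness of the multiplication.\<close>

definition first_half :: "nat \<Rightarrow> (nat \<Rightarrow> real) \<Rightarrow> nat \<Rightarrow> real" where
  "first_half n z = (\<lambda>i. if i < n then z i else 0)"

definition second_half :: "nat \<Rightarrow> (nat \<Rightarrow> real) \<Rightarrow> nat \<Rightarrow> real" where
  "second_half n z = (\<lambda>i. if i < n then z (n + i) else 0)"

definition lie_group :: "'g monoid \<Rightarrow> 'g topology \<Rightarrow> bool" where
  "lie_group G T \<longleftrightarrow>
     group G \<and> topspace T = carrier G \<and> Hausdorff_space T \<and> second_countable T \<and>
     continuous_map (prod_topology T T) T (\<lambda>(a, b). a \<otimes>\<^bsub>G\<^esub> b) \<and>
     continuous_map T T (\<lambda>a. inv\<^bsub>G\<^esub> a) \<and>
     (\<exists>n A. smooth_atlas n T A \<and>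
        (\<forall>(U, x)\<in>A. \<forall>(V, y)\<in>A. \<forall>(W, z)\<in>A.
           let p = \<lambda>q. inv_into U x (first_half n q) \<otimes>\<^bsub>G\<^esub> inv_into V y (second_half n q)
           in smooth_on (2 * n) n
                {q \<in> topspace (Euclidean_space (2 * n)).
                   first_half n q \<in> x ` U \<and> second_half n q \<in> y ` V \<and> p q \<in> W}
                (\<lambda>q. z (p q))) \<and>
        (\<forall>(U, x)\<in>A. \<forall>(V, y)\<in>A.
           let p = \<lambda>q. inv\<^bsub>G\<^esub> (inv_into U x q)
           in smooth_on n n {q \<in> x ` U. p q \<in> V} (\<lambda>q. y (p q))))"


section \<open>Representations\<close>

definition GL :: "'a::complex_vector set \<Rightarrow> ('a \<Rightarrow> 'a) monoid" where
  "GL V = BijGroup V \<lparr>carrier := {f \<in> Bij V. linear_on V f}\<rparr>"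

definition group_rep ::
    "'g monoid \<Rightarrow> 'a::complex_vector set \<Rightarrow> ('g \<Rightarrow> 'a \<Rightarrow> 'a) \<Rightarrow> bool" where
  "group_rep G V \<rho> \<longleftrightarrow> cvec.subspace V \<and> \<rho> \<in> hom G (GL V)"

definition irreducible_rep ::
    "'g monoid \<Rightarrow> 'a::complex_vector set \<Rightarrow> ('g \<Rightarrow> 'a \<Rightarrow> 'a) \<Rightarrow> bool" where
  "irreducible_rep G V \<rho> \<longleftrightarrow> group_rep G V \<rho> \<and> V \<noteq> {0} \<and>
     (\<forall>U. cvec.subspace U \<and> U \<subseteq> V \<and> (\<forall>g\<in>carrier G. \<rho> g ` U \<subseteq> U) \<longrightarrow> U = {0} \<or> U = V)"

text \<open>The vector space topology of a finite dimensional \<open>V\<close>: the coarsest one for which all linear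
  functionals are continuous.\<close>

definition fin_dim_topology :: "'a::complex_vector set \<Rightarrow> 'a topology" where
  "fin_dim_topology V =
     topology_generated_by {{x \<in> V. \<phi> x \<in> U} | \<phi> U. \<phi> \<in> dual V \<and> open U}"

text \<open>The topology of pointwise convergence on \<open>GL(V)\<close>, which for finite dimensional \<open>V\<close> is its usual
  topology.\<close>

definition GL_topology :: "'a::complex_vector set \<Rightarrow> ('a \<Rightarrow> 'a) topology" where
  "GL_topology V = subtopology (product_topology (\<lambda>_. fin_dim_topology V) V) (carrier (GL V))"

definition dual_rep ::
    "'g monoid \<Rightarrow> 'a::complex_vector set \<Rightarrow> ('g \<Rightarrow> 'a \<Rightarrow> 'a) \<Rightarrow>
     'g \<Rightarrow> ('a \<Rightarrow> complex) \<Rightarrow> ('a \<Rightarrow> complex)" where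
  "dual_rep G V \<rho> g = (\<lambda>\<phi>\<in>dual V. \<lambda>x. if x \<in> V then \<phi> (\<rho> (inv\<^bsub>G\<^esub> g) x) else 0)"

definition tensor_rep ::
    "'i set \<Rightarrow> ('i \<Rightarrow> 'a::complex_vector set) \<Rightarrow> ('i \<Rightarrow> 'g \<Rightarrow> 'a \<Rightarrow> 'a) \<Rightarrow>
     ('i \<Rightarrow> 'g) \<Rightarrow> ('i, 'a) tens \<Rightarrow> ('i, 'a) tens" where
  "tensor_rep I V \<rho> g = tensor_map I V V (\<lambda>i. \<rho> i (g i))"

definition invariants :: "'k set \<Rightarrow> 'a set \<Rightarrow> ('k \<Rightarrow> 'a \<Rightarrow> 'a) \<Rightarrow> 'a set" where
  "invariants H X act = {x \<in> X. \<forall>k\<in>H. act k x = x}"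


section \<open>Representations on a graph\<close>

text \<open>\<open>s\<close> and \<open>t\<close> are \<^const>\<open>tail\<close> and \<^const>\<open>head\<close>, so \<open>S(v|s)\<close> and \<open>S(v|t)\<close> are
  \<^const>\<open>out_arcs\<close> and \<^const>\<open>in_arcs\<close>.\<close>

definition edge_group :: "('v, 'e) pre_digraph \<Rightarrow> 'g monoid \<Rightarrow> ('e \<Rightarrow> 'g) monoid" where
  "edge_group \<Gamma> G = product_group (arcs \<Gamma>) (\<lambda>_. G)"

definition vertex_group ::
    "('v, 'e) pre_digraph \<Rightarrow> 'g monoid \<Rightarrow> ('v \<Rightarrow> 'g set) \<Rightarrow> ('v \<Rightarrow> 'g) monoid" where
  "vertex_group \<Gamma> G K = product_group (verts \<Gamma>) (\<lambda>v. G\<lparr>carrier := K v\<rparr>)"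

definition edge_action ::
    "('v, 'e) pre_digraph \<Rightarrow> 'g monoid \<Rightarrow> ('v \<Rightarrow> 'g) \<Rightarrow> ('e \<Rightarrow> 'g) \<Rightarrow> ('e \<Rightarrow> 'g)" where
  "edge_action \<Gamma> G k g = (\<lambda>e\<in>arcs \<Gamma>. k (tail \<Gamma> e) \<otimes>\<^bsub>G\<^esub> g e \<otimes>\<^bsub>G\<^esub> inv\<^bsub>G\<^esub> (k (head \<Gamma> e)))"

definition matrix_coeff ::
    "('v, 'e) pre_digraph \<Rightarrow> 'g monoid \<Rightarrow> ('e \<Rightarrow> 'm::complex_vector set) \<Rightarrow> ('e \<Rightarrow> 'g \<Rightarrow> 'm \<Rightarrow> 'm) \<Rightarrow>
     (('e, 'm) tens \<Rightarrow> complex) \<Rightarrow> ('e, 'm) tens \<Rightarrow> ('e \<Rightarrow> 'g) \<Rightarrow> complex" where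
  "matrix_coeff \<Gamma> G M \<pi> \<phi> m =
     (\<lambda>g. if g \<in> carrier (edge_group \<Gamma> G) then \<phi> (tensor_rep (arcs \<Gamma>) M \<pi> g m) else 0)"

definition matrix_coeff_space ::
    "('v, 'e) pre_digraph \<Rightarrow> 'g monoid \<Rightarrow> ('e \<Rightarrow> 'm::complex_vector set) \<Rightarrow> ('e \<Rightarrow> 'g \<Rightarrow> 'm \<Rightarrow> 'm) \<Rightarrow>
     (('e \<Rightarrow> 'g) \<Rightarrow> complex) set" where
  "matrix_coeff_space \<Gamma> G M \<pi> = cvec.span {matrix_coeff \<Gamma> G M \<pi> \<phi> m | \<phi> m.
     \<phi> \<in> dual (tensor (arcs \<Gamma>) M) \<and> m \<in> tensor (arcs \<Gamma>) M}"

definition target_space ::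
    "('v, 'e) pre_digraph \<Rightarrow> 'g monoid \<Rightarrow> ('e \<Rightarrow> 'm::complex_vector set) \<Rightarrow> ('e \<Rightarrow> 'g \<Rightarrow> 'm \<Rightarrow> 'm) \<Rightarrow>
     ('v \<Rightarrow> 's::complex_vector set) \<Rightarrow> (('e \<Rightarrow> 'g) \<Rightarrow> ('v, 's) tens) set" where
  "target_space \<Gamma> G M \<pi> S = fun_tensor (matrix_coeff_space \<Gamma> G M \<pi>) (tensor (verts \<Gamma>) S)"

definition target_action ::
    "('v, 'e) pre_digraph \<Rightarrow> 'g monoid \<Rightarrow> ('v \<Rightarrow> 'g set) \<Rightarrow>
     ('v \<Rightarrow> 's::complex_vector set) \<Rightarrow> ('v \<Rightarrow> 'g \<Rightarrow> 's \<Rightarrow> 's) \<Rightarrow>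
     ('v \<Rightarrow> 'g) \<Rightarrow> (('e \<Rightarrow> 'g) \<Rightarrow> ('v, 's) tens) \<Rightarrow> ('e \<Rightarrow> 'g) \<Rightarrow> ('v, 's) tens" where
  "target_action \<Gamma> G K S \<sigma> k f =
     (\<lambda>g. if g \<in> carrier (edge_group \<Gamma> G)
        then tensor_rep (verts \<Gamma>) S \<sigma> k (f (edge_action \<Gamma> G (inv\<^bsub>vertex_group \<Gamma> G K\<^esub> k) g))
        else 0)"

type_synonym ('e, 'm) star_tens = "(('e, 'm \<Rightarrow> complex) tens, ('e, 'm) tens) tens2"

definition star_space ::
    "('v, 'e) pre_digraph \<Rightarrow> ('e \<Rightarrow> 'm::complex_vector set) \<Rightarrow> 'v \<Rightarrow> ('e, 'm) star_tens set" where
  "star_space \<Gamma> M v =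
     tensor2 (tensor (out_arcs \<Gamma> v) (\<lambda>e. dual (M e))) (tensor (in_arcs \<Gamma> v) M)"

definition star_action ::
    "('v, 'e) pre_digraph \<Rightarrow> 'g monoid \<Rightarrow> ('e \<Rightarrow> 'm::complex_vector set) \<Rightarrow> ('e \<Rightarrow> 'g \<Rightarrow> 'm \<Rightarrow> 'm) \<Rightarrow>
     'v \<Rightarrow> 'g \<Rightarrow> ('e, 'm) star_tens \<Rightarrow> ('e, 'm) star_tens" where
  "star_action \<Gamma> G M \<pi> v k =
     (let A = tensor (out_arcs \<Gamma> v) (\<lambda>e. dual (M e)); B = tensor (in_arcs \<Gamma> v) M in
      tensor2_map A B A B
        (tensor_rep (out_arcs \<Gamma> v) (\<lambda>e. dual (M e)) (\<lambda>e. dual_rep G (M e) (\<pi> e)) (\<lambda>_. k))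
        (tensor_rep (in_arcs \<Gamma> v) M \<pi> (\<lambda>_. k)))"

definition vertex_space ::
    "('v, 'e) pre_digraph \<Rightarrow> ('e \<Rightarrow> 'm::complex_vector set) \<Rightarrow> ('v \<Rightarrow> 's::complex_vector set) \<Rightarrow>
     'v \<Rightarrow> (('e, 'm) star_tens, 's) tens2 set" where
  "vertex_space \<Gamma> M S v = tensor2 (star_space \<Gamma> M v) (S v)"

definition vertex_action ::
    "('v, 'e) pre_digraph \<Rightarrow> 'g monoid \<Rightarrow> ('e \<Rightarrow> 'm::complex_vector set) \<Rightarrow> ('e \<Rightarrow> 'g \<Rightarrow> 'm \<Rightarrow> 'm) \<Rightarrow>
     ('v \<Rightarrow> 's::complex_vector set) \<Rightarrow> ('v \<Rightarrow> 'g \<Rightarrow> 's \<Rightarrow> 's) \<Rightarrow>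
     'v \<Rightarrow> 'g \<Rightarrow> (('e, 'm) star_tens, 's) tens2 \<Rightarrow> (('e, 'm) star_tens, 's) tens2" where
  "vertex_action \<Gamma> G M \<pi> S \<sigma> v k =
     tensor2_map (star_space \<Gamma> M v) (S v) (star_space \<Gamma> M v) (S v)
       (star_action \<Gamma> G M \<pi> v k) (\<sigma> v k)"

definition vertex_vec ::
    "('v, 'e) pre_digraph \<Rightarrow> ('e \<Rightarrow> 'm::complex_vector set) \<Rightarrow> ('v \<Rightarrow> 's::complex_vector set) \<Rightarrow>
     ('e \<Rightarrow> 'm \<Rightarrow> complex) \<Rightarrow> ('e \<Rightarrow> 'm) \<Rightarrow> ('v \<Rightarrow> 's) \<Rightarrow> 'v \<Rightarrow> (('e, 'm) star_tens, 's) tens2" where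
  "vertex_vec \<Gamma> M S \<phi> m u v =
     tensor2_vec (star_space \<Gamma> M v) (S v)
       (tensor2_vec (tensor (out_arcs \<Gamma> v) (\<lambda>e. dual (M e))) (tensor (in_arcs \<Gamma> v) M)
          (tensor_vec (out_arcs \<Gamma> v) (\<lambda>e. dual (M e)) (restrict \<phi> (out_arcs \<Gamma> v)))
          (tensor_vec (in_arcs \<Gamma> v) M (restrict m (in_arcs \<Gamma> v))))
       (u v)"

definition source_space ::
    "('v, 'e) pre_digraph \<Rightarrow> ('e \<Rightarrow> 'm::complex_vector set) \<Rightarrow> ('v \<Rightarrow> 's::complex_vector set) \<Rightarrow>
     ('v, (('e, 'm) star_tens, 's) tens2) tens set" where
  "source_space \<Gamma> M S = tensor (verts \<Gamma>) (vertex_space \<Gamma> M S)"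

definition source_action ::
    "('v, 'e) pre_digraph \<Rightarrow> 'g monoid \<Rightarrow> ('e \<Rightarrow> 'm::complex_vector set) \<Rightarrow> ('e \<Rightarrow> 'g \<Rightarrow> 'm \<Rightarrow> 'm) \<Rightarrow>
     ('v \<Rightarrow> 's::complex_vector set) \<Rightarrow> ('v \<Rightarrow> 'g \<Rightarrow> 's \<Rightarrow> 's) \<Rightarrow> ('v \<Rightarrow> 'g) \<Rightarrow>
     ('v, (('e, 'm) star_tens, 's) tens2) tens \<Rightarrow> ('v, (('e, 'm) star_tens, 's) tens2) tens" where
  "source_action \<Gamma> G M \<pi> S \<sigma> = tensor_rep (verts \<Gamma>) (vertex_space \<Gamma> M S) (vertex_action \<Gamma> G M \<pi> S \<sigma>)"

definition vertex_invariants ::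
    "('v, 'e) pre_digraph \<Rightarrow> 'g monoid \<Rightarrow> ('v \<Rightarrow> 'g set) \<Rightarrow> ('e \<Rightarrow> 'm::complex_vector set) \<Rightarrow>
     ('e \<Rightarrow> 'g \<Rightarrow> 'm \<Rightarrow> 'm) \<Rightarrow> ('v \<Rightarrow> 's::complex_vector set) \<Rightarrow> ('v \<Rightarrow> 'g \<Rightarrow> 's \<Rightarrow> 's) \<Rightarrow>
     'v \<Rightarrow> (('e, 'm) star_tens, 's) tens2 set" where
  "vertex_invariants \<Gamma> G K M \<pi> S \<sigma> v =
     invariants (K v) (vertex_space \<Gamma> M S v) (vertex_action \<Gamma> G M \<pi> S \<sigma> v)"

text \<open>The linear map \<open>\<Psi>\<^sup>\<pi>\<close>, as a function undefined outside its domain, characterised by its values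
  on pure tensors.\<close>

definition is_Psi ::
    "('v, 'e) pre_digraph \<Rightarrow> 'g monoid \<Rightarrow> ('e \<Rightarrow> 'm::complex_vector set) \<Rightarrow> ('e \<Rightarrow> 'g \<Rightarrow> 'm \<Rightarrow> 'm) \<Rightarrow>
     ('v \<Rightarrow> 's::complex_vector set) \<Rightarrow>
     (('v, (('e, 'm) star_tens, 's) tens2) tens \<Rightarrow> ('e \<Rightarrow> 'g) \<Rightarrow> ('v, 's) tens) \<Rightarrow> bool" where
  "is_Psi \<Gamma> G M \<pi> S \<Psi> \<longleftrightarrow>
     \<Psi> \<in> source_space \<Gamma> M S \<rightarrow>\<^sub>E target_space \<Gamma> G M \<pi> S \<and>
     linear_on (source_space \<Gamma> M S) \<Psi> \<and>
     (\<forall>\<phi> \<in> (\<Pi>\<^sub>E e\<in>arcs \<Gamma>. dual (M e)). \<forall>m \<in> Pi\<^sub>E (arcs \<Gamma>) M. \<forall>u \<in> Pi\<^sub>E (verts \<Gamma>) S.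
        \<Psi> (tensor_vec (verts \<Gamma>) (vertex_space \<Gamma> M S) (\<lambda>v\<in>verts \<Gamma>. vertex_vec \<Gamma> M S \<phi> m u v)) =
        fun_tensor_vec
          (matrix_coeff \<Gamma> G M \<pi> (tensor_functional (arcs \<Gamma>) M \<phi>) (tensor_vec (arcs \<Gamma>) M m))
          (tensor_vec (verts \<Gamma>) S u))"

end

theory Submission
  imports Defs "HOL-Computational_Algebra.Fundamental_Theorem_Algebra"
begin

text \<open>
  On pure tensors \<open>\<Psi>\<close> produces the function
  \<open>g \<mapsto> (\<Prod>\<^sub>e \<phi>\<^sub>e (\<pi>\<^sub>e(g\<^sub>e) m\<^sub>e)) \<otimes>u\<^sub>v\<close>. Both sides of \<open>\<Psi>\<close> are multilinear in the same
  data \<open>\<phi>\<^sub>e\<close>, \<open>m\<^sub>e\<close>, \<open>u\<^sub>v\<close>: every arc contributes its covector to the star of its tail and its vector to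
  the star of its head, so the source merely groups these factors by vertices. Fix bases of all \<open>M\<^sub>e\<close> and
  \<open>S\<^sub>v\<close>. The proof gives the source and the target bases indexed by the same set, together with dual
  bases of coordinate functionals, such that corresponding functionals take the same value \<open>pairing\<close>
  on the pure tensor and on the function built from the same data (\<open>source_functional_vec\<close>,
  \<open>target_dual_bases\<close>). The linear map that preserves coordinates is then a bijection, and its
  coordinates show that it sends every pure tensor to the prescribed function: it is \<open>\<Psi>\<close>.

  Coordinates exist on the target because the matrix coefficients of an irreducible representation
  are as independent as they can be: by Burnside's theorem (\<open>burnside\<close>, a consequence of Schur's lemma by
  the density argument) every endomorphism of \<open>M\<^sub>e\<close> is a linear combination of operators \<open>\<pi>\<^sub>e(g)\<close>.
  Applied to matrix units, this recovers \<open>\<phi>(a) \<beta>(m)\<close>, for a basis vector \<open>a\<close> and a coordinate functional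
  \<open>\<beta>\<close>, from finitely many values of \<open>g \<mapsto> \<phi>(\<pi>\<^sub>e(g) m)\<close>, and multiplying over the arcs one recovers
  all coordinates of a function on \<open>G\<^sup>E\<close> from finitely many of its values.

  Equivariance is a computation on pure tensors: \<open>k\<close> replaces \<open>\<phi>\<^sub>e\<close> by its translate under \<open>k\<close> at the tail,
  \<open>m\<^sub>e\<close> by its translate under \<open>k\<close> at the head and \<open>u\<^sub>v\<close> by \<open>\<sigma>\<^sub>v(k\<^sub>v) u\<^sub>v\<close>, which has the effect of
  the action of \<open>\<^bold>K\<close> on the arguments and values of the function. For the last statement it
  remains to identify the \<open>\<^bold>K\<close>-invariants of a tensor product with the tensor product of the
  \<open>K\<^sub>v\<close>-invariants. If \<open>p\<^sub>v\<close> is a linear projection onto the \<open>K\<^sub>v\<close>-invariants, then \<open>\<Otimes>p\<^sub>v\<close> fixes every invariant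
  tensor, since contracting the other factors of such a tensor against functionals leaves a
  \<open>K\<^sub>v\<close>-invariant vector (\<open>tensor_contraction\<close>, \<open>tensor_invariants\<close>).
\<close>

section \<open>Linear maps on subspaces\<close>

lemma linear_on_addD: "linear_on V f \<Longrightarrow> x \<in> V \<Longrightarrow> y \<in> V \<Longrightarrow> f (x + y) = f x + f y"
  unfolding linear_on_def by blast

lemma linear_on_scaleD: "linear_on V f \<Longrightarrow> x \<in> V \<Longrightarrow> f (c *\<^sub>C x) = c *\<^sub>C f x"
  unfolding linear_on_def by blast

lemma linear_onI:
  assumes "\<And>x y. x \<in> V \<Longrightarrow> y \<in> V \<Longrightarrow> f (x + y) = f x + f y"
    and "\<And>c x. x \<in> V \<Longrightarrow> f (c *\<^sub>C x) = c *\<^sub>C f x"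
  shows "linear_on V f"
  using assms unfolding linear_on_def by blast

lemma linear_on_0:
  assumes "cvec.subspace V" "linear_on V f"
  shows "f 0 = 0"
  using linear_on_scaleD[OF assms(2) cvec.subspace_0[OF assms(1)], of 0] by simp

lemma linear_on_lincomb:
  assumes V: "cvec.subspace V" and f: "linear_on V f" and x: "\<And>j. j \<in> J \<Longrightarrow> x j \<in> V"
  shows "f (\<Sum>j\<in>J. c j *\<^sub>C x j) = (\<Sum>j\<in>J. c j *\<^sub>C f (x j))"
  using x
proof (induction J rule: infinite_finite_induct)
  case (insert i J)
  then have "(\<Sum>j\<in>J. c j *\<^sub>C x j) \<in> V" "c i *\<^sub>C x i \<in> V"
    using V by (auto intro!: cvec.subspace_sum cvec.subspace_scale)
  moreover have "f (c i *\<^sub>C x i) = c i *\<^sub>C f (x i)"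
    using insert.prems by (intro linear_on_scaleD[OF f]) simp
  ultimately show ?case
    unfolding sum.insert[OF insert.hyps] using insert by (simp add: linear_on_addD[OF f])
next
  case (infinite J)
  show ?case unfolding sum.infinite[OF infinite(1)] by (rule linear_on_0[OF V f])
next
  case empty
  show ?case unfolding sum.empty by (rule linear_on_0[OF V f])
qed

lemma linear_on_diff:
  assumes V: "cvec.subspace V" and f: "linear_on V f" and x: "x \<in> V" "y \<in> V"
  shows "f (x - y) = f x - f y"
  using linear_on_addD[OF f cvec.subspace_diff[OF V x] x(2)] by (simp add: algebra_simps)

lemma linear_on_subset: "linear_on V f \<Longrightarrow> U \<subseteq> V \<Longrightarrow> linear_on U f"
  unfolding linear_on_def by blast

lemma linear_on_compose:
  assumes "linear_on V f" "linear_on W g" "f ` V \<subseteq> W"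
  shows "linear_on V (\<lambda>x. g (f x))"
  using assms unfolding linear_on_def image_subset_iff by metis

lemma linear_on_lincombI:
  assumes "\<And>j. j \<in> J \<Longrightarrow> linear_on V (f j :: _ \<Rightarrow> complex)"
  shows "linear_on V (\<lambda>x. \<Sum>j\<in>J. f j x *\<^sub>C w j)"
proof (rule linear_onI)
  fix x y assume xy: "x \<in> V" "y \<in> V"
  have "(\<Sum>j\<in>J. f j (x + y) *\<^sub>C w j) = (\<Sum>j\<in>J. f j x *\<^sub>C w j + f j y *\<^sub>C w j)"
    by (intro sum.cong refl) (simp add: linear_on_addD[OF assms xy] scaleC_add_left)
  then show "(\<Sum>j\<in>J. f j (x + y) *\<^sub>C w j) = (\<Sum>j\<in>J. f j x *\<^sub>C w j) + (\<Sum>j\<in>J. f j y *\<^sub>C w j)"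
    by (simp only: sum.distrib)
next
  fix c x assume x: "x \<in> V"
  show "(\<Sum>j\<in>J. f j (c *\<^sub>C x) *\<^sub>C w j) = c *\<^sub>C (\<Sum>j\<in>J. f j x *\<^sub>C w j)"
    unfolding cvec.scale_sum_right
    by (intro sum.cong refl) (simp add: linear_on_scaleD[OF assms x] scaleC_scaleC)
qed

lemma linear_on_span_image:
  assumes L: "linear_on (cvec.span X) L" and X: "L ` X \<subseteq> W" and W: "cvec.subspace W"
  shows "L ` cvec.span X \<subseteq> W"
proof (rule image_subsetI)
  fix t assume "t \<in> cvec.span X"
  then have "t \<in> cvec.span X \<and> L t \<in> W"
  proof (induction rule: cvec.span_induct_alt)
    case base
    show ?case
      unfolding linear_on_0[OF cvec.subspace_span L] using cvec.span_zero cvec.subspace_0[OF W] by blast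
  next
    case (step c x y)
    have x: "x \<in> cvec.span X" using step.hyps by (rule cvec.span_base)
    have cx: "c *\<^sub>C x \<in> cvec.span X" by (rule cvec.span_scale[OF x])
    have "L (c *\<^sub>C x + y) = c *\<^sub>C L x + L y"
      using step by (simp only: linear_on_addD[OF L cx] linear_on_scaleD[OF L x])
    moreover have "c *\<^sub>C L x + L y \<in> W"
      using X W step by (intro cvec.subspace_add cvec.subspace_scale) auto
    ultimately show ?case using cvec.span_add[OF cx] step by simp
  qed
  then show "L t \<in> W" ..
qed

text \<open>
  The source of all spanning families for two-fold constructions below: it is applied to pure
  tensors, to functions \<open>x \<mapsto> c(x) u\<close> and to matrix coefficients.
\<close>

lemma bilinear_span:
  assumes f: "bilinear_on (cvec.span A) (cvec.span B) f"
    and x: "x \<in> cvec.span A" and y: "y \<in> cvec.span B"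
  shows "f x y \<in> cvec.span {f a b | a b. a \<in> A \<and> b \<in> B}" (is "_ \<in> ?S")
proof -
  have "f a y \<in> ?S" if a: "a \<in> A" for a
  proof -
    have "linear_on (cvec.span B) (f a)"
      using f cvec.span_base[OF a] unfolding bilinear_on_def by blast
    moreover have "f a ` B \<subseteq> ?S" using a by (auto intro: cvec.span_base)
    ultimately show ?thesis using linear_on_span_image[OF _ _ cvec.subspace_span] y by blast
  qed
  then have "(\<lambda>a. f a y) ` A \<subseteq> ?S" by blast
  moreover have "linear_on (cvec.span A) (\<lambda>a. f a y)"
    using f y unfolding bilinear_on_def by blast
  ultimately show ?thesis using linear_on_span_image[OF _ _ cvec.subspace_span] x by blast
qed

lemma linear_on_dual: "\<phi> \<in> dual V \<Longrightarrow> linear_on V \<phi>"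
  by (simp add: dual_def)

lemma dual_restrictI: "linear_on V \<phi> \<Longrightarrow> cvec.subspace V \<Longrightarrow> (\<lambda>x. if x \<in> V then \<phi> x else 0) \<in> dual V"
  by (auto simp: dual_def linear_on_def cvec.subspace_add cvec.subspace_scale)

lemma subspace_dual: "cvec.subspace (dual V)"
proof (rule cvec.subspaceI)
  show "0 \<in> dual V" by (simp add: dual_def linear_on_def)
next
  fix x y assume "x \<in> dual V" "y \<in> dual V"
  then show "x + y \<in> dual V" by (simp add: dual_def linear_on_def algebra_simps)
next
  fix c x assume "x \<in> dual V"
  then show "c *\<^sub>C x \<in> dual V" by (simp add: dual_def linear_on_def algebra_simps)
qed

lemma dual_separates:
  assumes V: "cvec.subspace V" and x: "x \<in> V" "y \<in> V" and eq: "\<And>\<psi>. \<psi> \<in> dual V \<Longrightarrow> \<psi> x = \<psi> y"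
  shows "x = y"
proof (rule ccontr)
  assume "x \<noteq> y"
  then obtain \<psi> where \<psi>: "linear_on UNIV \<psi>" "\<psi> (x - y) \<noteq> (0 :: complex)"
    using separating_functional[of "x - y"] by auto
  have lin: "linear_on V \<psi>" using \<psi>(1) linear_on_subset by blast
  have "(\<lambda>z. if z \<in> V then \<psi> z else 0) x = (\<lambda>z. if z \<in> V then \<psi> z else 0) y"
    by (rule eq[OF dual_restrictI[OF lin V]])
  then have "\<psi> x = \<psi> y" using x by simp
  with \<psi>(2) linear_on_diff[OF V lin x] show False by simp
qed


section \<open>Dual bases\<close>

text \<open>
  Indexing by an arbitrary set \<open>J\<close>, instead of by the basis vectors themselves, allows the bases of
  iterated tensor products to be reindexed by families of basis vectors on the arcs and vertices of a graph.
\<close>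

definition dual_bases ::
    "'j set \<Rightarrow> 'a::complex_vector set \<Rightarrow> ('j \<Rightarrow> 'a) \<Rightarrow> ('j \<Rightarrow> 'a \<Rightarrow> complex) \<Rightarrow> bool" where
  "dual_bases J V b \<beta> \<longleftrightarrow> finite J \<and> V = cvec.span (b ` J) \<and> (\<forall>j\<in>J. \<beta> j \<in> dual V) \<and>
     (\<forall>i\<in>J. \<forall>j\<in>J. \<beta> i (b j) = of_bool (i = j))"

lemma dual_basesI:
  assumes "finite J" "V = cvec.span (b ` J)" "\<And>j. j \<in> J \<Longrightarrow> \<beta> j \<in> dual V"
    "\<And>i j. i \<in> J \<Longrightarrow> j \<in> J \<Longrightarrow> \<beta> i (b j) = of_bool (i = j)"
  shows "dual_bases J V b \<beta>"
  using assms unfolding dual_bases_def by blast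

lemma dual_basesD:
  assumes "dual_bases J V b \<beta>"
  shows "finite J" "V = cvec.span (b ` J)" "\<And>j. j \<in> J \<Longrightarrow> \<beta> j \<in> dual V" "\<And>j. j \<in> J \<Longrightarrow> b j \<in> V"
    "\<And>i j. i \<in> J \<Longrightarrow> j \<in> J \<Longrightarrow> \<beta> i (b j) = of_bool (i = j)" "cvec.subspace V" "fin_dim_space V"
  using assms unfolding dual_bases_def fin_dim_space_def by (auto intro: cvec.span_base)

lemma dual_bases_expansion:
  assumes D: "dual_bases J V b \<beta>" and x: "x \<in> V"
  shows "x = (\<Sum>j\<in>J. \<beta> j x *\<^sub>C b j)"
proof (rule span_extension_unique[where X = "b ` J" and L = "\<lambda>x. x"])
  show "linear_on (cvec.span (b ` J)) (\<lambda>x. \<Sum>j\<in>J. \<beta> j x *\<^sub>C b j)"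
    using dual_basesD[OF D] by (intro linear_on_lincombI) (auto dest: linear_on_dual)
  show "linear_on (cvec.span (b ` J)) (\<lambda>x. x)" by (simp add: linear_on_def)
  show "x \<in> cvec.span (b ` J)" using x dual_basesD(2)[OF D] by simp
  fix y assume "y \<in> b ` J"
  then obtain i where i: "i \<in> J" "y = b i" by blast
  have "(\<Sum>j\<in>J. \<beta> j y *\<^sub>C b j) = (\<Sum>j\<in>J. if i = j then b j else 0)"
    by (intro sum.cong refl) (use i dual_basesD(5)[OF D] in auto)
  then show "y = (\<Sum>j\<in>J. \<beta> j y *\<^sub>C b j)" using i dual_basesD(1)[OF D] by simp
qed

lemma dual_bases_eqI:
  assumes D: "dual_bases J V b \<beta>" and x: "x \<in> V" "y \<in> V" and eq: "\<And>j. j \<in> J \<Longrightarrow> \<beta> j x = \<beta> j y"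
  shows "x = y"
proof -
  have "x = (\<Sum>j\<in>J. \<beta> j x *\<^sub>C b j)" by (rule dual_bases_expansion[OF D x(1)])
  also have "\<dots> = (\<Sum>j\<in>J. \<beta> j y *\<^sub>C b j)" by (intro sum.cong refl) (simp add: eq)
  also have "\<dots> = y" by (rule dual_bases_expansion[OF D x(2), symmetric])
  finally show ?thesis .
qed

lemma dual_bases_reindex:
  assumes "dual_bases J V b \<beta>" and h: "bij_betw h I J"
  shows "dual_bases I V (\<lambda>i. b (h i)) (\<lambda>i. \<beta> (h i))"
proof -
  have "(\<lambda>i. b (h i)) ` I = b ` J" using h by (auto simp: bij_betw_def)
  moreover have "h i = h j \<longleftrightarrow> i = j" if "i \<in> I" "j \<in> I" for i j
    using h that by (auto simp: bij_betw_def inj_on_def)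
  moreover have "h i \<in> J" if "i \<in> I" for i using h that by (auto simp: bij_betw_def)
  ultimately show ?thesis
    using dual_basesD[OF assms(1)] h by (intro dual_basesI) (simp_all add: bij_betw_finite)
qed

lemma fin_dim_dual_bases:
  fixes V :: "'a::complex_vector set"
  assumes "fin_dim_space V"
  shows "\<exists>(B :: 'a set) \<beta>. dual_bases B V (\<lambda>b. b) \<beta>"
proof -
  obtain A where A: "finite A" "V = cvec.span A" using assms unfolding fin_dim_space_def by blast
  obtain B where "B \<subseteq> V" and B: "cvec.independent B" "V \<subseteq> cvec.span B"
    using cvec.maximal_independent_subset by blast
  then have VB: "V = cvec.span B"
    using A(2) cvec.span_minimal[of B V] by auto
  have "finite B"
    using cvec.independent_span_bound[OF A(1) B(1)] \<open>B \<subseteq> V\<close> A(2) by blast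
  have "dual_bases B V (\<lambda>b. b) (\<lambda>b x. cvec.representation B x b)"
  proof (rule dual_basesI)
    fix b assume "b \<in> B"
    show "(\<lambda>x. cvec.representation B x b) \<in> dual V"
      unfolding VB dual_def linear_on_def
      by (auto simp: cvec.representation_add[OF B(1)] cvec.representation_scale[OF B(1)])
        (simp add: cvec.representation_def)
  next
    fix a b assume "a \<in> B" "b \<in> B"
    then show "cvec.representation B b a = of_bool (a = b)"
      by (simp add: cvec.representation_basis[OF B(1)])
  qed (use \<open>finite B\<close> VB in auto)
  then show ?thesis by blast
qed

text \<open>
  Evaluation at the basis vectors recovers the coefficients of a functional. This provides coordinates
  for the factors of a star tensor at the outgoing arcs, which are covectors.
\<close>

lemma dual_bases_dual:
  assumes D: "dual_bases J V b \<beta>"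
  shows "dual_bases J (dual V) \<beta> (\<lambda>j \<phi>. if \<phi> \<in> dual V then \<phi> (b j) else 0)"
proof (rule dual_basesI)
  show "dual V = cvec.span (\<beta> ` J)"
  proof
    show "cvec.span (\<beta> ` J) \<subseteq> dual V"
      using dual_basesD(3)[OF D] by (intro cvec.span_minimal subspace_dual) blast
    show "dual V \<subseteq> cvec.span (\<beta> ` J)"
    proof
      fix \<phi> assume \<phi>: "\<phi> \<in> dual V"
      have "\<phi> x = (\<Sum>j\<in>J. \<phi> (b j) *\<^sub>C \<beta> j) x" for x
      proof (cases "x \<in> V")
        case True
        have "\<phi> (\<Sum>j\<in>J. \<beta> j x *\<^sub>C b j) = (\<Sum>j\<in>J. \<beta> j x *\<^sub>C \<phi> (b j))"
          by (rule linear_on_lincomb[OF dual_basesD(6)[OF D] linear_on_dual[OF \<phi>] dual_basesD(4)[OF D]])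
        with dual_bases_expansion[OF D True] have "\<phi> x = (\<Sum>j\<in>J. \<beta> j x *\<^sub>C \<phi> (b j))" by simp
        also have "\<dots> = (\<Sum>j\<in>J. (\<phi> (b j) *\<^sub>C \<beta> j) x)" by (simp add: mult.commute)
        also have "\<dots> = (\<Sum>j\<in>J. \<phi> (b j) *\<^sub>C \<beta> j) x"
          using dual_basesD(1)[OF D] by (induction J rule: finite_induct) auto
        finally show ?thesis .
      next
        case False
        have "(\<Sum>j\<in>J. \<phi> (b j) *\<^sub>C \<beta> j) \<in> dual V"
          using dual_basesD(3)[OF D]
          by (intro cvec.subspace_sum cvec.subspace_scale subspace_dual)
        then show ?thesis using False \<phi> by (simp add: dual_def)
      qed
      then have "\<phi> = (\<Sum>j\<in>J. \<phi> (b j) *\<^sub>C \<beta> j)" by blast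
      also have "\<dots> \<in> cvec.span (\<beta> ` J)"
        by (intro cvec.span_sum cvec.span_scale cvec.span_base imageI)
      finally show "\<phi> \<in> cvec.span (\<beta> ` J)" .
    qed
  qed
  show "(\<lambda>\<phi>. if \<phi> \<in> dual V then \<phi> (b j) else 0) \<in> dual (dual V)" for j
    by (rule dual_restrictI[OF _ subspace_dual]) (simp add: linear_on_def)
qed (use dual_basesD[OF D] in auto)

text \<open>
  Two spaces with bases over the same index set are isomorphic through their coordinates. The
  second part characterises the image of a vector by its coordinates; this identifies the
  images of all pure tensors without expanding them in the basis.
\<close>

lemma dual_bases_iso:
  assumes D: "dual_bases J V b \<beta>" and E: "dual_bases J W c \<gamma>"
  shows "linear_iso V W (\<lambda>x\<in>V. \<Sum>j\<in>J. \<beta> j x *\<^sub>C c j)" (is "linear_iso V W ?L")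
    and "\<And>i x. i \<in> J \<Longrightarrow> x \<in> V \<Longrightarrow> \<gamma> i ((\<lambda>x\<in>V. \<Sum>j\<in>J. \<beta> j x *\<^sub>C c j) x) = \<beta> i x"
proof -
  have co: "\<gamma> i (\<Sum>j\<in>J. r j *\<^sub>C c j) = r i" if "dual_bases J W c \<gamma>" "i \<in> J"
    for r i and W :: "'x::complex_vector set" and c \<gamma>
  proof -
    note E = that(1)
    have "\<gamma> i (\<Sum>j\<in>J. r j *\<^sub>C c j) = (\<Sum>j\<in>J. r j *\<^sub>C \<gamma> i (c j))"
      by (rule linear_on_lincomb[OF dual_basesD(6)[OF E] linear_on_dual[OF dual_basesD(3)[OF E]]
            dual_basesD(4)[OF E]]) (rule that)
    also have "\<dots> = (\<Sum>j\<in>J. if i = j then r j else 0)"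
      using that(2) by (intro sum.cong refl) (auto simp: dual_basesD(5)[OF E])
    finally show ?thesis using that(2) dual_basesD(1)[OF E] by simp
  qed
  show "\<gamma> i (?L x) = \<beta> i x" if "i \<in> J" "x \<in> V" for i x
    using co[OF E that(1)] that(2) by simp
  have lin: "linear_on V (\<lambda>x. \<Sum>j\<in>J. \<beta> j x *\<^sub>C c j)"
    by (intro linear_on_lincombI linear_on_dual dual_basesD[OF D])
  then have "linear_on V ?L"
    using cvec.subspace_add[OF dual_basesD(6)[OF D]] cvec.subspace_scale[OF dual_basesD(6)[OF D]]
    unfolding linear_on_def by simp
  moreover have "bij_betw ?L V W"
  proof (rule bij_betw_byWitness[where f' = "\<lambda>y. \<Sum>j\<in>J. \<gamma> j y *\<^sub>C b j"])
    show "\<forall>x\<in>V. (\<Sum>j\<in>J. \<gamma> j (?L x) *\<^sub>C b j) = x"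
      using dual_bases_expansion[OF D] co[OF E] by simp
    have in_V: "(\<Sum>j\<in>J. r j *\<^sub>C b j) \<in> V" for r
      by (intro cvec.subspace_sum cvec.subspace_scale dual_basesD[OF D])
    then show "\<forall>y\<in>W. ?L (\<Sum>j\<in>J. \<gamma> j y *\<^sub>C b j) = y"
      using dual_bases_expansion[OF E] co[OF D] by simp
    show "(\<lambda>y. \<Sum>j\<in>J. \<gamma> j y *\<^sub>C b j) ` W \<subseteq> V" by (rule image_subsetI) (rule in_V)
    have "(\<Sum>j\<in>J. r j *\<^sub>C c j) \<in> W" for r
      by (intro cvec.subspace_sum cvec.subspace_scale dual_basesD[OF E])
    then show "?L ` V \<subseteq> W" by auto
  qed
  ultimately show "linear_iso V W ?L" unfolding linear_iso_def ..
qed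


section \<open>Irreducible representations\<close>

lemma linear_dependence:
  fixes w :: "nat \<Rightarrow> 'a::complex_vector"
  assumes V: "fin_dim_space V" and w: "\<And>i. w i \<in> V"
  shows "\<exists>n c. (\<Sum>i\<le>n. c i *\<^sub>C w i) = 0 \<and> (\<exists>i\<le>n. c i \<noteq> 0)"
proof -
  obtain A where A: "finite A" "V = cvec.span A" using V unfolding fin_dim_space_def by blast
  define n where "n = card A"
  show ?thesis
  proof (cases "inj_on w {..n}")
    case True
    then have "card (w ` {..n}) = Suc n" by (simp add: card_image)
    then have "cvec.dependent (w ` {..n})"
      using cvec.independent_span_bound[OF A(1), of "w ` {..n}"] w A(2) n_def by force
    then obtain u v where u: "v \<in> w ` {..n}" "u v \<noteq> 0" "(\<Sum>x\<in>w ` {..n}. u x *\<^sub>C x) = 0"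
      using cvec.dependent_finite[of "w ` {..n}"] by auto
    from u(1) obtain i where i: "i \<le> n" "v = w i" by auto
    have "(\<Sum>i\<le>n. u (w i) *\<^sub>C w i) = 0"
      using u(3) unfolding sum.reindex[OF True] comp_def .
    moreover have "u (w i) \<noteq> 0" using u(2) i by simp
    ultimately show ?thesis using i(1) by (intro exI[of _ n] exI[of _ "\<lambda>i. u (w i)"]) blast
  next
    case False
    then obtain i j where ij: "i \<le> n" "j \<le> n" "i \<noteq> j" "w i = w j" by (auto simp: inj_on_def)
    define c :: "nat \<Rightarrow> complex" where "c l = (if l = i then 1 else 0) - (if l = j then 1 else 0)" for l
    have "(\<Sum>l\<le>n. c l *\<^sub>C w l) = (\<Sum>l\<le>n. (if l = i then w l else 0) - (if l = j then w l else 0))"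
      by (intro sum.cong refl) (auto simp: c_def cvec.scale_left_diff_distrib)
    also have "\<dots> = w i - w j" using ij by (simp add: sum_subtractf)
    finally have "(\<Sum>l\<le>n. c l *\<^sub>C w l) = 0" using ij(4) by simp
    moreover have "c i \<noteq> 0" using ij(3) by (simp add: c_def)
    ultimately show ?thesis using ij(1) by blast
  qed
qed

text \<open>
  Read \<open>w\<^sub>i = T\<^sup>i w\<^sub>0\<close>, so that the sum is \<open>p(T) w\<^sub>0\<close>. If \<open>p = (X - a) q\<close>, then either
  \<open>q(T) w\<^sub>0 = 0\<close> and the degree drops, or \<open>q(T) w\<^sub>0\<close> is an eigenvector for \<open>a\<close>.
\<close>

lemma eigenvector_of_annihilating_poly:
  fixes w :: "nat \<Rightarrow> 'a::complex_vector"
  assumes V: "cvec.subspace V" and T: "linear_on V T"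
    and w: "\<And>i. w i \<in> V" "\<And>i. T (w i) = w (Suc i)" "w 0 \<noteq> 0"
    and p: "p \<noteq> 0" "(\<Sum>i\<le>degree p. coeff p i *\<^sub>C w i) = 0"
  shows "\<exists>a. \<exists>v\<in>V. v \<noteq> 0 \<and> T v = a *\<^sub>C v"
  using p
proof (induction "degree p" arbitrary: p)
  case 0
  then have "coeff p 0 \<noteq> 0" by (metis leading_coeff_0_iff)
  then show ?case using 0 w(3) by simp
next
  case (Suc k)
  have "\<not> constant (poly p)" using Suc(2) by (simp add: constant_degree)
  then obtain a where "poly p a = 0" using fundamental_theorem_of_algebra by blast
  then obtain q where pq: "p = [:- a, 1:] * q" by (auto simp: poly_eq_0_iff_dvd elim: dvdE)
  with Suc.prems have q: "q \<noteq> 0" by auto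
  then have "degree p = Suc (degree q)" unfolding pq by (subst degree_mult_eq) auto
  with Suc(2) have k: "degree q = k" by simp
  define y where "y = (\<Sum>i\<le>k. coeff q i *\<^sub>C w i)"
  have y: "y \<in> V" unfolding y_def by (intro cvec.subspace_sum cvec.subspace_scale V w)
  have Ty: "T y = (\<Sum>i\<le>k. coeff q i *\<^sub>C w (Suc i))"
    unfolding y_def w(2)[symmetric] by (rule linear_on_lincomb[OF V T w(1)])
  have pc: "coeff p i = coeff (pCons 0 q) i - a * coeff q i" for i
    unfolding pq by simp
  have "coeff q (Suc k) = 0" using k by (intro coeff_eq_0) simp
  then have y': "(\<Sum>i\<le>Suc k. (a * coeff q i) *\<^sub>C w i) = a *\<^sub>C y"
    unfolding y_def by (simp add: cvec.scale_sum_right scaleC_scaleC)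
  have "(\<Sum>i\<le>Suc k. coeff p i *\<^sub>C w i) =
      (\<Sum>i\<le>Suc k. coeff (pCons 0 q) i *\<^sub>C w i) - (\<Sum>i\<le>Suc k. (a * coeff q i) *\<^sub>C w i)"
    by (simp only: pc cvec.scale_left_diff_distrib sum_subtractf)
  also have "(\<Sum>i\<le>Suc k. coeff (pCons 0 q) i *\<^sub>C w i) = T y"
    unfolding Ty by (subst sum.atMost_Suc_shift) simp
  finally have *: "T y = a *\<^sub>C y" using Suc.prems(2) Suc(2) y' by simp
  show ?case
  proof (cases "y = 0")
    case True
    show ?thesis by (rule Suc(1)[OF k[symmetric] q]) (use True k in \<open>simp add: y_def\<close>)
  qed (use * y in blast)
qed

lemma eigenvector_exists:
  assumes V: "fin_dim_space V" "V \<noteq> {0}" and T: "linear_on V T" "T ` V \<subseteq> V"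
  shows "\<exists>a. \<exists>v\<in>V. v \<noteq> 0 \<and> T v = a *\<^sub>C v"
proof -
  have sub: "cvec.subspace V" using V(1) unfolding fin_dim_space_def by auto
  then obtain v where v: "v \<in> V" "v \<noteq> 0" using V(2) cvec.subspace_0 by blast
  define w where "w i = (T ^^ i) v" for i
  have w: "w i \<in> V" for i unfolding w_def by (induction i) (use v T(2) in auto)
  obtain n c where c: "(\<Sum>i\<le>n. c i *\<^sub>C w i) = 0" "\<exists>i\<le>n. c i \<noteq> 0"
    using linear_dependence[OF V(1), of w] w by blast
  define p where "p = (\<Sum>i\<le>n. monom (c i) i)"
  have pc: "coeff p i = (if i \<le> n then c i else 0)" for i
    by (simp add: p_def coeff_sum)
  have p: "p \<noteq> 0" using c(2) by (metis pc coeff_0)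
  have "degree p \<le> n" by (rule degree_le) (simp add: pc)
  then have "(\<Sum>i\<le>degree p. coeff p i *\<^sub>C w i) = (\<Sum>i\<le>n. coeff p i *\<^sub>C w i)"
    by (intro sum.mono_neutral_left) (auto intro: coeff_eq_0)
  also have "\<dots> = 0" using c(1) by (simp add: pc)
  finally show ?thesis
    by (intro eigenvector_of_annihilating_poly[OF sub T(1) w _ _ p]) (use v in \<open>auto simp: w_def\<close>)
qed

lemma group_repD:
  assumes "group_rep G V \<rho>"
  shows "cvec.subspace V"
    and "\<And>g. g \<in> carrier G \<Longrightarrow> linear_on V (\<rho> g)"
    and "\<And>g x. g \<in> carrier G \<Longrightarrow> x \<in> V \<Longrightarrow> \<rho> g x \<in> V"
    and "\<And>g h x. g \<in> carrier G \<Longrightarrow> h \<in> carrier G \<Longrightarrow> x \<in> V \<Longrightarrow> \<rho> (g \<otimes>\<^bsub>G\<^esub> h) x = \<rho> g (\<rho> h x)"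
    and "\<And>g. g \<in> carrier G \<Longrightarrow> bij_betw (\<rho> g) V V"
proof -
  show "cvec.subspace V" using assms by (simp add: group_rep_def)
  have \<rho>: "\<rho> \<in> hom G (GL V)" using assms by (simp add: group_rep_def)
  then have car: "\<rho> g \<in> Bij V" "linear_on V (\<rho> g)" if "g \<in> carrier G" for g
    using that by (auto simp: hom_def GL_def)
  then show "\<And>g. g \<in> carrier G \<Longrightarrow> linear_on V (\<rho> g)" by blast
  show bij: "\<And>g. g \<in> carrier G \<Longrightarrow> bij_betw (\<rho> g) V V" using car by (simp add: Bij_def)
  then show "\<And>g x. g \<in> carrier G \<Longrightarrow> x \<in> V \<Longrightarrow> \<rho> g x \<in> V" by (auto simp: bij_betw_def)
  fix g h x assume gh: "g \<in> carrier G" "h \<in> carrier G" and x: "x \<in> V"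
  have "\<rho> (g \<otimes>\<^bsub>G\<^esub> h) = \<rho> g \<otimes>\<^bsub>GL V\<^esub> \<rho> h" by (rule hom_mult[OF \<rho> gh])
  also have "\<dots> = compose V (\<rho> g) (\<rho> h)" using car gh by (simp add: GL_def BijGroup_def)
  finally show "\<rho> (g \<otimes>\<^bsub>G\<^esub> h) x = \<rho> g (\<rho> h x)" using x by (simp add: compose_eq)
qed

lemma group_rep_one:
  assumes G: "group G" and \<rho>: "group_rep G V \<rho>" and x: "x \<in> V"
  shows "\<rho> \<one>\<^bsub>G\<^esub> x = x"
proof -
  have 1: "\<one>\<^bsub>G\<^esub> \<in> carrier G" "\<one>\<^bsub>G\<^esub> \<otimes>\<^bsub>G\<^esub> \<one>\<^bsub>G\<^esub> = \<one>\<^bsub>G\<^esub>" using G by (simp_all add: group.is_monoid)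
  have "\<rho> \<one>\<^bsub>G\<^esub> (\<rho> \<one>\<^bsub>G\<^esub> x) = \<rho> \<one>\<^bsub>G\<^esub> x" using group_repD(4)[OF \<rho> 1(1) 1(1) x] 1(2) by simp
  then show ?thesis
    using group_repD(5)[OF \<rho> 1(1)] group_repD(3)[OF \<rho> 1(1) x] x
    unfolding bij_betw_def inj_on_def by blast
qed

text \<open>
  Schur's lemma: an eigenspace of an intertwiner is an invariant subspace.
\<close>

lemma schur_scalar:
  assumes fd: "fin_dim_space V" and irr: "irreducible_rep G V \<rho>"
    and T: "linear_on V T" "T ` V \<subseteq> V"
    and comm: "\<And>g x. g \<in> carrier G \<Longrightarrow> x \<in> V \<Longrightarrow> T (\<rho> g x) = \<rho> g (T x)"
  shows "\<exists>a. \<forall>x\<in>V. T x = a *\<^sub>C x"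
proof -
  have rep: "group_rep G V \<rho>" and "V \<noteq> {0}" using irr by (auto simp: irreducible_rep_def)
  note sub = group_repD(1)[OF rep]
  obtain a v where v: "v \<in> V" "v \<noteq> 0" "T v = a *\<^sub>C v"
    using eigenvector_exists[OF fd \<open>V \<noteq> {0}\<close> T] by blast
  define U where "U = {x \<in> V. T x = a *\<^sub>C x}"
  have "cvec.subspace U"
  proof (rule cvec.subspaceI)
    show "0 \<in> U" using cvec.subspace_0[OF sub] linear_on_0[OF sub T(1)] by (simp add: U_def)
  next
    fix x y assume "x \<in> U" "y \<in> U"
    then show "x + y \<in> U"
      using cvec.subspace_add[OF sub] by (simp add: U_def linear_on_addD[OF T(1)] scaleC_add_right)
  next
    fix c x assume "x \<in> U"
    then show "c *\<^sub>C x \<in> U"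
      using cvec.subspace_scale[OF sub]
      by (simp add: U_def linear_on_scaleD[OF T(1)] scaleC_scaleC mult.commute)
  qed
  moreover have "\<rho> g ` U \<subseteq> U" if "g \<in> carrier G" for g
    using group_repD(2,3)[OF rep that] comm[OF that] by (auto simp: U_def linear_on_scaleD)
  ultimately have "U = {0} \<or> U = V"
    using irr unfolding irreducible_rep_def U_def by blast
  moreover have "v \<in> U" using v by (simp add: U_def)
  ultimately show ?thesis using v(2) unfolding U_def by blast
qed

lemma rep_span_linear:
  assumes rep: "group_rep G V \<rho>" and \<alpha>: "\<alpha> \<in> cvec.span (\<rho> ` carrier G)"
  shows "linear_on V \<alpha> \<and> \<alpha> ` V \<subseteq> V"
  using \<alpha>
proof (induction rule: cvec.span_induct_alt)
  case base
  show ?case using cvec.subspace_0[OF group_repD(1)[OF rep]] by (auto simp: linear_on_def)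
next
  case (step c x y)
  then obtain g where g: "g \<in> carrier G" "x = \<rho> g" by blast
  have x: "linear_on V x" "\<And>z. z \<in> V \<Longrightarrow> x z \<in> V" using group_repD(2,3)[OF rep g(1)] g(2) by auto
  show ?case
    using step x cvec.subspace_add[OF group_repD(1)[OF rep]] cvec.subspace_scale[OF group_repD(1)[OF rep]]
    by (auto simp: linear_on_def image_subset_iff scaleC_add_right scaleC_scaleC algebra_simps)
qed

text \<open>
  Left multiplication by \<open>\<rho>(g)\<close> preserves the span of the group operators, as operators on \<open>V\<close>. Hence
  the values at a vector of all operators in the span that annihilate a given set form an invariant
  subspace, to which irreducibility applies.
\<close>

lemma rep_span_left_mult:
  assumes rep: "group_rep G V \<rho>" and G: "group G" and g: "g \<in> carrier G"
    and \<alpha>: "\<alpha> \<in> cvec.span (\<rho> ` carrier G)"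
  shows "\<exists>\<gamma>\<in>cvec.span (\<rho> ` carrier G). \<forall>x\<in>V. \<gamma> x = \<rho> g (\<alpha> x)" (is "?P \<alpha>")
proof -
  have "\<alpha> \<in> cvec.span (\<rho> ` carrier G) \<and> ?P \<alpha>"
    using \<alpha>
  proof (induction rule: cvec.span_induct_alt)
    case base
    show ?case
      using linear_on_0[OF group_repD(1)[OF rep] group_repD(2)[OF rep g]]
      by (intro conjI bexI[of _ 0] ballI cvec.span_zero) simp
  next
    case (step c x y)
    then obtain h where h: "h \<in> carrier G" "x = \<rho> h" by blast
    from step have y: "y \<in> cvec.span (\<rho> ` carrier G)" by blast
    from step obtain \<gamma> where \<gamma>: "\<gamma> \<in> cvec.span (\<rho> ` carrier G)" "\<forall>x\<in>V. \<gamma> x = \<rho> g (y x)" by blast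
    have gh: "g \<otimes>\<^bsub>G\<^esub> h \<in> carrier G" using G g h(1) by (simp add: group.is_monoid monoid.m_closed)
    have "c *\<^sub>C \<rho> (g \<otimes>\<^bsub>G\<^esub> h) + \<gamma> \<in> cvec.span (\<rho> ` carrier G)"
      by (intro cvec.span_add cvec.span_scale cvec.span_base imageI gh \<gamma>(1))
    moreover have "(c *\<^sub>C \<rho> (g \<otimes>\<^bsub>G\<^esub> h) + \<gamma>) v = \<rho> g ((c *\<^sub>C x + y) v)" if v: "v \<in> V" for v
    proof -
      have in_V: "\<rho> h v \<in> V" "y v \<in> V" "c *\<^sub>C \<rho> h v \<in> V"
        using group_repD(3)[OF rep h(1) v] rep_span_linear[OF rep y] v
          cvec.subspace_scale[OF group_repD(1)[OF rep]] by blast+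
      then show ?thesis
        using group_repD(4)[OF rep g h(1) v] \<gamma>(2) v h(2)
        by (simp add: linear_on_addD[OF group_repD(2)[OF rep g]]
            linear_on_scaleD[OF group_repD(2)[OF rep g]])
    qed
    moreover have "c *\<^sub>C x + y \<in> cvec.span (\<rho> ` carrier G)"
      using step(1) y by (intro cvec.span_add cvec.span_scale) (rule cvec.span_base)
    ultimately show ?case by blast
  qed
  then show ?thesis ..
qed

text \<open>
  Jacobson's density argument, by induction on the independent set. For a new vector \<open>b\<close>, the values
  \<open>\<alpha>(b)\<close> of the operators \<open>\<alpha>\<close> vanishing on \<open>D\<close> form an invariant subspace \<open>U\<close>. If \<open>U\<close> is
  everything, the value at \<open>b\<close> can be corrected freely. If \<open>U = 0\<close>, then \<open>\<alpha>(b)\<close> depends on the restriction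
  of \<open>\<alpha>\<close> to \<open>D\<close> only; the component of this dependence at \<open>d \<in> D\<close> is an intertwiner, hence a scalar by Schur's
  lemma, and evaluation at the identity operator puts \<open>b\<close> into the span of \<open>D\<close>.
\<close>

lemma irreducible_rep_density:
  assumes G: "group G" and fd: "fin_dim_space V" and irr: "irreducible_rep G V \<rho>"
    and D: "finite D" "cvec.independent D" "D \<subseteq> V" and f: "f ` D \<subseteq> V"
  shows "\<exists>\<alpha>\<in>cvec.span (\<rho> ` carrier G). \<forall>d\<in>D. \<alpha> d = f d"
  using D f
proof (induction D arbitrary: f rule: finite_induct)
  case empty
  show ?case by (intro bexI[of _ 0] cvec.span_zero) simp
next
  case (insert b D f)
  define A where "A = cvec.span (\<rho> ` carrier G)"
  have rep: "group_rep G V \<rho>" and "V \<noteq> {0}" using irr by (auto simp: irreducible_rep_def)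
  note sub = group_repD(1)[OF rep]
  have A: "cvec.subspace A" unfolding A_def by (rule cvec.subspace_span)
  have bV: "b \<in> V" and DV: "D \<subseteq> V" using insert.prems by auto
  have indD: "cvec.independent D" and b_notin: "b \<notin> cvec.span D"
    using insert.prems(1) insert.hyps(2) by (simp_all add: cvec.independent_insert)
  have IH: "\<exists>\<alpha>\<in>A. \<forall>d\<in>D. \<alpha> d = h d" if "h ` D \<subseteq> V" for h
    using insert.IH[OF indD DV that] unfolding A_def .
  have AV: "\<alpha> x \<in> V" if "\<alpha> \<in> A" "x \<in> V" for \<alpha> x
    using rep_span_linear[OF rep] that unfolding A_def by blast
  have Aid: "\<rho> \<one>\<^bsub>G\<^esub> \<in> A"
    unfolding A_def by (intro cvec.span_base imageI monoid.one_closed group.is_monoid[OF G])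
  define U where "U = {\<alpha> b | \<alpha>. \<alpha> \<in> A \<and> (\<forall>d\<in>D. \<alpha> d = 0)}"
  have UI: "\<alpha> b \<in> U" if "\<alpha> \<in> A" "\<forall>d\<in>D. \<alpha> d = 0" for \<alpha>
    unfolding U_def using that by blast
  have "cvec.subspace U"
  proof (rule cvec.subspaceI)
    show "0 \<in> U" using UI[OF cvec.subspace_0[OF A]] by simp
  next
    fix x y assume "x \<in> U" "y \<in> U"
    then obtain \<alpha> \<beta> where "\<alpha> \<in> A" "\<forall>d\<in>D. \<alpha> d = 0" "x = \<alpha> b" "\<beta> \<in> A" "\<forall>d\<in>D. \<beta> d = 0" "y = \<beta> b"
      unfolding U_def by blast
    then show "x + y \<in> U" using UI[OF cvec.subspace_add[OF A, of \<alpha> \<beta>]] by simp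
  next
    fix c x assume "x \<in> U"
    then obtain \<alpha> where "\<alpha> \<in> A" "\<forall>d\<in>D. \<alpha> d = 0" "x = \<alpha> b" unfolding U_def by blast
    then show "c *\<^sub>C x \<in> U" using UI[OF cvec.subspace_scale[OF A, of \<alpha> c]] by simp
  qed
  moreover have "\<rho> g ` U \<subseteq> U" if g: "g \<in> carrier G" for g
  proof (rule image_subsetI)
    fix x assume "x \<in> U"
    then obtain \<alpha> where \<alpha>: "\<alpha> \<in> A" "\<forall>d\<in>D. \<alpha> d = 0" "x = \<alpha> b" unfolding U_def by blast
    obtain \<gamma> where \<gamma>: "\<gamma> \<in> A" "\<forall>x\<in>V. \<gamma> x = \<rho> g (\<alpha> x)"
      using rep_span_left_mult[OF rep G g] \<alpha>(1) unfolding A_def by blast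
    have "\<forall>d\<in>D. \<gamma> d = 0"
      using \<gamma>(2) \<alpha>(2) DV linear_on_0[OF sub group_repD(2)[OF rep g]] by auto
    then show "\<rho> g x \<in> U" using UI[OF \<gamma>(1)] \<gamma>(2) bV \<alpha>(3) by simp
  qed
  moreover have "U \<subseteq> V" using AV bV unfolding U_def by blast
  ultimately have "U = {0} \<or> U = V" using irr unfolding irreducible_rep_def by blast
  then show ?case
  proof
    assume "U = V"
    obtain \<alpha> where \<alpha>: "\<alpha> \<in> A" "\<forall>d\<in>D. \<alpha> d = f d" using IH[of f] insert.prems by blast
    have "f b - \<alpha> b \<in> U" unfolding \<open>U = V\<close>
      using insert.prems AV[OF \<alpha>(1) bV] sub by (intro cvec.subspace_diff) auto
    then obtain \<beta> where \<beta>: "\<beta> \<in> A" "\<forall>d\<in>D. \<beta> d = 0" "f b - \<alpha> b = \<beta> b" unfolding U_def by blast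
    have "(\<alpha> + \<beta>) b = f b" using \<beta>(3)[symmetric] by simp
    moreover have "\<forall>d\<in>D. (\<alpha> + \<beta>) d = f d" using \<alpha>(2) \<beta>(2) by simp
    moreover have "\<alpha> + \<beta> \<in> A" by (rule cvec.subspace_add[OF A \<alpha>(1) \<beta>(1)])
    ultimately show ?thesis unfolding A_def by blast
  next
    assume U0: "U = {0}"
    have det: "\<alpha> b = \<beta> b" if "\<alpha> \<in> A" "\<beta> \<in> A" "\<forall>d\<in>D. \<alpha> d = \<beta> d" for \<alpha> \<beta>
      using UI[OF cvec.subspace_diff[OF A that(1,2)]] that(3) U0 by simp
    \<comment> \<open>An operator with value \<open>v\<close> at \<open>d\<close> and \<open>0\<close> elsewhere on \<open>D\<close>; by \<open>det\<close> its value at \<open>b\<close>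
      does not depend on the choice.\<close>
    define sel where "sel d v = (SOME \<alpha>. \<alpha> \<in> A \<and> (\<forall>d'\<in>D. \<alpha> d' = (if d' = d then v else 0)))" for d v
    have sel: "sel d v \<in> A \<and> (\<forall>d'\<in>D. sel d v d' = (if d' = d then v else 0))" if "v \<in> V" for d v
    proof -
      have "(\<lambda>d'. if d' = d then v else 0) ` D \<subseteq> V" using that cvec.subspace_0[OF sub] by auto
      from IH[OF this] show ?thesis unfolding sel_def by (intro someI_ex[of "\<lambda>\<alpha>. \<alpha> \<in> A \<and> _ \<alpha>"]) blast
    qed
    define T where "T d v = sel d v b" for d v
    have T: "T d v = \<alpha> b" if "\<alpha> \<in> A" "v \<in> V" "\<forall>d'\<in>D. \<alpha> d' = (if d' = d then v else 0)" for d v \<alpha>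
      unfolding T_def using sel[OF that(2)] that by (intro det) auto
    have "\<exists>a. \<forall>x\<in>V. T d x = a *\<^sub>C x" for d
    proof (rule schur_scalar[OF fd irr])
      show "linear_on V (T d)"
      proof (rule linear_onI)
        fix x y assume x: "x \<in> V" and y: "y \<in> V"
        have "T d (x + y) = (sel d x + sel d y) b"
          using sel[OF x, of d] sel[OF y, of d]
          by (intro T cvec.subspace_add[OF A] cvec.subspace_add[OF sub x y] ballI) simp_all
        then show "T d (x + y) = T d x + T d y" by (simp add: T_def)
      next
        fix c x assume x: "x \<in> V"
        have "T d (c *\<^sub>C x) = (c *\<^sub>C sel d x) b"
          using sel[OF x, of d]
          by (intro T cvec.subspace_scale[OF A] cvec.subspace_scale[OF sub x] ballI) simp_all
        then show "T d (c *\<^sub>C x) = c *\<^sub>C T d x" by (simp add: T_def)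
      qed
      show "T d ` V \<subseteq> V" using AV bV sel unfolding T_def by blast
      fix g x assume g: "g \<in> carrier G" and x: "x \<in> V"
      obtain \<gamma> where \<gamma>: "\<gamma> \<in> A" "\<forall>y\<in>V. \<gamma> y = \<rho> g (sel d x y)"
        using rep_span_left_mult[OF rep G g] sel[OF x, of d] unfolding A_def by blast
      have "T d (\<rho> g x) = \<gamma> b"
        using \<gamma> sel[OF x, of d] DV linear_on_0[OF sub group_repD(2)[OF rep g]]
          group_repD(3)[OF rep g x] by (intro T) auto
      also have "\<dots> = \<rho> g (T d x)" using \<gamma>(2) bV by (simp add: T_def)
      finally show "T d (\<rho> g x) = \<rho> g (T d x)" .
    qed
    then obtain a where a: "\<And>d x. x \<in> V \<Longrightarrow> T d x = a d *\<^sub>C x" by metis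
    have sum_app: "(\<Sum>d\<in>D. sel d d) x = (\<Sum>d\<in>D. sel d d x)" for x
      using insert.hyps(1) by (induction D rule: finite_induct) auto
    have "\<rho> \<one>\<^bsub>G\<^esub> b = (\<Sum>d\<in>D. sel d d) b"
    proof (rule det[OF Aid])
      show "(\<Sum>d\<in>D. sel d d) \<in> A" using sel DV by (intro cvec.subspace_sum[OF A]) blast
      show "\<forall>d\<in>D. \<rho> \<one>\<^bsub>G\<^esub> d = (\<Sum>d\<in>D. sel d d) d"
      proof
        fix d assume d: "d \<in> D"
        have "(\<Sum>d'\<in>D. sel d' d' d) = (\<Sum>d'\<in>D. if d' = d then d else 0)"
          using sel DV d by (intro sum.cong refl) auto
        then show "\<rho> \<one>\<^bsub>G\<^esub> d = (\<Sum>d\<in>D. sel d d) d"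
          using d DV insert.hyps(1) group_rep_one[OF G rep, of d] unfolding sum_app by auto
      qed
    qed
    also have "\<dots> = (\<Sum>d\<in>D. a d *\<^sub>C d)"
      unfolding sum_app using a DV by (intro sum.cong refl) (auto simp: T_def[symmetric])
    finally have "b = (\<Sum>d\<in>D. a d *\<^sub>C d)" using group_rep_one[OF G rep bV] by simp
    also have "\<dots> \<in> cvec.span D" by (intro cvec.span_sum cvec.span_scale cvec.span_base)
    finally show ?thesis using b_notin by blast
  qed
qed

theorem burnside:
  assumes G: "group G" and fd: "fin_dim_space V" and irr: "irreducible_rep G V \<rho>"
    and T: "linear_on V T" "T ` V \<subseteq> V"
  shows "\<exists>D c. finite D \<and> D \<subseteq> carrier G \<and> (\<forall>x\<in>V. (\<Sum>g\<in>D. c g *\<^sub>C \<rho> g x) = T x)"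
proof -
  have rep: "group_rep G V \<rho>" using irr by (auto simp: irreducible_rep_def)
  obtain A where A: "finite A" "V = cvec.span A" using fd unfolding fin_dim_space_def by blast
  obtain B where B: "B \<subseteq> V" "cvec.independent B" "V \<subseteq> cvec.span B"
    using cvec.maximal_independent_subset by blast
  have finB: "finite B" using cvec.independent_span_bound[OF A(1) B(2)] B(1) A(2) by blast
  have VB: "V = cvec.span B" using B(1,3) A(2) cvec.span_minimal[of B V] by auto
  obtain \<alpha> where \<alpha>: "\<alpha> \<in> cvec.span (\<rho> ` carrier G)" "\<forall>b\<in>B. \<alpha> b = T b"
    using irreducible_rep_density[OF G fd irr finB B(2,1), of T] T(2) B(1) by blast
  have eq: "\<alpha> x = T x" if "x \<in> V" for x
  proof (rule span_extension_unique[of B \<alpha> T])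
    show "linear_on (cvec.span B) \<alpha>" "linear_on (cvec.span B) T" "x \<in> cvec.span B"
      using rep_span_linear[OF rep \<alpha>(1)] T(1) that unfolding VB by blast+
  qed (use \<alpha>(2) in blast)
  obtain t r where t: "finite t" "t \<subseteq> \<rho> ` carrier G" "\<alpha> = (\<Sum>a\<in>t. r a *\<^sub>C a)"
    using \<alpha>(1)[unfolded cvec.span_explicit mem_Collect_eq] by (elim exE conjE)
  obtain D where D: "D \<subseteq> carrier G" "inj_on \<rho> D" "t = \<rho> ` D"
    using t(2) by (meson subset_image_inj)
  have finD: "finite D" using t(1) D(2,3) by (simp add: finite_image_iff)
  have sum_app: "(\<Sum>g\<in>D. r (\<rho> g) *\<^sub>C \<rho> g) x = (\<Sum>g\<in>D. r (\<rho> g) *\<^sub>C \<rho> g x)" for x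
    using finD by (induction D rule: finite_induct) auto
  have "\<alpha> = (\<Sum>g\<in>D. r (\<rho> g) *\<^sub>C \<rho> g)"
    unfolding t(3) D(3) sum.reindex[OF D(2)] comp_def ..
  then have "\<forall>x\<in>V. (\<Sum>g\<in>D. r (\<rho> g) *\<^sub>C \<rho> g x) = T x" using eq sum_app by metis
  then show ?thesis using finD D(1) by (intro exI[of _ D] exI[of _ "\<lambda>g. r (\<rho> g)"]) blast
qed

text \<open>
  Burnside's theorem for the endomorphism \<open>m \<mapsto> \<beta>\<^sub>j(m) b\<^sub>i\<close>: the product of a coordinate of \<open>\<phi>\<close> and a coordinate
  of \<open>m\<close> is a fixed finite combination of values of the matrix coefficient of \<open>\<phi>\<close> and \<open>m\<close>.
\<close>

lemma irreducible_rep_matrix_unit: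
  assumes G: "group G" and irr: "irreducible_rep G V \<rho>" and D: "dual_bases J V b \<beta>"
    and ij: "i \<in> J" "j \<in> J"
  shows "\<exists>D c. finite D \<and> D \<subseteq> carrier G \<and>
    (\<forall>\<phi>\<in>dual V. \<forall>m\<in>V. (\<Sum>g\<in>D. c g * \<phi> (\<rho> g m)) = \<phi> (b i) * \<beta> j m)"
proof -
  have rep: "group_rep G V \<rho>" using irr by (auto simp: irreducible_rep_def)
  define T where "T m = \<beta> j m *\<^sub>C b i" for m
  have T: "linear_on V T"
    using linear_on_dual[OF dual_basesD(3)[OF D ij(2)]]
    by (auto simp: T_def linear_on_def scaleC_add_left scaleC_scaleC)
  have TV: "T ` V \<subseteq> V"
    using cvec.subspace_scale[OF dual_basesD(6)[OF D] dual_basesD(4)[OF D ij(1)]]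
    unfolding T_def by blast
  obtain E c where E: "finite E" "E \<subseteq> carrier G"
      and T: "\<forall>x\<in>V. (\<Sum>g\<in>E. c g *\<^sub>C \<rho> g x) = T x"
    using burnside[OF G dual_basesD(7)[OF D] irr T TV] by blast
  have "(\<Sum>g\<in>E. c g * \<phi> (\<rho> g m)) = \<phi> (b i) * \<beta> j m" if \<phi>: "\<phi> \<in> dual V" and m: "m \<in> V" for \<phi> m
  proof -
    have "\<phi> (\<Sum>g\<in>E. c g *\<^sub>C \<rho> g m) = (\<Sum>g\<in>E. c g *\<^sub>C \<phi> (\<rho> g m))"
      by (rule linear_on_lincomb[OF group_repD(1)[OF rep] linear_on_dual[OF \<phi>]])
        (use E(2) group_repD(3)[OF rep] m in blast)
    moreover have "\<phi> (\<Sum>g\<in>E. c g *\<^sub>C \<rho> g m) = \<beta> j m *\<^sub>C \<phi> (b i)"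
      using T m linear_on_scaleD[OF linear_on_dual[OF \<phi>] dual_basesD(4)[OF D ij(1)]]
      by (simp add: T_def)
    ultimately show ?thesis by (simp add: mult.commute)
  qed
  with E show ?thesis by blast
qed


section \<open>Dual bases of tensor products\<close>

lemma subspace_tensor: "cvec.subspace (tensor I V)"
  unfolding tensor_def by (rule cvec.subspace_span)

lemma subspace_tensor2: "cvec.subspace (tensor2 V W)"
  unfolding tensor2_def by (rule cvec.subspace_span)

text \<open>
  The factors of a pure tensor are moved from \<open>V\<^sub>i\<close> into \<open>A\<^sub>i\<close> one slot at a time; \<open>J\<close> collects the
  slots that still range over all of \<open>V\<^sub>i\<close>.
\<close>

lemma tensor_span:
  assumes I: "finite I" and V: "\<And>i. i \<in> I \<Longrightarrow> V i = cvec.span (A i)"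
  shows "tensor I V = cvec.span (tensor_vec I V ` Pi\<^sub>E I A)" (is "_ = ?S")
proof
  have "Pi\<^sub>E I A \<subseteq> Pi\<^sub>E I V" using V by (intro PiE_mono) (auto intro: cvec.span_base)
  then show "?S \<subseteq> tensor I V" unfolding tensor_def by (intro cvec.span_mono image_mono)
  have "\<forall>x\<in>Pi\<^sub>E I V. (\<forall>i\<in>I - J. x i \<in> A i) \<longrightarrow> tensor_vec I V x \<in> ?S"
    if "finite J" "J \<subseteq> I" for J
    using that
  proof (induction J rule: finite_induct)
    case empty
    show ?case
    proof (intro ballI impI)
      fix x assume "x \<in> Pi\<^sub>E I V" "\<forall>i\<in>I - {}. x i \<in> A i"
      then have "x \<in> Pi\<^sub>E I A" by (auto simp: PiE_iff)
      then show "tensor_vec I V x \<in> ?S" by (intro cvec.span_base imageI)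
    qed
  next
    case (insert i J)
    show ?case
    proof (intro ballI impI)
      fix x assume x: "x \<in> Pi\<^sub>E I V" and xA: "\<forall>j\<in>I - insert i J. x j \<in> A j"
      have i: "i \<in> I" using insert.prems by simp
      have "linear_on (cvec.span (A i)) (\<lambda>a. tensor_vec I V (x(i := a)))"
        using multilinear_on_tensor_vec[of I V] x i V[OF i] unfolding multilinear_on_def by metis
      moreover have "(\<lambda>a. tensor_vec I V (x(i := a))) ` A i \<subseteq> ?S"
      proof (rule image_subsetI)
        fix a assume a: "a \<in> A i"
        have "x(i := a) \<in> Pi\<^sub>E I V"
          using x i a V[OF i] by (auto simp: PiE_iff extensional_def intro: cvec.span_base)
        moreover have "\<forall>j\<in>I - J. (x(i := a)) j \<in> A j" using xA a by auto
        ultimately show "tensor_vec I V (x(i := a)) \<in> ?S" using insert by blast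
      qed
      ultimately have "(\<lambda>a. tensor_vec I V (x(i := a))) ` cvec.span (A i) \<subseteq> ?S"
        by (rule linear_on_span_image) (rule cvec.subspace_span)
      moreover have "x i \<in> cvec.span (A i)" using x i V[OF i] by auto
      ultimately have "tensor_vec I V (x(i := x i)) \<in> ?S" by blast
      then show "tensor_vec I V x \<in> ?S" by (simp only: fun_upd_triv)
    qed
  qed
  from this[OF I subset_refl] have "tensor_vec I V ` Pi\<^sub>E I V \<subseteq> ?S" by blast
  then show "tensor I V \<subseteq> ?S"
    unfolding tensor_def by (rule cvec.span_minimal) (rule cvec.subspace_span)
qed

lemma prod_of_bool_eq:
  assumes "finite I" "j \<in> Pi\<^sub>E I J" "k \<in> Pi\<^sub>E I J"
  shows "(\<Prod>i\<in>I. of_bool (j i = k i) :: complex) = of_bool (j = k)"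
proof (cases "j = k")
  case False
  then obtain i where "i \<in> I" "j i \<noteq> k i" using assms(2,3) PiE_ext by metis
  then show ?thesis using assms(1) False by (auto intro!: prod_zero)
qed simp

lemma dual_bases_tensor:
  assumes I: "finite I" and D: "\<And>i. i \<in> I \<Longrightarrow> dual_bases (J i) (V i) (b i) (\<beta> i)"
  shows "dual_bases (Pi\<^sub>E I J) (tensor I V) (\<lambda>j. tensor_vec I V (\<lambda>i\<in>I. b i (j i)))
    (\<lambda>j. tensor_functional I V (\<lambda>i. \<beta> i (j i)))"
proof (rule dual_basesI)
  show "finite (Pi\<^sub>E I J)" using I dual_basesD(1)[OF D] by (rule finite_PiE)
  have "Pi\<^sub>E I (\<lambda>i. b i ` J i) = (\<lambda>j. \<lambda>i\<in>I. b i (j i)) ` Pi\<^sub>E I J"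
  proof
    show "Pi\<^sub>E I (\<lambda>i. b i ` J i) \<subseteq> (\<lambda>j. \<lambda>i\<in>I. b i (j i)) ` Pi\<^sub>E I J"
    proof
      fix x assume x: "x \<in> Pi\<^sub>E I (\<lambda>i. b i ` J i)"
      then have "\<forall>i\<in>I. \<exists>j. j \<in> J i \<and> x i = b i j" by (auto simp: PiE_iff)
      then obtain j where j: "\<forall>i\<in>I. j i \<in> J i \<and> x i = b i (j i)" by metis
      have "x = (\<lambda>i\<in>I. b i (restrict j I i))" using x j by (auto simp: PiE_iff extensional_def)
      moreover have "restrict j I \<in> Pi\<^sub>E I J" using j by auto
      ultimately show "x \<in> (\<lambda>j. \<lambda>i\<in>I. b i (j i)) ` Pi\<^sub>E I J" by blast
    qed
  qed auto
  then have "tensor_vec I V ` Pi\<^sub>E I (\<lambda>i. b i ` J i) =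
      (\<lambda>j. tensor_vec I V (\<lambda>i\<in>I. b i (j i))) ` Pi\<^sub>E I J"
    by (simp add: image_image)
  then show "tensor I V = cvec.span ((\<lambda>j. tensor_vec I V (\<lambda>i\<in>I. b i (j i))) ` Pi\<^sub>E I J)"
    using tensor_span[OF I dual_basesD(2)[OF D]] by simp
next
  fix j k assume j: "j \<in> Pi\<^sub>E I J" and k: "k \<in> Pi\<^sub>E I J"
  have "tensor_functional I V (\<lambda>i. \<beta> i (j i)) (tensor_vec I V (\<lambda>i\<in>I. b i (k i))) =
      (\<Prod>i\<in>I. \<beta> i (j i) ((\<lambda>i\<in>I. b i (k i)) i))"
    using j k dual_basesD(3,4,6)[OF D] by (intro tensor_functional_vec I) (auto simp: PiE_iff)
  also have "\<dots> = (\<Prod>i\<in>I. of_bool (j i = k i))"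
    using j k dual_basesD(5)[OF D] by (intro prod.cong refl) (auto simp: PiE_iff)
  also have "\<dots> = of_bool (j = k)" by (rule prod_of_bool_eq[OF I j k])
  finally show "tensor_functional I V (\<lambda>i. \<beta> i (j i)) (tensor_vec I V (\<lambda>i\<in>I. b i (k i))) =
      of_bool (j = k)" .
qed (rule tensor_functional_dual)

text \<open>
  The two-fold analogue of \<^const>\<open>tensor_functional\<close>.
\<close>

definition tensor2_functional ::
    "'a::complex_vector set \<Rightarrow> 'b::complex_vector set \<Rightarrow> ('a \<Rightarrow> complex) \<Rightarrow> ('b \<Rightarrow> complex) \<Rightarrow>
     ('a, 'b) tens2 \<Rightarrow> complex" where
  "tensor2_functional V W \<phi> \<psi> t =
     (if t \<in> tensor2 V W then t (\<lambda>a b. if a \<in> V \<and> b \<in> W then \<phi> a * \<psi> b else 0) else 0)"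

lemma tensor2_functional_dual: "tensor2_functional V W \<phi> \<psi> \<in> dual (tensor2 V W)"
  using cvec.subspace_add[OF subspace_tensor2[of V W]] cvec.subspace_scale[OF subspace_tensor2[of V W]]
  unfolding dual_def linear_on_def tensor2_functional_def by simp

lemma tensor2_functional_vec:
  assumes V: "cvec.subspace V" and W: "cvec.subspace W"
    and \<phi>: "\<phi> \<in> dual V" and \<psi>: "\<psi> \<in> dual W" and a: "a \<in> V" and b: "b \<in> W"
  shows "tensor2_functional V W \<phi> \<psi> (tensor2_vec V W a b) = \<phi> a * \<psi> b"
proof -
  let ?F = "\<lambda>a b. if a \<in> V \<and> b \<in> W then \<phi> a * \<psi> b else 0"
  have "?F \<in> bilinear_forms V W"
    using linear_on_dual[OF \<phi>] linear_on_dual[OF \<psi>] cvec.subspace_add[OF V]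
      cvec.subspace_scale[OF V] cvec.subspace_add[OF W] cvec.subspace_scale[OF W]
    unfolding bilinear_forms_def bilinear_on_def linear_on_def by (auto simp: algebra_simps)
  then show ?thesis
    using a b tensor2_vec_in_tensor2[OF a b] by (simp add: tensor2_functional_def tensor2_vec_def)
qed

lemma dual_bases_tensor2:
  assumes D: "dual_bases J V b \<beta>" and E: "dual_bases K W c \<gamma>"
  shows "dual_bases (J \<times> K) (tensor2 V W) (\<lambda>jk. tensor2_vec V W (b (fst jk)) (c (snd jk)))
    (\<lambda>jk. tensor2_functional V W (\<beta> (fst jk)) (\<gamma> (snd jk)))"
proof (rule dual_basesI)
  show "finite (J \<times> K)" using dual_basesD(1)[OF D] dual_basesD(1)[OF E] by simp
  let ?B = "(\<lambda>jk. tensor2_vec V W (b (fst jk)) (c (snd jk))) ` (J \<times> K)"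
  have B: "?B = {tensor2_vec V W x y | x y. x \<in> b ` J \<and> y \<in> c ` K}" by force
  show "tensor2 V W = cvec.span ?B"
  proof
    show "cvec.span ?B \<subseteq> tensor2 V W"
      using dual_basesD(4)[OF D] dual_basesD(4)[OF E]
      by (intro cvec.span_minimal subspace_tensor2) (auto intro: tensor2_vec_in_tensor2)
    have "tensor2_vec V W x y \<in> cvec.span ?B" if "x \<in> V" "y \<in> W" for x y
      using bilinear_span[of "b ` J" "c ` K" "tensor2_vec V W" x y] bilinear_on_tensor2_vec[of V W] that
      unfolding B dual_basesD(2)[OF D, symmetric] dual_basesD(2)[OF E, symmetric] by blast
    then show "tensor2 V W \<subseteq> cvec.span ?B"
      unfolding tensor2_def by (intro cvec.span_minimal cvec.subspace_span) blast
  qed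
next
  fix i j assume "i \<in> J \<times> K" "j \<in> J \<times> K"
  then show "tensor2_functional V W (\<beta> (fst i)) (\<gamma> (snd i)) (tensor2_vec V W (b (fst j)) (c (snd j))) =
      of_bool (i = j)"
    using dual_basesD(3-6)[OF D] dual_basesD(3-6)[OF E]
    by (subst tensor2_functional_vec) (auto simp: prod_eq_iff)
qed (rule tensor2_functional_dual)


section \<open>Maps between tensor products\<close>

lemma tensor_map_in_tensor:
  assumes V: "\<And>i. i \<in> I \<Longrightarrow> cvec.subspace (V i)"
    and f: "\<And>i. i \<in> I \<Longrightarrow> linear_on (V i) (f i)" "\<And>i. i \<in> I \<Longrightarrow> f i ` V i \<subseteq> W i"
    and t: "t \<in> tensor I V"
  shows "tensor_map I V W f t \<in> tensor I W"
proof -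
  have "tensor_map I V W f ` tensor_vec I V ` Pi\<^sub>E I V \<subseteq> tensor I W"
  proof (intro image_subsetI, elim imageE)
    fix s x assume x: "x \<in> Pi\<^sub>E I V" and s: "s = tensor_vec I V x"
    have "(\<lambda>i\<in>I. f i (x i)) \<in> Pi\<^sub>E I W" using x f(2) by (fastforce simp: PiE_iff)
    then show "tensor_map I V W f s \<in> tensor I W"
      unfolding s using tensor_map_vec[OF V f x] tensor_vec_in_tensor by metis
  qed
  then have "tensor_map I V W f ` cvec.span (tensor_vec I V ` Pi\<^sub>E I V) \<subseteq> tensor I W"
    by (rule linear_on_span_image[OF linear_on_tensor_map _ subspace_tensor])
  then show ?thesis using t unfolding tensor_def by blast
qed

lemma tensor_map_compose:
  assumes U: "\<And>i. i \<in> I \<Longrightarrow> cvec.subspace (U i)" and V: "\<And>i. i \<in> I \<Longrightarrow> cvec.subspace (V i)"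
    and f: "\<And>i. i \<in> I \<Longrightarrow> linear_on (U i) (f i)" "\<And>i. i \<in> I \<Longrightarrow> f i ` U i \<subseteq> V i"
    and h: "\<And>i. i \<in> I \<Longrightarrow> linear_on (V i) (h i)" "\<And>i. i \<in> I \<Longrightarrow> h i ` V i \<subseteq> W i"
    and hf: "\<And>i x. i \<in> I \<Longrightarrow> x \<in> U i \<Longrightarrow> h i (f i x) = l i x"
    and t: "t \<in> tensor I U"
  shows "tensor_map I V W h (tensor_map I U V f t) = tensor_map I U W l t"
proof (rule span_extension_unique[where L = "\<lambda>t. tensor_map I V W h (tensor_map I U V f t)"])
  show "linear_on (cvec.span (tensor_vec I U ` Pi\<^sub>E I U))
      (\<lambda>t. tensor_map I V W h (tensor_map I U V f t))"
    by (rule linear_on_compose[OF linear_on_tensor_map linear_on_tensor_map subset_UNIV])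
  show "t \<in> cvec.span (tensor_vec I U ` Pi\<^sub>E I U)" using t unfolding tensor_def .
  fix s assume "s \<in> tensor_vec I U ` Pi\<^sub>E I U"
  then obtain x where x: "x \<in> Pi\<^sub>E I U" "s = tensor_vec I U x" by blast
  have l: "linear_on (U i) (l i)" if "i \<in> I" for i
    using linear_on_compose[OF f(1)[OF that] h(1)[OF that] f(2)[OF that]]
      cvec.subspace_add[OF U[OF that]] cvec.subspace_scale[OF U[OF that]]
    unfolding linear_on_def by (simp add: hf that)
  have lW: "l i ` U i \<subseteq> W i" if "i \<in> I" for i
    using hf[OF that] f(2)[OF that] h(2)[OF that] by (metis image_subset_iff)
  have fx: "(\<lambda>i\<in>I. f i (x i)) \<in> Pi\<^sub>E I V" using x f(2) by (fastforce simp: PiE_iff)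
  have "tensor_map I V W h (tensor_map I U V f s) =
      tensor_vec I W (\<lambda>i\<in>I. h i ((\<lambda>i\<in>I. f i (x i)) i))"
    using tensor_map_vec[OF U f x(1)] tensor_map_vec[OF V h fx] x(2) by simp
  also have "(\<lambda>i\<in>I. h i ((\<lambda>i\<in>I. f i (x i)) i)) = (\<lambda>i\<in>I. l i (x i))"
    using x(1) hf by (intro restrict_ext) (auto simp: PiE_iff)
  also have "tensor_vec I W \<dots> = tensor_map I U W l s"
    using tensor_map_vec[OF U l lW x(1)] x(2) by simp
  finally show "tensor_map I V W h (tensor_map I U V f s) = tensor_map I U W l s" .
qed (rule linear_on_tensor_map)

lemma tensor_map_ident:
  assumes V: "\<And>i. i \<in> I \<Longrightarrow> cvec.subspace (V i)" and f: "\<And>i x. i \<in> I \<Longrightarrow> x \<in> V i \<Longrightarrow> f i x = x"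
    and t: "t \<in> tensor I V"
  shows "tensor_map I V V f t = t"
proof (rule span_extension_unique[where L = "tensor_map I V V f" and L' = "\<lambda>t. t"])
  show "t \<in> cvec.span (tensor_vec I V ` Pi\<^sub>E I V)" using t unfolding tensor_def .
  show "linear_on (cvec.span (tensor_vec I V ` Pi\<^sub>E I V)) (\<lambda>t. t)" by (rule linear_onI) (rule refl)+
  fix s assume "s \<in> tensor_vec I V ` Pi\<^sub>E I V"
  then obtain x where x: "x \<in> Pi\<^sub>E I V" "s = tensor_vec I V x" by blast
  have "linear_on (V i) (f i)" "f i ` V i \<subseteq> V i" if "i \<in> I" for i
    using f[OF that] cvec.subspace_add[OF V[OF that]] cvec.subspace_scale[OF V[OF that]]
    by (auto simp: linear_on_def)
  then have "tensor_map I V V f s = tensor_vec I V (\<lambda>i\<in>I. f i (x i))"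
    unfolding x(2) by (intro tensor_map_vec V x(1))
  also have "(\<lambda>i\<in>I. f i (x i)) = x"
    using x(1) f by (auto simp: PiE_iff extensional_def)
  finally show "tensor_map I V V f s = s" using x(2) by simp
qed (rule linear_on_tensor_map)

lemma tensor2_map_in_tensor2:
  assumes V: "cvec.subspace V" and W: "cvec.subspace W"
    and f: "linear_on V f" "f ` V \<subseteq> V'" and h: "linear_on W h" "h ` W \<subseteq> W'"
    and t: "t \<in> tensor2 V W"
  shows "tensor2_map V W V' W' f h t \<in> tensor2 V' W'"
proof -
  have "tensor2_map V W V' W' f h ` {tensor2_vec V W a b | a b. a \<in> V \<and> b \<in> W} \<subseteq> tensor2 V' W'"
  proof (intro image_subsetI, elim CollectE exE conjE)
    fix s a b assume s: "s = tensor2_vec V W a b" and ab: "a \<in> V" "b \<in> W"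
    show "tensor2_map V W V' W' f h s \<in> tensor2 V' W'"
      unfolding s tensor2_map_vec[OF V W f h ab] using ab f(2) h(2) by (auto intro: tensor2_vec_in_tensor2)
  qed
  then have "tensor2_map V W V' W' f h ` cvec.span {tensor2_vec V W a b | a b. a \<in> V \<and> b \<in> W} \<subseteq>
      tensor2 V' W'"
    by (rule linear_on_span_image[OF linear_on_tensor2_map _ subspace_tensor2])
  then show ?thesis using t unfolding tensor2_def by blast
qed

lemma tensor2_map_ident:
  assumes V: "cvec.subspace V" and W: "cvec.subspace W"
    and f: "\<And>x. x \<in> V \<Longrightarrow> f x = x" and h: "\<And>x. x \<in> W \<Longrightarrow> h x = x" and t: "t \<in> tensor2 V W"
  shows "tensor2_map V W V W f h t = t"
proof (rule span_extension_unique[where L = "tensor2_map V W V W f h" and L' = "\<lambda>t. t"])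
  let ?X = "{tensor2_vec V W a b | a b. a \<in> V \<and> b \<in> W}"
  show "t \<in> cvec.span ?X" using t unfolding tensor2_def .
  show "linear_on (cvec.span ?X) (\<lambda>t. t)" by (rule linear_onI) (rule refl)+
  fix s assume "s \<in> ?X"
  then obtain a b where s: "s = tensor2_vec V W a b" "a \<in> V" "b \<in> W" by blast
  have "linear_on V f" "linear_on W h"
    using f h cvec.subspace_add[OF V] cvec.subspace_scale[OF V] cvec.subspace_add[OF W]
      cvec.subspace_scale[OF W] by (simp_all add: linear_on_def)
  moreover have "f ` V \<subseteq> V" "h ` W \<subseteq> W" using f h by auto
  ultimately show "tensor2_map V W V W f h s = s"
    using tensor2_map_vec[OF V W _ _ _ _ s(2,3), of f V h W] f[OF s(2)] h[OF s(3)] s(1) by simp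
qed (rule linear_on_tensor2_map)


section \<open>Invariants of a tensor product\<close>

text \<open>
  Contracting all slots but \<open>i\<close> of a tensor \<open>t\<close> against functionals leaves a vector \<open>y\<close> of \<open>V\<^sub>i\<close>, and
  this is compatible with linear maps in the slot \<open>i\<close>. For \<open>t = \<Otimes>x\<^sub>j\<close> the vector is
  \<open>(\<Prod>\<^sub>j \<psi>\<^sub>j(x\<^sub>j)) x\<^sub>i\<close>, the product being over \<open>j \<noteq> i\<close>; in general it is a sum of such vectors.
  Quantifying over \<open>f\<close> inside makes the same \<open>y\<close> serve for the identity, a group element and a projection.
\<close>

lemma tensor_contraction:
  assumes I: "finite I" and V: "\<And>i. i \<in> I \<Longrightarrow> cvec.subspace (V i)"
    and \<psi>: "\<And>j. j \<in> I - {i} \<Longrightarrow> \<psi> j \<in> dual (V j)" and i: "i \<in> I" and t: "t \<in> tensor I V"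
  shows "\<exists>y\<in>V i. \<forall>f \<eta>. linear_on (V i) f \<longrightarrow> f ` V i \<subseteq> V i \<longrightarrow> \<eta> \<in> dual (V i) \<longrightarrow>
    tensor_functional I V (\<psi>(i := \<eta>)) (tensor_map I V V ((\<lambda>_ x. x)(i := f)) t) = \<eta> (f y)"
proof -
  define N where "N f \<eta> t = tensor_functional I V (\<psi>(i := \<eta>)) (tensor_map I V V ((\<lambda>_ x. x)(i := f)) t)"
    for f \<eta> t
  define Q where "Q y t \<longleftrightarrow> (\<forall>f \<eta>. linear_on (V i) f \<longrightarrow> f ` V i \<subseteq> V i \<longrightarrow> \<eta> \<in> dual (V i) \<longrightarrow>
    N f \<eta> t = \<eta> (f y))" for y t
  have QI: "Q y t" if "\<And>f \<eta>. linear_on (V i) f \<Longrightarrow> f ` V i \<subseteq> V i \<Longrightarrow> \<eta> \<in> dual (V i) \<Longrightarrow>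
      N f \<eta> t = \<eta> (f y)" for y t
    unfolding Q_def using that by (intro allI impI)
  have QD: "N f \<eta> t = \<eta> (f y)"
    if "Q y t" "linear_on (V i) f" "f ` V i \<subseteq> V i" "\<eta> \<in> dual (V i)" for y t f \<eta>
    using that unfolding Q_def by (elim allE impE)
  have mapI: "linear_on (V j) (((\<lambda>_ x. x)(i := f)) j)" "((\<lambda>_ x. x)(i := f)) j ` V j \<subseteq> V j"
    if "linear_on (V i) f" "f ` V i \<subseteq> V i" for f and j
    using that by (cases "j = i"; simp add: linear_onI)+
  have N_linear: "linear_on (tensor I V) (N f \<eta>)" if "linear_on (V i) f" "f ` V i \<subseteq> V i" for f \<eta>
    unfolding N_def
    by (rule linear_on_compose[OF linear_on_tensor_map linear_on_dual[OF tensor_functional_dual]])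
      (rule image_subsetI, rule tensor_map_in_tensor[OF V mapI[OF that]])
  have pure: "\<exists>y\<in>V i. Q y (tensor_vec I V x)" if x: "x \<in> Pi\<^sub>E I V" for x
  proof -
    define c where "c = (\<Prod>j\<in>I - {i}. \<psi> j (x j))"
    have xi: "x i \<in> V i" using x i by auto
    have y: "c *\<^sub>C x i \<in> V i" by (rule cvec.subspace_scale[OF V[OF i] xi])
    have "N f \<eta> (tensor_vec I V x) = \<eta> (f (c *\<^sub>C x i))"
      if f: "linear_on (V i) f" "f ` V i \<subseteq> V i" and \<eta>: "\<eta> \<in> dual (V i)" for f \<eta>
    proof -
      let ?f = "(\<lambda>_ x. x)(i := f)"
      have fxi: "f (x i) \<in> V i" using f(2) xi by blast
      have fx: "(\<lambda>j\<in>I. ?f j (x j)) \<in> Pi\<^sub>E I V" using x fxi by (auto simp: PiE_iff)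
      have eq: "tensor_map I V V ?f (tensor_vec I V x) = tensor_vec I V (\<lambda>j\<in>I. ?f j (x j))"
        by (rule tensor_map_vec[OF V mapI[OF f] x])
      have "N f \<eta> (tensor_vec I V x) = (\<Prod>j\<in>I. (\<psi>(i := \<eta>)) j ((\<lambda>j\<in>I. ?f j (x j)) j))"
        unfolding N_def eq
        by (rule tensor_functional_vec[OF I V _ fx]) (use \<psi> \<eta> in auto)
      also have "\<dots> = \<eta> (f (x i)) * c"
        using i I unfolding c_def by (subst prod.remove[of I i]) (auto intro!: prod.cong)
      also have "\<dots> = \<eta> (f (c *\<^sub>C x i))"
        using linear_on_scaleD[OF f(1) xi] linear_on_scaleD[OF linear_on_dual[OF \<eta>] fxi]
        by simp
      finally show ?thesis .
    qed
    then have "Q (c *\<^sub>C x i) (tensor_vec I V x)" by (rule QI)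
    with y show ?thesis by (rule bexI[rotated])
  qed
  have "t \<in> tensor I V \<and> (\<exists>y\<in>V i. Q y t)"
    using t unfolding tensor_def
  proof (induction rule: cvec.span_induct_alt)
    case base
    have "Q 0 0"
    proof (rule QI)
      fix f \<eta> assume that: "linear_on (V i) f" "f ` V i \<subseteq> V i" "\<eta> \<in> dual (V i)"
      show "N f \<eta> 0 = \<eta> (f 0)"
      using linear_on_0[OF subspace_tensor N_linear[OF that(1,2)]] linear_on_0[OF V[OF i] that(1)]
        linear_on_0[OF V[OF i] linear_on_dual[OF that(3)]] by simp
    qed
    then show ?case using cvec.span_zero cvec.subspace_0[OF V[OF i]] by blast
  next
    case (step c s s')
    then obtain x where x: "x \<in> Pi\<^sub>E I V" "s = tensor_vec I V x" by blast
    have s: "s \<in> tensor I V" unfolding x(2) by (rule tensor_vec_in_tensor[OF x(1)])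
    have cs: "c *\<^sub>C s \<in> tensor I V" by (rule cvec.subspace_scale[OF subspace_tensor s])
    have s': "s' \<in> tensor I V" using step(2) unfolding tensor_def ..
    obtain y where y: "y \<in> V i" "Q y s" using pure[OF x(1)] unfolding x(2) ..
    obtain y' where y': "y' \<in> V i" "Q y' s'" using step(2) by blast
    have cy: "c *\<^sub>C y \<in> V i" by (rule cvec.subspace_scale[OF V[OF i] y(1)])
    have "N f \<eta> (c *\<^sub>C s + s') = \<eta> (f (c *\<^sub>C y + y'))"
      if f: "linear_on (V i) f" "f ` V i \<subseteq> V i" and \<eta>: "\<eta> \<in> dual (V i)" for f \<eta>
    proof -
      have fy: "f y \<in> V i" "f y' \<in> V i" "f (c *\<^sub>C y) \<in> V i" using f(2) y(1) y'(1) cy by auto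
      have "N f \<eta> (c *\<^sub>C s + s') = c * \<eta> (f y) + \<eta> (f y')"
        using linear_on_addD[OF N_linear[OF f] cs s'] linear_on_scaleD[OF N_linear[OF f] s]
          QD[OF y(2) f \<eta>] QD[OF y'(2) f \<eta>] by simp
      also have "\<dots> = \<eta> (f (c *\<^sub>C y + y'))"
        using linear_on_addD[OF f(1) cy y'(1)] linear_on_addD[OF linear_on_dual[OF \<eta>] fy(3,2)]
          linear_on_scaleD[OF f(1) y(1)] linear_on_scaleD[OF linear_on_dual[OF \<eta>] fy(1)] by simp
      finally show ?thesis .
    qed
    then have "Q (c *\<^sub>C y + y') (c *\<^sub>C s + s')" by (rule QI)
    moreover have "c *\<^sub>C y + y' \<in> V i" by (rule cvec.subspace_add[OF V[OF i] cy y'(1)])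
    moreover have "c *\<^sub>C s + s' \<in> cvec.span (tensor_vec I V ` Pi\<^sub>E I V)"
      using cvec.subspace_add[OF subspace_tensor cs s'] unfolding tensor_def .
    ultimately show ?case by (intro conjI bexI)
  qed
  then show ?thesis unfolding Q_def N_def by (rule conjunct2)
qed

text \<open>
  Products of functionals separate the points of a tensor product, because they contain the coordinate
  functionals of a basis.
\<close>

lemma tensor_eqI:
  assumes I: "finite I" and V: "\<And>i. i \<in> I \<Longrightarrow> fin_dim_space (V i)"
    and s: "s \<in> tensor I V" and t: "t \<in> tensor I V"
    and eq: "\<And>\<psi>. (\<And>i. i \<in> I \<Longrightarrow> \<psi> i \<in> dual (V i)) \<Longrightarrow>
      tensor_functional I V \<psi> s = tensor_functional I V \<psi> t"
  shows "s = t"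
proof -
  have "\<forall>i\<in>I. \<exists>B \<beta>. dual_bases B (V i) (\<lambda>b. b) \<beta>" using fin_dim_dual_bases[OF V] by blast
  then obtain B \<beta> where D: "\<And>i. i \<in> I \<Longrightarrow> dual_bases (B i) (V i) (\<lambda>b. b) (\<beta> i)" by metis
  show ?thesis
    by (rule dual_bases_eqI[OF dual_bases_tensor[OF I D] s t])
      (use dual_basesD(3)[OF D] in \<open>auto intro!: eq simp: PiE_iff\<close>)
qed

lemma subspace_invariants:
  assumes V: "cvec.subspace V" and \<rho>: "\<And>k. k \<in> H \<Longrightarrow> linear_on V (\<rho> k)"
  shows "cvec.subspace (invariants H V \<rho>)"
proof (rule cvec.subspaceI)
  show "0 \<in> invariants H V \<rho>"
    using cvec.subspace_0[OF V] linear_on_0[OF V \<rho>] by (simp add: invariants_def)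
next
  fix x y assume "x \<in> invariants H V \<rho>" "y \<in> invariants H V \<rho>"
  then show "x + y \<in> invariants H V \<rho>"
    using cvec.subspace_add[OF V] linear_on_addD[OF \<rho>] by (simp add: invariants_def)
next
  fix c x assume "x \<in> invariants H V \<rho>"
  then show "c *\<^sub>C x \<in> invariants H V \<rho>"
    using cvec.subspace_scale[OF V] linear_on_scaleD[OF \<rho>] by (simp add: invariants_def)
qed

lemma projection_onto:
  assumes "cvec.subspace U"
  obtains p where "linear_on UNIV p" "p ` UNIV \<subseteq> U" "\<And>x. x \<in> U \<Longrightarrow> p x = x"
proof -
  have "Vector_Spaces.linear (*\<^sub>C) (*\<^sub>C) (\<lambda>x :: 'a. x)" by (rule cvec.linear_ident)
  then obtain p where p: "range p \<subseteq> U" "Vector_Spaces.linear (*\<^sub>C) (*\<^sub>C) p" "\<forall>v\<in>U. p v = v"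
    using cvec.linear_exists_left_inverse_on[OF _ assms inj_on_id2] by blast
  interpret l: Vector_Spaces.linear "(*\<^sub>C)" "(*\<^sub>C)" p by (rule p(2))
  have "linear_on UNIV p" unfolding linear_on_def using l.add l.scale by blast
  with p that show thesis by blast
qed

text \<open>
  The inclusion has the left inverse \<open>\<Otimes>p\<^sub>i\<close>, where \<open>p\<^sub>i\<close> is a linear projection onto \<open>U\<^sub>i\<close>.
  It is a right inverse on invariant tensors \<open>t\<close>: elements of the product group
  that are trivial off \<open>i\<close> show that the contractions of \<open>t\<close> to the slot \<open>i\<close> lie in \<open>U\<^sub>i\<close>, hence
  are fixed by \<open>p\<^sub>i\<close>, so that \<open>p\<^sub>i\<close> in the slot \<open>i\<close> fixes \<open>t\<close>.
\<close>

theorem tensor_invariants: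
  fixes V :: "'i \<Rightarrow> 'a::complex_vector set" and H :: "'i \<Rightarrow> 'k set"
  assumes I: "finite I" and V: "\<And>i. i \<in> I \<Longrightarrow> fin_dim_space (V i)"
    and \<rho>: "\<And>i k. i \<in> I \<Longrightarrow> k \<in> H i \<Longrightarrow> linear_on (V i) (\<rho> i k)"
      "\<And>i k. i \<in> I \<Longrightarrow> k \<in> H i \<Longrightarrow> \<rho> i k ` V i \<subseteq> V i"
    and e: "\<And>i. i \<in> I \<Longrightarrow> e \<in> H i" "\<And>i x. i \<in> I \<Longrightarrow> x \<in> V i \<Longrightarrow> \<rho> i e x = x"
    and U: "\<And>i. i \<in> I \<Longrightarrow> U i = invariants (H i) (V i) (\<rho> i)"
  shows "linear_iso (tensor I U) (invariants (Pi\<^sub>E I H) (tensor I V) (tensor_rep I V \<rho>))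
    (tensor_incl I U V)"
proof -
  have sV: "cvec.subspace (V i)" if "i \<in> I" for i
    using V[OF that] unfolding fin_dim_space_def by auto
  have sU: "cvec.subspace (U i)" if "i \<in> I" for i
    unfolding U[OF that] by (rule subspace_invariants[OF sV[OF that] \<rho>(1)[OF that]])
  have UV: "U i \<subseteq> V i" if "i \<in> I" for i unfolding U[OF that] invariants_def by blast
  have id_lin: "linear_on W (\<lambda>x. x)" for W :: "'a set" by (rule linear_onI) (rule refl)+
  have "\<forall>i. \<exists>p. i \<in> I \<longrightarrow> linear_on UNIV p \<and> p ` UNIV \<subseteq> U i \<and> (\<forall>x\<in>U i. p x = x)"
    using projection_onto[OF sU] by metis
  then obtain p where "\<forall>i. i \<in> I \<longrightarrow> linear_on UNIV (p i) \<and> p i ` UNIV \<subseteq> U i \<and> (\<forall>x\<in>U i. p i x = x)"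
    by metis
  then have pl: "linear_on W (p i)" and pU: "p i x \<in> U i" and p_id: "x \<in> U i \<Longrightarrow> p i x = x"
    if "i \<in> I" for i x W
    using that by (blast intro: linear_on_subset)+
  have p: "linear_on (V i) (p i)" "p i ` V i \<subseteq> U i" "p i ` V i \<subseteq> V i" if "i \<in> I" for i
    using pl[OF that] pU[OF that] UV[OF that] by auto
  have incl_inv: "tensor_rep I V \<rho> k (tensor_incl I U V s) = tensor_incl I U V s"
    if k: "k \<in> Pi\<^sub>E I H" and s: "s \<in> tensor I U" for k s
    unfolding tensor_rep_def tensor_incl_def
  proof (rule tensor_map_compose[OF sU sV])
    show "\<rho> i (k i) x = x" if "i \<in> I" "x \<in> U i" for i x
      using that k unfolding U[OF that(1)] invariants_def by auto
    fix i assume i: "i \<in> I"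
    have ki: "k i \<in> H i" using k i by auto
    show "linear_on (V i) (\<rho> i (k i))" by (rule \<rho>(1)[OF i ki])
    show "\<rho> i (k i) ` V i \<subseteq> V i" by (rule \<rho>(2)[OF i ki])
  qed (use UV s id_lin in auto)
  have incl_in: "tensor_incl I U V s \<in> tensor I V" if "s \<in> tensor I U" for s
    unfolding tensor_incl_def by (rule tensor_map_in_tensor[OF sU id_lin _ that]) (use UV in auto)
  have retract: "tensor_map I V U p (tensor_incl I U V s) = s" if s: "s \<in> tensor I U" for s
  proof -
    have "tensor_map I V U p (tensor_incl I U V s) = tensor_map I U U (\<lambda>_ x. x) s"
      unfolding tensor_incl_def
      by (rule tensor_map_compose[OF sU sV id_lin _ p(1,2) _ s]) (use UV p_id in auto)
    also have "\<dots> = s" by (rule tensor_map_ident[OF _ _ s]) (auto intro: sU)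
    finally show ?thesis .
  qed
  have incl_retract: "tensor_incl I U V (tensor_map I V U p t) = t"
    if t: "t \<in> invariants (Pi\<^sub>E I H) (tensor I V) (tensor_rep I V \<rho>)" for t
  proof -
    have tV: "t \<in> tensor I V" and t_inv: "\<And>k. k \<in> Pi\<^sub>E I H \<Longrightarrow> tensor_rep I V \<rho> k t = t"
      using t by (auto simp: invariants_def)
    have slot: "tensor_map I V V ((\<lambda>_ x. x)(i := p i)) t = t" if i: "i \<in> I" for i
    proof (rule tensor_eqI[OF I V _ tV])
      have q: "linear_on (V j) (((\<lambda>_ x. x)(i := p i)) j)" "((\<lambda>_ x. x)(i := p i)) j ` V j \<subseteq> V j"
        if "j \<in> I" for j
        using p[OF that] id_lin by auto
      show "tensor_map I V V ((\<lambda>_ x. x)(i := p i)) t \<in> tensor I V"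
        by (rule tensor_map_in_tensor[OF sV q tV])
      fix \<psi> assume \<psi>: "\<And>j. j \<in> I \<Longrightarrow> \<psi> j \<in> dual (V j)"
      obtain y where y: "y \<in> V i" and N: "\<And>f \<eta>. linear_on (V i) f \<Longrightarrow> f ` V i \<subseteq> V i \<Longrightarrow> \<eta> \<in> dual (V i) \<Longrightarrow>
          tensor_functional I V (\<psi>(i := \<eta>)) (tensor_map I V V ((\<lambda>_ x. x)(i := f)) t) = \<eta> (f y)"
        using tensor_contraction[OF I sV _ i tV, of \<psi>] \<psi> by blast
      have idt: "tensor_map I V V ((\<lambda>_ x. x)(i := (\<lambda>x. x))) t = t"
        by (rule tensor_map_ident[OF _ _ tV]) (auto intro: sV)
      have y0: "tensor_functional I V (\<psi>(i := \<eta>)) t = \<eta> y" if "\<eta> \<in> dual (V i)" for \<eta>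
        using N[OF id_lin _ that] idt by auto
      have "y \<in> U i"
        unfolding U[OF i] invariants_def
      proof (intro CollectI conjI ballI y)
        fix k assume k: "k \<in> H i"
        show "\<rho> i k y = y"
        proof (rule dual_separates[OF sV[OF i] _ y])
          show "\<rho> i k y \<in> V i" using \<rho>(2)[OF i k] y by blast
          fix \<eta> assume \<eta>: "\<eta> \<in> dual (V i)"
          \<comment> \<open>the group element that acts in the slot \<open>i\<close> only\<close>
          define k' where "k' = (\<lambda>j\<in>I. if j = i then k else e)"
          have k': "k' \<in> Pi\<^sub>E I H" using k e(1) by (auto simp: k'_def)
          have "tensor_map I V V ((\<lambda>_ x. x)(i := \<rho> i k)) t = tensor_rep I V \<rho> k' t"
          proof -
            have "tensor_map I V V (\<lambda>_ x. x) (tensor_rep I V \<rho> k' t) =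
                tensor_map I V V ((\<lambda>_ x. x)(i := \<rho> i k)) t"
              unfolding tensor_rep_def
              by (rule tensor_map_compose[OF sV sV _ _ id_lin _ _ tV])
                (use \<rho> e k in \<open>auto simp: k'_def\<close>)
            moreover have "tensor_map I V V (\<lambda>_ x. x) t = t" by (rule tensor_map_ident[OF _ _ tV]) (auto intro: sV)
            ultimately show ?thesis using t_inv[OF k'] by simp
          qed
          then have "tensor_map I V V ((\<lambda>_ x. x)(i := \<rho> i k)) t = t" using t_inv[OF k'] by simp
          then show "\<eta> (\<rho> i k y) = \<eta> y"
            using N[OF \<rho>(1)[OF i k] \<rho>(2)[OF i k] \<eta>] y0[OF \<eta>] by simp
        qed
      qed
      then have "\<psi> i (p i y) = \<psi> i y" using p_id[OF i] by simp
      then show "tensor_functional I V \<psi> (tensor_map I V V ((\<lambda>_ x. x)(i := p i)) t) =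
          tensor_functional I V \<psi> t"
        using N[OF p(1)[OF i] p(3)[OF i] \<psi>[OF i]] y0[OF \<psi>[OF i]] by simp
    qed
    have "tensor_map I V V (\<lambda>i. if i \<in> J then p i else (\<lambda>x. x)) t = t" if "finite J" "J \<subseteq> I" for J
      using that
    proof (induction J rule: finite_induct)
      case empty
      show ?case by (rule tensor_map_ident[OF _ _ tV]) (auto intro: sV)
    next
      case (insert i J)
      then have i: "i \<in> I" and IH: "tensor_map I V V (\<lambda>i. if i \<in> J then p i else (\<lambda>x. x)) t = t" by auto
      have "tensor_map I V V ((\<lambda>_ x. x)(i := p i)) (tensor_map I V V (\<lambda>i. if i \<in> J then p i else (\<lambda>x. x)) t)
          = tensor_map I V V (\<lambda>j. if j \<in> insert i J then p j else (\<lambda>x. x)) t"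
      proof (rule tensor_map_compose[OF sV sV _ _ _ _ _ tV])
        fix j assume j: "j \<in> I"
        show "linear_on (V j) (if j \<in> J then p j else (\<lambda>x. x))"
          "linear_on (V j) (((\<lambda>_ x. x)(i := p i)) j)"
          using p(1)[OF j] id_lin by (cases "j = i"; simp)+
        show "(if j \<in> J then p j else (\<lambda>x. x)) ` V j \<subseteq> V j"
          "((\<lambda>_ x. x)(i := p i)) j ` V j \<subseteq> V j"
          using p(3)[OF j] by (cases "j = i"; simp)+
      qed (use insert.hyps(2) in auto)
      then show ?case using IH slot[OF i] by simp
    qed
    from this[OF I subset_refl]
    have "tensor_map I V V (\<lambda>i. if i \<in> I then p i else (\<lambda>x. x)) t = t" .
    moreover have "tensor_incl I U V (tensor_map I V U p t) =
        tensor_map I V V (\<lambda>i. if i \<in> I then p i else (\<lambda>x. x)) t"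
      unfolding tensor_incl_def
      by (rule tensor_map_compose[OF sV sU p(1,2) id_lin _ _ tV]) (use UV in auto)
    ultimately show ?thesis by simp
  qed
  have "bij_betw (tensor_incl I U V) (tensor I U)
      (invariants (Pi\<^sub>E I H) (tensor I V) (tensor_rep I V \<rho>))"
  proof (rule bij_betw_byWitness[where f' = "tensor_map I V U p"])
    show "tensor_incl I U V ` tensor I U \<subseteq> invariants (Pi\<^sub>E I H) (tensor I V) (tensor_rep I V \<rho>)"
      using incl_in incl_inv unfolding invariants_def by blast
    show "tensor_map I V U p ` invariants (Pi\<^sub>E I H) (tensor I V) (tensor_rep I V \<rho>) \<subseteq> tensor I U"
    proof (rule image_subsetI)
      fix t assume "t \<in> invariants (Pi\<^sub>E I H) (tensor I V) (tensor_rep I V \<rho>)"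
      then have t: "t \<in> tensor I V" by (simp add: invariants_def)
      show "tensor_map I V U p t \<in> tensor I U" by (rule tensor_map_in_tensor[OF sV p(1,2) t])
    qed
  qed (auto simp: retract incl_retract)
  then show ?thesis
    unfolding linear_iso_def tensor_incl_def using linear_on_tensor_map by blast
qed


section \<open>Tensors on a graph\<close>

lemma tensor_functional_cong:
  assumes "\<And>i. i \<in> I \<Longrightarrow> \<phi> i = \<psi> i"
  shows "tensor_functional I V \<phi> = tensor_functional I V \<psi>"
proof -
  have "(\<Prod>i\<in>I. \<phi> i (x i)) = (\<Prod>i\<in>I. \<psi> i (x i))" for x
    using assms by (intro prod.cong) auto
  then show ?thesis unfolding tensor_functional_def by presburger
qed

lemma dual_bases_cong:
  assumes "dual_bases J V b \<beta>" "\<And>j. j \<in> J \<Longrightarrow> b j = b' j"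
  shows "dual_bases J V b' \<beta>"
proof -
  have "b ` J = b' ` J" using assms(2) by (rule image_cong[OF refl])
  then show ?thesis
    using dual_basesD[OF assms(1)] assms(2) by (intro dual_basesI) simp_all
qed

text \<open>
  The representations on the graph together with chosen dual bases: \<open>B\<^sub>e\<close>, \<open>\<beta>\<^sub>e\<close> for \<open>M\<^sub>e\<close> and \<open>C\<^sub>v\<close>, \<open>\<gamma>\<^sub>v\<close>
  for \<open>S\<^sub>v\<close>.
\<close>

locale graph_representation = fin_digraph \<Gamma>
  for \<Gamma> :: "('v, 'e) pre_digraph" +
  fixes G :: "'g monoid" and K :: "'v \<Rightarrow> 'g set"
    and M :: "'e \<Rightarrow> 'm::complex_vector set" and \<pi> :: "'e \<Rightarrow> 'g \<Rightarrow> 'm \<Rightarrow> 'm"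
    and S :: "'v \<Rightarrow> 's::complex_vector set" and \<sigma> :: "'v \<Rightarrow> 'g \<Rightarrow> 's \<Rightarrow> 's"
    and B :: "'e \<Rightarrow> 'm set" and \<beta> :: "'e \<Rightarrow> 'm \<Rightarrow> 'm \<Rightarrow> complex"
    and C :: "'v \<Rightarrow> 's set" and \<gamma> :: "'v \<Rightarrow> 's \<Rightarrow> 's \<Rightarrow> complex"
  assumes G: "group G"
    and K: "\<And>v. v \<in> verts \<Gamma> \<Longrightarrow> subgroup (K v) G"
    and irr: "\<And>e. e \<in> arcs \<Gamma> \<Longrightarrow> irreducible_rep G (M e) (\<pi> e)"
    and \<sigma>: "\<And>v. v \<in> verts \<Gamma> \<Longrightarrow> group_rep (G\<lparr>carrier := K v\<rparr>) (S v) (\<sigma> v)"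
    and B: "\<And>e. e \<in> arcs \<Gamma> \<Longrightarrow> dual_bases (B e) (M e) (\<lambda>b. b) (\<beta> e)"
    and C: "\<And>v. v \<in> verts \<Gamma> \<Longrightarrow> dual_bases (C v) (S v) (\<lambda>c. c) (\<gamma> v)"
begin

lemma \<pi>: "e \<in> arcs \<Gamma> \<Longrightarrow> group_rep G (M e) (\<pi> e)"
  using irr unfolding irreducible_rep_def by blast

lemma subspace_M: "e \<in> arcs \<Gamma> \<Longrightarrow> cvec.subspace (M e)"
  by (rule dual_basesD(6)[OF B])

lemma subspace_S: "v \<in> verts \<Gamma> \<Longrightarrow> cvec.subspace (S v)"
  by (rule dual_basesD(6)[OF C])

definition source_vec ::
    "('e \<Rightarrow> 'm \<Rightarrow> complex) \<Rightarrow> ('e \<Rightarrow> 'm) \<Rightarrow> ('v \<Rightarrow> 's) \<Rightarrow> ('v, (('e, 'm) star_tens, 's) tens2) tens" where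
  "source_vec \<phi> m u =
     tensor_vec (verts \<Gamma>) (vertex_space \<Gamma> M S) (\<lambda>v\<in>verts \<Gamma>. vertex_vec \<Gamma> M S \<phi> m u v)"

definition target_vec ::
    "('e \<Rightarrow> 'm \<Rightarrow> complex) \<Rightarrow> ('e \<Rightarrow> 'm) \<Rightarrow> ('v \<Rightarrow> 's) \<Rightarrow> ('e \<Rightarrow> 'g) \<Rightarrow> ('v, 's) tens" where
  "target_vec \<phi> m u =
     fun_tensor_vec
       (matrix_coeff \<Gamma> G M \<pi> (tensor_functional (arcs \<Gamma>) M \<phi>) (tensor_vec (arcs \<Gamma>) M m))
       (tensor_vec (verts \<Gamma>) S u)"

definition pure_data :: "('e \<Rightarrow> 'm \<Rightarrow> complex) \<Rightarrow> ('e \<Rightarrow> 'm) \<Rightarrow> ('v \<Rightarrow> 's) \<Rightarrow> bool" where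
  "pure_data \<phi> m u \<longleftrightarrow> \<phi> \<in> (\<Pi>\<^sub>E e\<in>arcs \<Gamma>. dual (M e)) \<and> m \<in> Pi\<^sub>E (arcs \<Gamma>) M \<and> u \<in> Pi\<^sub>E (verts \<Gamma>) S"

text \<open>
  A triple \<open>(a, b, c)\<close> selects the covector dual to \<open>a\<^sub>e\<close> and the vector \<open>b\<^sub>e\<close> at each arc, and the
  vector \<open>c\<^sub>v\<close> at each vertex.
\<close>

definition indices :: "(('e \<Rightarrow> 'm) \<times> ('e \<Rightarrow> 'm) \<times> ('v \<Rightarrow> 's)) set" where
  "indices = Pi\<^sub>E (arcs \<Gamma>) B \<times> Pi\<^sub>E (arcs \<Gamma>) B \<times> Pi\<^sub>E (verts \<Gamma>) C"

definition dual_family :: "('e \<Rightarrow> 'm) \<Rightarrow> 'e \<Rightarrow> 'm \<Rightarrow> complex" where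
  "dual_family a = (\<lambda>e\<in>arcs \<Gamma>. \<beta> e (a e))"

text \<open>
  The coordinate with index \<open>(a, b, c)\<close> of the pure tensor built from \<open>\<phi>\<close>, \<open>m\<close>, \<open>u\<close>, in the source and in
  the target alike: the coordinate of the covector \<open>\<phi>\<^sub>e\<close> at the dual of \<open>a\<^sub>e\<close> is \<open>\<phi>\<^sub>e(a\<^sub>e)\<close>.
\<close>

definition pairing ::
    "('e \<Rightarrow> 'm) \<times> ('e \<Rightarrow> 'm) \<times> ('v \<Rightarrow> 's) \<Rightarrow>
     ('e \<Rightarrow> 'm \<Rightarrow> complex) \<Rightarrow> ('e \<Rightarrow> 'm) \<Rightarrow> ('v \<Rightarrow> 's) \<Rightarrow> complex" where
  "pairing = (\<lambda>(a, b, c) \<phi> m u.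
     (\<Prod>e\<in>arcs \<Gamma>. \<phi> e (a e)) * (\<Prod>e\<in>arcs \<Gamma>. \<beta> e (b e) (m e)) * (\<Prod>v\<in>verts \<Gamma>. \<gamma> v (c v) (u v)))"

lemma finite_indices: "finite indices"
  unfolding indices_def
  by (intro finite_cartesian_product finite_PiE dual_basesD(1)[OF B] dual_basesD(1)[OF C]) auto

lemma pure_data_basis:
  assumes "(a, b, c) \<in> indices"
  shows "pure_data (dual_family a) b c"
  using assms dual_basesD(3,4)[OF B] dual_basesD(4)[OF C]
  by (auto simp: indices_def pure_data_def dual_family_def PiE_iff)

lemma pairing_basis:
  assumes x: "x \<in> indices" and y: "(a, b, c) \<in> indices"
  shows "pairing x (dual_family a) b c = of_bool (x = (a, b, c))"
proof -
  obtain a' b' c' where x': "x = (a', b', c')" by (cases x)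
  have mem: "a \<in> Pi\<^sub>E (arcs \<Gamma>) B" "b \<in> Pi\<^sub>E (arcs \<Gamma>) B" "c \<in> Pi\<^sub>E (verts \<Gamma>) C"
      "a' \<in> Pi\<^sub>E (arcs \<Gamma>) B" "b' \<in> Pi\<^sub>E (arcs \<Gamma>) B" "c' \<in> Pi\<^sub>E (verts \<Gamma>) C"
    using x y x' by (auto simp: indices_def)
  have "(\<Prod>e\<in>arcs \<Gamma>. dual_family a e (a' e)) = (\<Prod>e\<in>arcs \<Gamma>. of_bool (a e = a' e))"
    using mem dual_basesD(5)[OF B] by (intro prod.cong refl) (auto simp: dual_family_def PiE_iff)
  moreover have "(\<Prod>e\<in>arcs \<Gamma>. \<beta> e (b' e) (b e)) = (\<Prod>e\<in>arcs \<Gamma>. of_bool (b' e = b e))"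
    using mem dual_basesD(5)[OF B] by (intro prod.cong refl) (auto simp: PiE_iff)
  moreover have "(\<Prod>v\<in>verts \<Gamma>. \<gamma> v (c' v) (c v)) = (\<Prod>v\<in>verts \<Gamma>. of_bool (c' v = c v))"
    using mem dual_basesD(5)[OF C] by (intro prod.cong refl) (auto simp: PiE_iff)
  ultimately show ?thesis
    using mem by (auto simp: pairing_def x' prod_of_bool_eq)
qed


subsection \<open>A dual basis of the source\<close>

definition out_space :: "'v \<Rightarrow> ('e, 'm \<Rightarrow> complex) tens set" where
  "out_space v = tensor (out_arcs \<Gamma> v) (\<lambda>e. dual (M e))"

definition in_space :: "'v \<Rightarrow> ('e, 'm) tens set" where
  "in_space v = tensor (in_arcs \<Gamma> v) M"

definition out_functional :: "'v \<Rightarrow> ('e \<Rightarrow> 'm) \<Rightarrow> ('e, 'm \<Rightarrow> complex) tens \<Rightarrow> complex" where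
  "out_functional v a = tensor_functional (out_arcs \<Gamma> v) (\<lambda>e. dual (M e))
     (\<lambda>e \<phi>. if \<phi> \<in> dual (M e) then \<phi> (a e) else 0)"

definition in_functional :: "'v \<Rightarrow> ('e \<Rightarrow> 'm) \<Rightarrow> ('e, 'm) tens \<Rightarrow> complex" where
  "in_functional v b = tensor_functional (in_arcs \<Gamma> v) M (\<lambda>e. \<beta> e (b e))"

text \<open>
  The index \<open>j = ((a, b), c)\<close> follows the nesting of the tensor product at the vertex: outgoing arcs,
  incoming arcs, the space \<open>S\<^sub>v\<close>.
\<close>

definition vertex_functional ::
    "'v \<Rightarrow> (('e \<Rightarrow> 'm) \<times> ('e \<Rightarrow> 'm)) \<times> 's \<Rightarrow> (('e, 'm) star_tens, 's) tens2 \<Rightarrow> complex" where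
  "vertex_functional v j = tensor2_functional (star_space \<Gamma> M v) (S v)
     (tensor2_functional (out_space v) (in_space v)
       (out_functional v (fst (fst j))) (in_functional v (snd (fst j)))) (\<gamma> v (snd j))"

definition vertex_indices :: "'v \<Rightarrow> ((('e \<Rightarrow> 'm) \<times> ('e \<Rightarrow> 'm)) \<times> 's) set" where
  "vertex_indices v = (Pi\<^sub>E (out_arcs \<Gamma> v) B \<times> Pi\<^sub>E (in_arcs \<Gamma> v) B) \<times> C v"

lemma star_space_eq: "star_space \<Gamma> M v = tensor2 (out_space v) (in_space v)"
  by (simp only: star_space_def out_space_def in_space_def)

lemma vertex_dual_bases:
  assumes v: "v \<in> verts \<Gamma>"
  shows "dual_bases (vertex_indices v) (vertex_space \<Gamma> M S v)
    (\<lambda>j. tensor2_vec (star_space \<Gamma> M v) (S v)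
      (tensor2_vec (out_space v) (in_space v)
        (tensor_vec (out_arcs \<Gamma> v) (\<lambda>e. dual (M e)) (\<lambda>e\<in>out_arcs \<Gamma> v. \<beta> e (fst (fst j) e)))
        (tensor_vec (in_arcs \<Gamma> v) M (\<lambda>e\<in>in_arcs \<Gamma> v. snd (fst j) e)))
      (snd j))
    (vertex_functional v)"
proof -
  have out: "dual_bases (Pi\<^sub>E (out_arcs \<Gamma> v) B) (out_space v)
      (\<lambda>j. tensor_vec (out_arcs \<Gamma> v) (\<lambda>e. dual (M e)) (\<lambda>e\<in>out_arcs \<Gamma> v. \<beta> e (j e)))
      (out_functional v)"
    unfolding out_space_def out_functional_def[abs_def]
    by (rule dual_bases_tensor[OF _ dual_bases_dual[OF B]]) auto
  have "in": "dual_bases (Pi\<^sub>E (in_arcs \<Gamma> v) B) (in_space v)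
      (\<lambda>j. tensor_vec (in_arcs \<Gamma> v) M (\<lambda>e\<in>in_arcs \<Gamma> v. j e)) (in_functional v)"
    unfolding in_space_def in_functional_def[abs_def]
    by (rule dual_bases_tensor[OF _ B]) auto
  show ?thesis
    using dual_bases_tensor2[OF dual_bases_tensor2[OF out "in"] C[OF v]]
    unfolding vertex_indices_def vertex_space_def star_space_eq vertex_functional_def[abs_def] .
qed

lemma subspace_vertex_space: "cvec.subspace (vertex_space \<Gamma> M S v)"
  unfolding vertex_space_def by (rule subspace_tensor2)

lemma subspace_star_space: "cvec.subspace (star_space \<Gamma> M v)"
  unfolding star_space_def by (rule subspace_tensor2)

lemma pure_data_at:
  assumes "pure_data \<phi> m u"
  shows "restrict \<phi> (out_arcs \<Gamma> v) \<in> Pi\<^sub>E (out_arcs \<Gamma> v) (\<lambda>e. dual (M e))"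
    "restrict m (in_arcs \<Gamma> v) \<in> Pi\<^sub>E (in_arcs \<Gamma> v) M"
    "v \<in> verts \<Gamma> \<Longrightarrow> u v \<in> S v"
  using assms unfolding pure_data_def by auto

lemma star_vec_in:
  assumes "pure_data \<phi> m u"
  shows "tensor2_vec (out_space v) (in_space v)
      (tensor_vec (out_arcs \<Gamma> v) (\<lambda>e. dual (M e)) (restrict \<phi> (out_arcs \<Gamma> v)))
      (tensor_vec (in_arcs \<Gamma> v) M (restrict m (in_arcs \<Gamma> v))) \<in> star_space \<Gamma> M v"
  unfolding star_space_eq out_space_def in_space_def
  by (intro tensor2_vec_in_tensor2 tensor_vec_in_tensor pure_data_at[OF assms])

lemma vertex_vec_in:
  assumes "pure_data \<phi> m u" "v \<in> verts \<Gamma>"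
  shows "vertex_vec \<Gamma> M S \<phi> m u v \<in> vertex_space \<Gamma> M S v"
  unfolding vertex_vec_def vertex_space_def out_space_def[symmetric] in_space_def[symmetric]
  by (intro tensor2_vec_in_tensor2 star_vec_in[OF assms(1)] pure_data_at(3)[OF assms])

lemma vertex_functional_vec:
  assumes P: "pure_data \<phi> m u" and v: "v \<in> verts \<Gamma>" and j: "((a, b), c) \<in> vertex_indices v"
  shows "vertex_functional v ((a, b), c) (vertex_vec \<Gamma> M S \<phi> m u v) =
    (\<Prod>e\<in>out_arcs \<Gamma> v. \<phi> e (a e)) * (\<Prod>e\<in>in_arcs \<Gamma> v. \<beta> e (b e) (m e)) * \<gamma> v c (u v)"
proof -
  let ?x = "tensor_vec (out_arcs \<Gamma> v) (\<lambda>e. dual (M e)) (restrict \<phi> (out_arcs \<Gamma> v))"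
  let ?y = "tensor_vec (in_arcs \<Gamma> v) M (restrict m (in_arcs \<Gamma> v))"
  have "out_functional v a ?x = (\<Prod>e\<in>out_arcs \<Gamma> v. (if restrict \<phi> (out_arcs \<Gamma> v) e \<in> dual (M e)
      then restrict \<phi> (out_arcs \<Gamma> v) e (a e) else 0))"
    unfolding out_functional_def
    by (rule tensor_functional_vec[OF _ subspace_dual dual_restrictI[OF _ subspace_dual]
          pure_data_at(1)[OF P]]) (auto simp: linear_on_def)
  also have "\<dots> = (\<Prod>e\<in>out_arcs \<Gamma> v. \<phi> e (a e))"
    using pure_data_at(1)[OF P, of v] by (intro prod.cong refl) (simp add: PiE_iff)
  finally have x: "out_functional v a ?x = (\<Prod>e\<in>out_arcs \<Gamma> v. \<phi> e (a e))" .
  have "in_functional v b ?y = (\<Prod>e\<in>in_arcs \<Gamma> v. \<beta> e (b e) (restrict m (in_arcs \<Gamma> v) e))"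
    unfolding in_functional_def
    by (rule tensor_functional_vec[OF _ subspace_M dual_basesD(3)[OF B] pure_data_at(2)[OF P]])
      (use j in \<open>auto simp: vertex_indices_def\<close>)
  also have "\<dots> = (\<Prod>e\<in>in_arcs \<Gamma> v. \<beta> e (b e) (m e))" by (intro prod.cong refl) simp
  finally have y: "in_functional v b ?y = (\<Prod>e\<in>in_arcs \<Gamma> v. \<beta> e (b e) (m e))" .
  have \<gamma>: "\<gamma> v c \<in> dual (S v)" using dual_basesD(3)[OF C[OF v]] j by (simp add: vertex_indices_def)
  have "tensor2_functional (out_space v) (in_space v) (out_functional v a) (in_functional v b)
      (tensor2_vec (out_space v) (in_space v) ?x ?y) = out_functional v a ?x * in_functional v b ?y"
    by (rule tensor2_functional_vec)
      (auto simp only: out_space_def in_space_def out_functional_def in_functional_def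
        intro!: subspace_tensor tensor_functional_dual tensor_vec_in_tensor pure_data_at[OF P])
  moreover have "vertex_functional v ((a, b), c) (vertex_vec \<Gamma> M S \<phi> m u v) =
      tensor2_functional (out_space v) (in_space v) (out_functional v a) (in_functional v b)
        (tensor2_vec (out_space v) (in_space v) ?x ?y) * \<gamma> v c (u v)"
    unfolding vertex_functional_def vertex_vec_def out_space_def[symmetric] in_space_def[symmetric]
      fst_conv snd_conv
    by (rule tensor2_functional_vec[OF subspace_star_space subspace_S[OF v] _ \<gamma> star_vec_in[OF P]
          pure_data_at(3)[OF P v]]) (simp only: star_space_eq tensor2_functional_dual)
  ultimately show ?thesis by (simp only: x y)
qed

definition star_index ::
    "('e \<Rightarrow> 'm) \<times> ('e \<Rightarrow> 'm) \<times> ('v \<Rightarrow> 's) \<Rightarrow> 'v \<Rightarrow> (('e \<Rightarrow> 'm) \<times> ('e \<Rightarrow> 'm)) \<times> 's" where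
  "star_index = (\<lambda>(a, b, c). \<lambda>v\<in>verts \<Gamma>. ((restrict a (out_arcs \<Gamma> v), restrict b (in_arcs \<Gamma> v)), c v))"

text \<open>
  A family of local indices at the vertices glues to a triple of global ones, because every arc is
  an outgoing arc of exactly one vertex, its tail, and an incoming arc of exactly one vertex, its head.
  This covers loops, which occur in both roles at one vertex.
\<close>

lemma bij_star_index: "bij_betw star_index indices (Pi\<^sub>E (verts \<Gamma>) vertex_indices)"
proof (rule bij_betw_byWitness[where f' = "\<lambda>j. (\<lambda>e\<in>arcs \<Gamma>. fst (fst (j (tail \<Gamma> e))) e,
    \<lambda>e\<in>arcs \<Gamma>. snd (fst (j (head \<Gamma> e))) e, \<lambda>v\<in>verts \<Gamma>. snd (j v))"])
  show "star_index ` indices \<subseteq> Pi\<^sub>E (verts \<Gamma>) vertex_indices"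
    by (auto simp: star_index_def indices_def vertex_indices_def PiE_iff)
  show "(\<lambda>j. (\<lambda>e\<in>arcs \<Gamma>. fst (fst (j (tail \<Gamma> e))) e,
    \<lambda>e\<in>arcs \<Gamma>. snd (fst (j (head \<Gamma> e))) e, \<lambda>v\<in>verts \<Gamma>. snd (j v))) `
      Pi\<^sub>E (verts \<Gamma>) vertex_indices \<subseteq> indices"
  proof (rule image_subsetI)
    fix j assume j: "j \<in> Pi\<^sub>E (verts \<Gamma>) vertex_indices"
    have "fst (fst (j v)) \<in> Pi\<^sub>E (out_arcs \<Gamma> v) B" "snd (fst (j v)) \<in> Pi\<^sub>E (in_arcs \<Gamma> v) B"
        "snd (j v) \<in> C v" if "v \<in> verts \<Gamma>" for v
      using PiE_mem[OF j that] unfolding vertex_indices_def by auto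
    then show "(\<lambda>e\<in>arcs \<Gamma>. fst (fst (j (tail \<Gamma> e))) e,
      \<lambda>e\<in>arcs \<Gamma>. snd (fst (j (head \<Gamma> e))) e, \<lambda>v\<in>verts \<Gamma>. snd (j v)) \<in> indices"
      by (auto simp: indices_def PiE_iff)
  qed
  show "\<forall>x\<in>indices. (\<lambda>j. (\<lambda>e\<in>arcs \<Gamma>. fst (fst (j (tail \<Gamma> e))) e,
      \<lambda>e\<in>arcs \<Gamma>. snd (fst (j (head \<Gamma> e))) e, \<lambda>v\<in>verts \<Gamma>. snd (j v))) (star_index x) = x"
    by (auto simp: indices_def star_index_def PiE_iff extensional_def fun_eq_iff)
  show "\<forall>j\<in>Pi\<^sub>E (verts \<Gamma>) vertex_indices. star_index (\<lambda>e\<in>arcs \<Gamma>. fst (fst (j (tail \<Gamma> e))) e,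
      \<lambda>e\<in>arcs \<Gamma>. snd (fst (j (head \<Gamma> e))) e, \<lambda>v\<in>verts \<Gamma>. snd (j v)) = j"
  proof
    fix j assume j: "j \<in> Pi\<^sub>E (verts \<Gamma>) vertex_indices"
    show "star_index (\<lambda>e\<in>arcs \<Gamma>. fst (fst (j (tail \<Gamma> e))) e,
      \<lambda>e\<in>arcs \<Gamma>. snd (fst (j (head \<Gamma> e))) e, \<lambda>v\<in>verts \<Gamma>. snd (j v)) = j" (is "?l = j")
    proof
      fix v show "?l v = j v"
      proof (cases "v \<in> verts \<Gamma>")
        case True
        obtain a b c where jv: "j v = ((a, b), c)" by (metis surj_pair)
        have ab: "a \<in> Pi\<^sub>E (out_arcs \<Gamma> v) B" "b \<in> Pi\<^sub>E (in_arcs \<Gamma> v) B"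
          using PiE_mem[OF j True] unfolding vertex_indices_def jv by auto
        have "restrict (\<lambda>e\<in>arcs \<Gamma>. fst (fst (j (tail \<Gamma> e))) e) (out_arcs \<Gamma> v) = a"
          "restrict (\<lambda>e\<in>arcs \<Gamma>. snd (fst (j (head \<Gamma> e))) e) (in_arcs \<Gamma> v) = b"
          using ab by (auto simp: fun_eq_iff jv PiE_iff extensional_def restrict_def)
        then show ?thesis using True jv by (simp add: star_index_def)
      next
        case False
        then show ?thesis using j by (simp add: star_index_def PiE_iff extensional_def)
      qed
    qed
  qed
qed

definition source_functional ::
    "('e \<Rightarrow> 'm) \<times> ('e \<Rightarrow> 'm) \<times> ('v \<Rightarrow> 's) \<Rightarrow> ('v, (('e, 'm) star_tens, 's) tens2) tens \<Rightarrow> complex" where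
  "source_functional x =
     tensor_functional (verts \<Gamma>) (vertex_space \<Gamma> M S) (\<lambda>v. vertex_functional v (star_index x v))"

lemma source_dual_bases:
  "dual_bases indices (source_space \<Gamma> M S) (\<lambda>(a, b, c). source_vec (dual_family a) b c) source_functional"
proof -
  have "dual_bases (Pi\<^sub>E (verts \<Gamma>) vertex_indices) (source_space \<Gamma> M S)
      (\<lambda>j. tensor_vec (verts \<Gamma>) (vertex_space \<Gamma> M S) (\<lambda>v\<in>verts \<Gamma>.
        tensor2_vec (star_space \<Gamma> M v) (S v)
          (tensor2_vec (out_space v) (in_space v)
            (tensor_vec (out_arcs \<Gamma> v) (\<lambda>e. dual (M e)) (\<lambda>e\<in>out_arcs \<Gamma> v. \<beta> e (fst (fst (j v)) e)))
            (tensor_vec (in_arcs \<Gamma> v) M (\<lambda>e\<in>in_arcs \<Gamma> v. snd (fst (j v)) e)))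
          (snd (j v))))
      (\<lambda>j. tensor_functional (verts \<Gamma>) (vertex_space \<Gamma> M S) (\<lambda>v. vertex_functional v (j v)))"
    unfolding source_space_def by (rule dual_bases_tensor[OF finite_verts vertex_dual_bases])
  note dual_bases_reindex[OF this bij_star_index, folded source_functional_def]
  then show ?thesis
  proof (rule dual_bases_cong)
    fix x assume "x \<in> indices"
    obtain a b c where x: "x = (a, b, c)" by (cases x)
    have r: "(\<lambda>e\<in>out_arcs \<Gamma> v. \<beta> e (restrict a (out_arcs \<Gamma> v) e)) =
        restrict (dual_family a) (out_arcs \<Gamma> v)"
      "(\<lambda>e\<in>in_arcs \<Gamma> v. restrict b (in_arcs \<Gamma> v) e) = restrict b (in_arcs \<Gamma> v)" for v
      by (auto simp: fun_eq_iff dual_family_def restrict_def)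
    have "(\<lambda>v\<in>verts \<Gamma>. tensor2_vec (star_space \<Gamma> M v) (S v)
          (tensor2_vec (out_space v) (in_space v)
            (tensor_vec (out_arcs \<Gamma> v) (\<lambda>e. dual (M e))
              (\<lambda>e\<in>out_arcs \<Gamma> v. \<beta> e (fst (fst (star_index x v)) e)))
            (tensor_vec (in_arcs \<Gamma> v) M (\<lambda>e\<in>in_arcs \<Gamma> v. snd (fst (star_index x v)) e)))
          (snd (star_index x v))) =
        (\<lambda>v\<in>verts \<Gamma>. vertex_vec \<Gamma> M S (dual_family a) b c v)"
      by (rule restrict_ext)
        (simp only: vertex_vec_def out_space_def in_space_def star_index_def x case_prod_conv
          restrict_apply' fst_conv snd_conv r)
    then show "tensor_vec (verts \<Gamma>) (vertex_space \<Gamma> M S) (\<lambda>v\<in>verts \<Gamma>.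
        tensor2_vec (star_space \<Gamma> M v) (S v)
          (tensor2_vec (out_space v) (in_space v)
            (tensor_vec (out_arcs \<Gamma> v) (\<lambda>e. dual (M e))
              (\<lambda>e\<in>out_arcs \<Gamma> v. \<beta> e (fst (fst (star_index x v)) e)))
            (tensor_vec (in_arcs \<Gamma> v) M (\<lambda>e\<in>in_arcs \<Gamma> v. snd (fst (star_index x v)) e)))
          (snd (star_index x v))) = (case x of (a, b, c) \<Rightarrow> source_vec (dual_family a) b c)"
      unfolding x source_vec_def case_prod_conv by (rule arg_cong)
  qed
qed

text \<open>
  The value is a product over vertices of products over the arcs leaving and entering them; collecting
  the arcs by their tails and by their heads turns these into products over all arcs.
\<close>

lemma source_functional_vec:
  assumes x: "x \<in> indices" and P: "pure_data \<phi> m u"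
  shows "source_functional x (source_vec \<phi> m u) = pairing x \<phi> m u"
proof -
  obtain a b c where x': "x = (a, b, c)" by (cases x)
  have idx: "star_index x v \<in> vertex_indices v" if "v \<in> verts \<Gamma>" for v
    using bij_star_index x that unfolding bij_betw_def by (auto simp: PiE_iff)
  have "source_functional x (source_vec \<phi> m u) =
      (\<Prod>v\<in>verts \<Gamma>. vertex_functional v (star_index x v) ((\<lambda>v\<in>verts \<Gamma>. vertex_vec \<Gamma> M S \<phi> m u v) v))"
    unfolding source_functional_def source_vec_def
    by (rule tensor_functional_vec[OF finite_verts subspace_vertex_space])
      (use dual_basesD(3)[OF vertex_dual_bases] idx vertex_vec_in[OF P] in auto)
  also have "\<dots> = (\<Prod>v\<in>verts \<Gamma>. (\<Prod>e\<in>out_arcs \<Gamma> v. \<phi> e (a e)) *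
      (\<Prod>e\<in>in_arcs \<Gamma> v. \<beta> e (b e) (m e)) * \<gamma> v (c v) (u v))"
  proof (rule prod.cong[OF refl])
    fix v assume v: "v \<in> verts \<Gamma>"
    have s: "star_index x v = ((restrict a (out_arcs \<Gamma> v), restrict b (in_arcs \<Gamma> v)), c v)"
      using v by (simp add: star_index_def x')
    show "vertex_functional v (star_index x v) ((\<lambda>v\<in>verts \<Gamma>. vertex_vec \<Gamma> M S \<phi> m u v) v) =
      (\<Prod>e\<in>out_arcs \<Gamma> v. \<phi> e (a e)) * (\<Prod>e\<in>in_arcs \<Gamma> v. \<beta> e (b e) (m e)) * \<gamma> v (c v) (u v)"
      using vertex_functional_vec[OF P v idx[OF v, unfolded s]] v unfolding s by simp
  qed
  also have "\<dots> = (\<Prod>v\<in>verts \<Gamma>. \<Prod>e\<in>out_arcs \<Gamma> v. \<phi> e (a e)) *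
      (\<Prod>v\<in>verts \<Gamma>. \<Prod>e\<in>in_arcs \<Gamma> v. \<beta> e (b e) (m e)) * (\<Prod>v\<in>verts \<Gamma>. \<gamma> v (c v) (u v))"
    by (simp only: prod.distrib)
  also have "(\<Prod>v\<in>verts \<Gamma>. \<Prod>e\<in>out_arcs \<Gamma> v. \<phi> e (a e)) = (\<Prod>e\<in>arcs \<Gamma>. \<phi> e (a e))"
    unfolding out_arcs_def by (rule prod.group) auto
  also have "(\<Prod>v\<in>verts \<Gamma>. \<Prod>e\<in>in_arcs \<Gamma> v. \<beta> e (b e) (m e)) = (\<Prod>e\<in>arcs \<Gamma>. \<beta> e (b e) (m e))"
    unfolding in_arcs_def by (rule prod.group) auto
  finally show ?thesis by (simp add: pairing_def x')
qed

lemma source_vec_in: "pure_data \<phi> m u \<Longrightarrow> source_vec \<phi> m u \<in> source_space \<Gamma> M S"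
  unfolding source_vec_def source_space_def using vertex_vec_in by (intro tensor_vec_in_tensor) auto


subsection \<open>A dual basis of the target\<close>

lemma fun_tensor_vec_bilinear: "bilinear_on R W fun_tensor_vec"
  by (auto simp: bilinear_on_def linear_on_def fun_tensor_vec_def fun_eq_iff
      scaleC_add_left scaleC_add_right scaleC_scaleC mult.commute)

lemma tensor_rep_in:
  assumes "\<And>e. e \<in> arcs \<Gamma> \<Longrightarrow> g e \<in> carrier G" "t \<in> tensor (arcs \<Gamma>) M"
  shows "tensor_rep (arcs \<Gamma>) M \<pi> g t \<in> tensor (arcs \<Gamma>) M"
  unfolding tensor_rep_def
  by (rule tensor_map_in_tensor[OF subspace_M _ _ assms(2)])
    (use group_repD(2,3)[OF \<pi>] assms(1) in auto)

lemma matrix_coeff_bilinear: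
  "bilinear_on (dual (tensor (arcs \<Gamma>) M)) (tensor (arcs \<Gamma>) M) (matrix_coeff \<Gamma> G M \<pi>)"
  unfolding bilinear_on_def
proof (intro conjI ballI)
  fix m
  show "linear_on (dual (tensor (arcs \<Gamma>) M)) (\<lambda>\<phi>. matrix_coeff \<Gamma> G M \<pi> \<phi> m)"
    by (rule linear_onI) (auto simp: matrix_coeff_def fun_eq_iff)
next
  fix \<phi> assume \<phi>: "\<phi> \<in> dual (tensor (arcs \<Gamma>) M)"
  have lin: "linear_on (tensor (arcs \<Gamma>) M) (\<lambda>m. \<phi> (tensor_rep (arcs \<Gamma>) M \<pi> g m))"
    if "g \<in> carrier (edge_group \<Gamma> G)" for g
    using that
    by (intro linear_on_compose[OF _ linear_on_dual[OF \<phi>]] image_subsetI tensor_rep_in)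
      (auto simp: edge_group_def tensor_rep_def linear_on_tensor_map)
  show "linear_on (tensor (arcs \<Gamma>) M) (matrix_coeff \<Gamma> G M \<pi> \<phi>)"
  proof (rule linear_onI; rule ext)
    fix x y g assume xy: "x \<in> tensor (arcs \<Gamma>) M" "y \<in> tensor (arcs \<Gamma>) M"
    show "matrix_coeff \<Gamma> G M \<pi> \<phi> (x + y) g =
        (matrix_coeff \<Gamma> G M \<pi> \<phi> x + matrix_coeff \<Gamma> G M \<pi> \<phi> y) g"
      using linear_on_addD[OF lin xy] by (simp only: matrix_coeff_def plus_fun_apply) simp
  next
    fix c x g assume x: "x \<in> tensor (arcs \<Gamma>) M"
    show "matrix_coeff \<Gamma> G M \<pi> \<phi> (c *\<^sub>C x) g = (c *\<^sub>C matrix_coeff \<Gamma> G M \<pi> \<phi> x) g"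
      using linear_on_scaleD[OF lin x] by (simp only: matrix_coeff_def scaleC_fun_apply) simp
  qed
qed

lemma matrix_coeff_pure:
  assumes P: "pure_data \<phi> m u" and g: "g \<in> carrier (edge_group \<Gamma> G)"
  shows "matrix_coeff \<Gamma> G M \<pi> (tensor_functional (arcs \<Gamma>) M \<phi>) (tensor_vec (arcs \<Gamma>) M m) g =
    (\<Prod>e\<in>arcs \<Gamma>. \<phi> e (\<pi> e (g e) (m e)))"
proof -
  have ge: "g e \<in> carrier G" if "e \<in> arcs \<Gamma>" for e
    using g that by (auto simp: edge_group_def PiE_iff)
  have \<pi>g: "linear_on (M e) (\<pi> e (g e))" "\<pi> e (g e) ` M e \<subseteq> M e" if "e \<in> arcs \<Gamma>" for e
    using group_repD(2,3)[OF \<pi>[OF that] ge[OF that]] by auto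
  have \<phi>: "\<phi> e \<in> dual (M e)" if "e \<in> arcs \<Gamma>" for e
    using P that unfolding pure_data_def by auto
  have m: "m \<in> Pi\<^sub>E (arcs \<Gamma>) M" using P unfolding pure_data_def by auto
  have gm: "(\<lambda>e\<in>arcs \<Gamma>. \<pi> e (g e) (m e)) \<in> Pi\<^sub>E (arcs \<Gamma>) M"
    using m \<pi>g(2) by (fastforce simp: PiE_iff)
  have "tensor_functional (arcs \<Gamma>) M \<phi> (tensor_vec (arcs \<Gamma>) M (\<lambda>e\<in>arcs \<Gamma>. \<pi> e (g e) (m e))) =
      (\<Prod>e\<in>arcs \<Gamma>. \<phi> e ((\<lambda>e\<in>arcs \<Gamma>. \<pi> e (g e) (m e)) e))"
    by (rule tensor_functional_vec[OF finite_arcs subspace_M \<phi> gm])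
  then show ?thesis
    using g by (simp add: matrix_coeff_def tensor_rep_def tensor_map_vec[OF subspace_M \<pi>g m])
qed

lemma target_vec_in:
  assumes "pure_data \<phi> m u"
  shows "target_vec \<phi> m u \<in> target_space \<Gamma> G M \<pi> S"
proof -
  have "matrix_coeff \<Gamma> G M \<pi> (tensor_functional (arcs \<Gamma>) M \<phi>) (tensor_vec (arcs \<Gamma>) M m)
      \<in> matrix_coeff_space \<Gamma> G M \<pi>"
    unfolding matrix_coeff_space_def
    using assms tensor_functional_dual tensor_vec_in_tensor[of m "arcs \<Gamma>" M]
    unfolding pure_data_def by (intro cvec.span_base) blast
  moreover have "tensor_vec (verts \<Gamma>) S u \<in> tensor (verts \<Gamma>) S"
    using assms unfolding pure_data_def by (intro tensor_vec_in_tensor) blast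
  ultimately show ?thesis
    unfolding target_vec_def target_space_def fun_tensor_def by (intro cvec.span_base) blast
qed

lemma target_span:
  "target_space \<Gamma> G M \<pi> S = cvec.span ((\<lambda>(a, b, c). target_vec (dual_family a) b c) ` indices)"
    (is "_ = cvec.span ?T")
proof
  have "?T \<subseteq> target_space \<Gamma> G M \<pi> S" using target_vec_in[OF pure_data_basis] by auto
  moreover have "cvec.subspace (target_space \<Gamma> G M \<pi> S)"
    unfolding target_space_def fun_tensor_def by (rule cvec.subspace_span)
  ultimately show "cvec.span ?T \<subseteq> target_space \<Gamma> G M \<pi> S" by (rule cvec.span_minimal)
next
  have restr: "restrict b I = b" if "b \<in> Pi\<^sub>E I J" for b :: "'x \<Rightarrow> 'y" and I J
    using that by (auto simp: PiE_iff extensional_def)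
  define \<Phi> where "\<Phi> = (\<lambda>a. tensor_functional (arcs \<Gamma>) M (dual_family a)) ` Pi\<^sub>E (arcs \<Gamma>) B"
  define X where "X = tensor_vec (arcs \<Gamma>) M ` Pi\<^sub>E (arcs \<Gamma>) B"
  define Y where "Y = tensor_vec (verts \<Gamma>) S ` Pi\<^sub>E (verts \<Gamma>) C"
  note DM = dual_bases_tensor[OF finite_arcs B]
  have X: "tensor (arcs \<Gamma>) M = cvec.span X"
    unfolding X_def using dual_basesD(2)[OF DM] restr by (simp cong: image_cong_simp)
  have Y: "tensor (verts \<Gamma>) S = cvec.span Y"
    unfolding Y_def using dual_basesD(2)[OF dual_bases_tensor[OF finite_verts C]] restr
    by (simp cong: image_cong_simp)
  have "\<Phi> = (\<lambda>a. tensor_functional (arcs \<Gamma>) M (\<lambda>e. \<beta> e (a e))) ` Pi\<^sub>E (arcs \<Gamma>) B"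
    unfolding \<Phi>_def dual_family_def
    by (intro image_cong refl tensor_functional_cong) simp
  then have \<Phi>: "dual (tensor (arcs \<Gamma>) M) = cvec.span \<Phi>"
    using dual_basesD(2)[OF dual_bases_dual[OF DM]] by simp
  define R where "R = {matrix_coeff \<Gamma> G M \<pi> \<phi> m | \<phi> m. \<phi> \<in> \<Phi> \<and> m \<in> X}"
  have "{matrix_coeff \<Gamma> G M \<pi> \<phi> m | \<phi> m. \<phi> \<in> dual (tensor (arcs \<Gamma>) M) \<and> m \<in> tensor (arcs \<Gamma>) M}
      \<subseteq> cvec.span R"
    using bilinear_span[of \<Phi> X "matrix_coeff \<Gamma> G M \<pi>"] matrix_coeff_bilinear
    unfolding R_def \<Phi>[symmetric] X[symmetric] by blast
  then have R: "matrix_coeff_space \<Gamma> G M \<pi> \<subseteq> cvec.span R"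
    unfolding matrix_coeff_space_def by (rule cvec.span_minimal) (rule cvec.subspace_span)
  have "{fun_tensor_vec f u | f u. f \<in> R \<and> u \<in> Y} \<subseteq> ?T"
  proof
    fix h assume "h \<in> {fun_tensor_vec f u | f u. f \<in> R \<and> u \<in> Y}"
    then obtain a b c where "a \<in> Pi\<^sub>E (arcs \<Gamma>) B" "b \<in> Pi\<^sub>E (arcs \<Gamma>) B" "c \<in> Pi\<^sub>E (verts \<Gamma>) C"
        "h = target_vec (dual_family a) b c"
      unfolding R_def \<Phi>_def X_def Y_def target_vec_def by blast
    then show "h \<in> ?T"
      by (intro image_eqI[of _ _ "(a, b, c)"]) (simp_all add: indices_def)
  qed
  then have T: "cvec.span {fun_tensor_vec f u | f u. f \<in> R \<and> u \<in> Y} \<subseteq> cvec.span ?T"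
    by (rule cvec.span_mono)
  have "fun_tensor_vec f u \<in> cvec.span ?T" if "f \<in> matrix_coeff_space \<Gamma> G M \<pi>" "u \<in> tensor (verts \<Gamma>) S"
    for f u
    using bilinear_span[OF fun_tensor_vec_bilinear, of f R u Y] that R T unfolding Y by blast
  then show "target_space \<Gamma> G M \<pi> S \<subseteq> cvec.span ?T"
    unfolding target_space_def fun_tensor_def by (intro cvec.span_minimal cvec.subspace_span) blast
qed

lemma target_value_in:
  assumes "f \<in> target_space \<Gamma> G M \<pi> S"
  shows "f g \<in> tensor (verts \<Gamma>) S"
proof -
  have "(\<lambda>f. f g) ` {fun_tensor_vec c u | c u. c \<in> matrix_coeff_space \<Gamma> G M \<pi> \<and> u \<in> tensor (verts \<Gamma>) S}
      \<subseteq> tensor (verts \<Gamma>) S"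
    using cvec.subspace_scale[OF subspace_tensor] unfolding fun_tensor_vec_def by blast
  then have "(\<lambda>f. f g) ` target_space \<Gamma> G M \<pi> S \<subseteq> tensor (verts \<Gamma>) S"
    unfolding target_space_def fun_tensor_def
    by (intro linear_on_span_image subspace_tensor) (auto simp: linear_on_def)
  then show ?thesis using assms by blast
qed

text \<open>
  The coordinate functional of \<open>(a, b, c)\<close> evaluates a function at the points of a finite grid in
  \<open>G\<^sup>E\<close>, weights the values by products over the arcs of the coefficients from
  \<open>irreducible_rep_matrix_unit\<close>, and applies the coordinate functional of \<open>c\<close>. On a product of
  matrix coefficients the sum over the grid factors into sums over the single arcs. These
  values already force the family to be biorthogonal, by \<open>pairing_basis\<close>.
\<close>

lemma target_dual_bases:
  "\<exists>\<eta>. dual_bases indices (target_space \<Gamma> G M \<pi> S) (\<lambda>(a, b, c). target_vec (dual_family a) b c) \<eta> \<and>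
     (\<forall>x\<in>indices. \<forall>\<phi> m u. pure_data \<phi> m u \<longrightarrow> \<eta> x (target_vec \<phi> m u) = pairing x \<phi> m u)"
proof -
  define unit where "unit e a b = (\<lambda>(D, r). finite D \<and> D \<subseteq> carrier G \<and>
      (\<forall>\<phi>\<in>dual (M e). \<forall>m\<in>M e. (\<Sum>g\<in>D. r g * \<phi> (\<pi> e g m)) = \<phi> a * \<beta> e b m))"
    for e a b
  define D where "D e a b = fst (SOME Dr. unit e a b Dr)" for e a b
  define r where "r e a b = snd (SOME Dr. unit e a b Dr)" for e a b
  have "unit e a b (D e a b, r e a b)" if "e \<in> arcs \<Gamma>" "a \<in> B e" "b \<in> B e" for e a b
  proof -
    have "\<exists>Dr. unit e a b Dr"
      using irreducible_rep_matrix_unit[OF G irr[OF that(1)] B[OF that(1)] that(2,3)]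
      unfolding unit_def by simp
    then show ?thesis unfolding D_def r_def prod.collapse by (rule someI_ex)
  qed
  then have D: "finite (D e a b)" "D e a b \<subseteq> carrier G"
      "\<And>\<phi> m. \<phi> \<in> dual (M e) \<Longrightarrow> m \<in> M e \<Longrightarrow>
        (\<Sum>g\<in>D e a b. r e a b g * \<phi> (\<pi> e g m)) = \<phi> a * \<beta> e b m"
    if "e \<in> arcs \<Gamma>" "a \<in> B e" "b \<in> B e" for e a b
    using that unfolding unit_def by simp_all
  define P where "P a b = Pi\<^sub>E (arcs \<Gamma>) (\<lambda>e. D e (a e) (b e))" for a b
  define w where "w a b g = (\<Prod>e\<in>arcs \<Gamma>. r e (a e) (b e) (g e))" for a b g
  define \<eta> where "\<eta> = (\<lambda>(a, b, c) f. if f \<in> target_space \<Gamma> G M \<pi> S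
    then tensor_functional (verts \<Gamma>) S (\<lambda>v. \<gamma> v (c v)) (\<Sum>g\<in>P a b. w a b g *\<^sub>C f g) else 0)"
  have \<eta>_vec: "\<eta> (a, b, c) (target_vec \<phi> m u) = pairing (a, b, c) \<phi> m u"
    if x: "(a, b, c) \<in> indices" and pd: "pure_data \<phi> m u" for a b c \<phi> m u
  proof -
    have a: "a e \<in> B e" and b: "b e \<in> B e" if "e \<in> arcs \<Gamma>" for e
      using x that by (auto simp: indices_def)
    have pd': "\<phi> e \<in> dual (M e)" "m e \<in> M e" if "e \<in> arcs \<Gamma>" for e
      using pd that by (auto simp: pure_data_def)
    have u: "u \<in> Pi\<^sub>E (verts \<Gamma>) S" using pd by (simp add: pure_data_def)
    let ?q = "\<lambda>g. \<Prod>e\<in>arcs \<Gamma>. r e (a e) (b e) (g e) * \<phi> e (\<pi> e (g e) (m e))"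
    have "w a b g *\<^sub>C target_vec \<phi> m u g = ?q g *\<^sub>C tensor_vec (verts \<Gamma>) S u" if g: "g \<in> P a b" for g
    proof -
      have "g \<in> carrier (edge_group \<Gamma> G)"
        using g D(2)[OF _ a b] unfolding P_def edge_group_def by (fastforce simp: PiE_iff)
      from matrix_coeff_pure[OF pd this] show ?thesis
        by (simp add: target_vec_def fun_tensor_vec_def w_def scaleC_scaleC prod.distrib)
    qed
    then have "(\<Sum>g\<in>P a b. w a b g *\<^sub>C target_vec \<phi> m u g) =
        (\<Sum>g\<in>P a b. ?q g *\<^sub>C tensor_vec (verts \<Gamma>) S u)"
      by (rule sum.cong[OF refl])
    also have "\<dots> = (\<Sum>g\<in>P a b. ?q g) *\<^sub>C tensor_vec (verts \<Gamma>) S u"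
      by (simp only: cvec.scale_sum_left)
    also have "(\<Sum>g\<in>P a b. ?q g) =
        (\<Prod>e\<in>arcs \<Gamma>. \<Sum>g\<in>D e (a e) (b e). r e (a e) (b e) g * \<phi> e (\<pi> e g (m e)))"
      unfolding P_def by (rule prod_sum_PiE[symmetric]) (use D(1) a b in auto)
    also have "\<dots> = (\<Prod>e\<in>arcs \<Gamma>. \<phi> e (a e) * \<beta> e (b e) (m e))"
      by (intro prod.cong refl D(3) a b pd')
    finally have "\<eta> (a, b, c) (target_vec \<phi> m u) =
        tensor_functional (verts \<Gamma>) S (\<lambda>v. \<gamma> v (c v))
          ((\<Prod>e\<in>arcs \<Gamma>. \<phi> e (a e) * \<beta> e (b e) (m e)) *\<^sub>C tensor_vec (verts \<Gamma>) S u)"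
      using target_vec_in[OF pd] by (simp only: \<eta>_def case_prod_conv if_True)
    also have "\<dots> = (\<Prod>e\<in>arcs \<Gamma>. \<phi> e (a e) * \<beta> e (b e) (m e)) *
        tensor_functional (verts \<Gamma>) S (\<lambda>v. \<gamma> v (c v)) (tensor_vec (verts \<Gamma>) S u)"
      using linear_on_scaleD[OF linear_on_dual[OF tensor_functional_dual] tensor_vec_in_tensor[OF u]]
      by simp
    also have "tensor_functional (verts \<Gamma>) S (\<lambda>v. \<gamma> v (c v)) (tensor_vec (verts \<Gamma>) S u) =
        (\<Prod>v\<in>verts \<Gamma>. \<gamma> v (c v) (u v))"
      by (rule tensor_functional_vec[OF finite_verts subspace_S dual_basesD(3)[OF C] u])
        (use x in \<open>auto simp: indices_def\<close>)
    finally show ?thesis by (simp add: pairing_def prod.distrib)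
  qed
  have "dual_bases indices (target_space \<Gamma> G M \<pi> S) (\<lambda>(a, b, c). target_vec (dual_family a) b c) \<eta>"
  proof (rule dual_basesI[OF finite_indices target_span])
    fix x assume "x \<in> indices"
    obtain a b c where x: "x = (a, b, c)" by (cases x)
    have sub: "cvec.subspace (target_space \<Gamma> G M \<pi> S)"
      unfolding target_space_def fun_tensor_def by (rule cvec.subspace_span)
    define Z where "Z f = (\<Sum>g\<in>P a b. w a b g *\<^sub>C f g)" for f :: "('e \<Rightarrow> 'g) \<Rightarrow> ('v, 's) tens"
    have "linear_on (target_space \<Gamma> G M \<pi> S) Z"
      by (rule linear_onI)
        (simp_all add: Z_def scaleC_add_right sum.distrib cvec.scale_sum_right scaleC_scaleC mult.commute)
    moreover have "Z ` target_space \<Gamma> G M \<pi> S \<subseteq> tensor (verts \<Gamma>) S"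
      using target_value_in unfolding Z_def
      by (intro image_subsetI cvec.subspace_sum cvec.subspace_scale subspace_tensor)
    ultimately have "linear_on (target_space \<Gamma> G M \<pi> S)
        (\<lambda>f. tensor_functional (verts \<Gamma>) S (\<lambda>v. \<gamma> v (c v)) (Z f))"
      by (rule linear_on_compose[OF _ linear_on_dual[OF tensor_functional_dual]])
    from dual_restrictI[OF this sub] show "\<eta> x \<in> dual (target_space \<Gamma> G M \<pi> S)"
      unfolding \<eta>_def x Z_def case_prod_conv .
  next
    fix x y assume x: "x \<in> indices" and y: "y \<in> indices"
    obtain a b c where y': "y = (a, b, c)" by (cases y)
    show "\<eta> x (case y of (a, b, c) \<Rightarrow> target_vec (dual_family a) b c) = of_bool (x = y)"
      using \<eta>_vec[OF _ pure_data_basis] pairing_basis x y unfolding y' by (cases x) auto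
  qed
  moreover have "\<forall>x\<in>indices. \<forall>\<phi> m u. pure_data \<phi> m u \<longrightarrow> \<eta> x (target_vec \<phi> m u) = pairing x \<phi> m u"
    using \<eta>_vec by auto
  ultimately show ?thesis by blast
qed


subsection \<open>The isomorphism\<close>

lemma is_Psi_iff:
  "is_Psi \<Gamma> G M \<pi> S \<Psi> \<longleftrightarrow>
     \<Psi> \<in> source_space \<Gamma> M S \<rightarrow>\<^sub>E target_space \<Gamma> G M \<pi> S \<and> linear_on (source_space \<Gamma> M S) \<Psi> \<and>
     (\<forall>\<phi> m u. pure_data \<phi> m u \<longrightarrow> \<Psi> (source_vec \<phi> m u) = target_vec \<phi> m u)"
proof -
  have "(\<forall>\<phi>\<in>X. \<forall>m\<in>Y. \<forall>u\<in>Z. Q \<phi> m u) \<longleftrightarrow> (\<forall>\<phi> m u. \<phi> \<in> X \<and> m \<in> Y \<and> u \<in> Z \<longrightarrow> Q \<phi> m u)"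
    for X :: "('e \<Rightarrow> 'm \<Rightarrow> complex) set" and Y :: "('e \<Rightarrow> 'm) set" and Z :: "('v \<Rightarrow> 's) set" and Q
    by blast
  then show ?thesis
    unfolding is_Psi_def pure_data_def source_vec_def target_vec_def by (simp only:)
qed

lemma is_PsiD:
  assumes "is_Psi \<Gamma> G M \<pi> S \<Psi>"
  shows "\<Psi> \<in> source_space \<Gamma> M S \<rightarrow>\<^sub>E target_space \<Gamma> G M \<pi> S"
    and "linear_on (source_space \<Gamma> M S) \<Psi>"
    and "\<And>\<phi> m u. pure_data \<phi> m u \<Longrightarrow> \<Psi> (source_vec \<phi> m u) = target_vec \<phi> m u"
proof -
  note * = assms[unfolded is_Psi_iff]
  show "\<Psi> \<in> source_space \<Gamma> M S \<rightarrow>\<^sub>E target_space \<Gamma> G M \<pi> S" by (rule conjunct1[OF *])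
  show "linear_on (source_space \<Gamma> M S) \<Psi>" by (rule conjunct1[OF conjunct2[OF *]])
  show "\<And>\<phi> m u. pure_data \<phi> m u \<Longrightarrow> \<Psi> (source_vec \<phi> m u) = target_vec \<phi> m u"
    by (rule conjunct2[OF conjunct2[OF *], rule_format])
qed

lemma source_span: "source_space \<Gamma> M S = cvec.span {source_vec \<phi> m u | \<phi> m u. pure_data \<phi> m u}"
    (is "_ = cvec.span ?X")
proof
  have "(\<lambda>(a, b, c). source_vec (dual_family a) b c) ` indices \<subseteq> ?X"
  proof (rule image_subsetI)
    fix x assume x: "x \<in> indices"
    obtain a b c where abc: "x = (a, b, c)" by (cases x)
    have P: "pure_data (dual_family a) b c" using x unfolding abc by (rule pure_data_basis)
    show "(case x of (a, b, c) \<Rightarrow> source_vec (dual_family a) b c) \<in> ?X"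
      unfolding abc case_prod_conv by (intro CollectI exI conjI) (rule refl, rule P)
  qed
  then show "source_space \<Gamma> M S \<subseteq> cvec.span ?X"
    unfolding dual_basesD(2)[OF source_dual_bases] by (rule cvec.span_mono)
  have "?X \<subseteq> source_space \<Gamma> M S" using source_vec_in by auto
  then show "cvec.span ?X \<subseteq> source_space \<Gamma> M S"
    by (rule cvec.span_minimal) (rule dual_basesD(6)[OF source_dual_bases])
qed

lemma source_eqI:
  assumes "linear_on (source_space \<Gamma> M S) f" "linear_on (source_space \<Gamma> M S) h"
    and "\<And>\<phi> m u. pure_data \<phi> m u \<Longrightarrow> f (source_vec \<phi> m u) = h (source_vec \<phi> m u)"
    and "x \<in> source_space \<Gamma> M S"
  shows "f x = h x"
proof (rule span_extension_unique[of "{source_vec \<phi> m u | \<phi> m u. pure_data \<phi> m u}" f h x,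
      folded source_span])
  show "f y = h y" if "y \<in> {source_vec \<phi> m u | \<phi> m u. pure_data \<phi> m u}" for y
    using that assms(3) by blast
qed (rule assms)+

text \<open>
  The coordinate isomorphism is \<open>\<Psi>\<close>, since the pure tensor and the function built from the same data
  have the same coordinates.
\<close>

lemma Psi_exists:
  "\<exists>\<Psi>. is_Psi \<Gamma> G M \<pi> S \<Psi> \<and> linear_iso (source_space \<Gamma> M S) (target_space \<Gamma> G M \<pi> S) \<Psi>"
proof -
  obtain \<eta> where \<eta>: "dual_bases indices (target_space \<Gamma> G M \<pi> S)
      (\<lambda>(a, b, c). target_vec (dual_family a) b c) \<eta>"
    and \<eta>_vec: "\<And>x \<phi> m u. x \<in> indices \<Longrightarrow> pure_data \<phi> m u \<Longrightarrow> \<eta> x (target_vec \<phi> m u) = pairing x \<phi> m u"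
    using target_dual_bases by blast
  define \<Psi> where "\<Psi> = (\<lambda>x\<in>source_space \<Gamma> M S. \<Sum>j\<in>indices. source_functional j x *\<^sub>C
    (case j of (a, b, c) \<Rightarrow> target_vec (dual_family a) b c))"
  note iso = dual_bases_iso[OF source_dual_bases \<eta>, folded \<Psi>_def]
  have \<Psi>_in: "\<Psi> x \<in> target_space \<Gamma> G M \<pi> S" if "x \<in> source_space \<Gamma> M S" for x
    using iso(1) that unfolding linear_iso_def bij_betw_def by blast
  have vec: "\<Psi> (source_vec \<phi> m u) = target_vec \<phi> m u" if P: "pure_data \<phi> m u" for \<phi> m u
  proof (rule dual_bases_eqI[OF \<eta> \<Psi>_in[OF source_vec_in[OF P]] target_vec_in[OF P]])
    fix j assume j: "j \<in> indices"
    show "\<eta> j (\<Psi> (source_vec \<phi> m u)) = \<eta> j (target_vec \<phi> m u)"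
      using iso(2)[OF j source_vec_in[OF P]] source_functional_vec[OF j P] \<eta>_vec[OF j P] by simp
  qed
  have "\<Psi> \<in> source_space \<Gamma> M S \<rightarrow>\<^sub>E target_space \<Gamma> G M \<pi> S"
    using \<Psi>_in by (intro PiE_I) (simp_all add: \<Psi>_def)
  then show ?thesis using iso(1) vec unfolding is_Psi_iff linear_iso_def by blast
qed

lemma Psi_unique:
  assumes "is_Psi \<Gamma> G M \<pi> S \<Psi>" "is_Psi \<Gamma> G M \<pi> S \<Psi>'"
  shows "\<Psi> = \<Psi>'"
proof (rule PiE_ext[OF is_PsiD(1)[OF assms(1)] is_PsiD(1)[OF assms(2)]])
  fix x assume x: "x \<in> source_space \<Gamma> M S"
  show "\<Psi> x = \<Psi>' x"
  proof (rule source_eqI[OF is_PsiD(2)[OF assms(1)] is_PsiD(2)[OF assms(2)] _ x])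
    fix \<phi> m u assume P: "pure_data \<phi> m u"
    show "\<Psi> (source_vec \<phi> m u) = \<Psi>' (source_vec \<phi> m u)"
      by (simp only: is_PsiD(3)[OF assms(1) P] is_PsiD(3)[OF assms(2) P])
  qed
qed


subsection \<open>Equivariance\<close>

lemma K_carrier: "v \<in> verts \<Gamma> \<Longrightarrow> k \<in> K v \<Longrightarrow> k \<in> carrier G"
  by (rule subgroup.mem_carrier[OF K])

lemma \<pi>_image: "e \<in> arcs \<Gamma> \<Longrightarrow> g \<in> carrier G \<Longrightarrow> \<pi> e g ` M e \<subseteq> M e"
  by (rule image_subsetI) (rule group_repD(3)[OF \<pi>])

lemma dual_rep_in: "dual_rep G (M e) (\<pi> e) k \<phi> \<in> dual (M e)"
  if "e \<in> arcs \<Gamma>" "k \<in> carrier G" "\<phi> \<in> dual (M e)"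
proof -
  have k: "inv\<^bsub>G\<^esub> k \<in> carrier G" by (rule group.inv_closed[OF G that(2)])
  have "linear_on (M e) (\<lambda>x. \<phi> (\<pi> e (inv\<^bsub>G\<^esub> k) x))"
    by (rule linear_on_compose[OF group_repD(2)[OF \<pi>[OF that(1)] k] linear_on_dual[OF that(3)]
          \<pi>_image[OF that(1) k]])
  from dual_restrictI[OF this subspace_M[OF that(1)]] show ?thesis
    using that(3) by (simp add: dual_rep_def)
qed

lemma linear_dual_rep: "linear_on (dual (M e)) (dual_rep G (M e) (\<pi> e) k)"
proof (rule linear_onI)
  fix \<phi> \<psi> assume *: "\<phi> \<in> dual (M e)" "\<psi> \<in> dual (M e)"
  show "dual_rep G (M e) (\<pi> e) k (\<phi> + \<psi>) = dual_rep G (M e) (\<pi> e) k \<phi> + dual_rep G (M e) (\<pi> e) k \<psi>"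
    using * cvec.subspace_add[OF subspace_dual *] by (auto simp: dual_rep_def fun_eq_iff)
next
  fix c \<phi> assume *: "\<phi> \<in> dual (M e)"
  show "dual_rep G (M e) (\<pi> e) k (c *\<^sub>C \<phi>) = c *\<^sub>C dual_rep G (M e) (\<pi> e) k \<phi>"
    using * cvec.subspace_scale[OF subspace_dual *] by (auto simp: dual_rep_def fun_eq_iff)
qed

lemma dual_rep_one: "dual_rep G (M e) (\<pi> e) \<one>\<^bsub>G\<^esub> \<phi> = \<phi>" if "e \<in> arcs \<Gamma>" "\<phi> \<in> dual (M e)"
proof
  have "inv\<^bsub>G\<^esub> \<one>\<^bsub>G\<^esub> = \<one>\<^bsub>G\<^esub>" by (rule monoid.inv_one[OF group.is_monoid[OF G]])
  then show "dual_rep G (M e) (\<pi> e) \<one>\<^bsub>G\<^esub> \<phi> x = \<phi> x" for x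
    using that group_rep_one[OF G \<pi>[OF that(1)]] by (auto simp: dual_rep_def dual_def)
qed

definition out_map :: "'v \<Rightarrow> 'g \<Rightarrow> ('e, 'm \<Rightarrow> complex) tens \<Rightarrow> ('e, 'm \<Rightarrow> complex) tens" where
  "out_map v k = tensor_rep (out_arcs \<Gamma> v) (\<lambda>e. dual (M e)) (\<lambda>e. dual_rep G (M e) (\<pi> e)) (\<lambda>_. k)"

definition in_map :: "'v \<Rightarrow> 'g \<Rightarrow> ('e, 'm) tens \<Rightarrow> ('e, 'm) tens" where
  "in_map v k = tensor_rep (in_arcs \<Gamma> v) M \<pi> (\<lambda>_. k)"

lemma star_action_eq:
  "star_action \<Gamma> G M \<pi> v k =
     tensor2_map (out_space v) (in_space v) (out_space v) (in_space v) (out_map v k) (in_map v k)"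
  by (simp only: star_action_def Let_def out_space_def in_space_def out_map_def in_map_def)

lemma subspace_out_space: "cvec.subspace (out_space v)"
  unfolding out_space_def by (rule subspace_tensor)

lemma subspace_in_space: "cvec.subspace (in_space v)"
  unfolding in_space_def by (rule subspace_tensor)

lemma out_map:
  assumes k: "k \<in> carrier G"
  shows "linear_on (out_space v) (out_map v k)" "out_map v k ` out_space v \<subseteq> out_space v"
proof -
  show "linear_on (out_space v) (out_map v k)"
    unfolding out_map_def tensor_rep_def by (rule linear_on_tensor_map)
  show "out_map v k ` out_space v \<subseteq> out_space v"
    unfolding out_map_def tensor_rep_def out_space_def
  proof (rule image_subsetI)
    fix t assume t: "t \<in> tensor (out_arcs \<Gamma> v) (\<lambda>e. dual (M e))"
    have "dual_rep G (M e) (\<pi> e) k ` dual (M e) \<subseteq> dual (M e)" if "e \<in> out_arcs \<Gamma> v" for e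
      using that by (intro image_subsetI dual_rep_in k) simp_all
    then show "tensor_map (out_arcs \<Gamma> v) (\<lambda>e. dual (M e)) (\<lambda>e. dual (M e))
        (\<lambda>e. dual_rep G (M e) (\<pi> e) k) t \<in> tensor (out_arcs \<Gamma> v) (\<lambda>e. dual (M e))"
      by (rule tensor_map_in_tensor[OF subspace_dual linear_dual_rep _ t])
  qed
qed

lemma in_map:
  assumes k: "k \<in> carrier G"
  shows "linear_on (in_space v) (in_map v k)" "in_map v k ` in_space v \<subseteq> in_space v"
proof -
  show "linear_on (in_space v) (in_map v k)"
    unfolding in_map_def tensor_rep_def by (rule linear_on_tensor_map)
  show "in_map v k ` in_space v \<subseteq> in_space v"
    unfolding in_map_def tensor_rep_def in_space_def
    by (rule image_subsetI)
      (rule tensor_map_in_tensor[OF subspace_M group_repD(2)[OF \<pi> k] \<pi>_image[OF _ k]]; simp)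
qed

lemma star_action:
  assumes k: "k \<in> carrier G"
  shows "linear_on (star_space \<Gamma> M v) (star_action \<Gamma> G M \<pi> v k)"
    "star_action \<Gamma> G M \<pi> v k ` star_space \<Gamma> M v \<subseteq> star_space \<Gamma> M v"
proof -
  show "linear_on (star_space \<Gamma> M v) (star_action \<Gamma> G M \<pi> v k)"
    unfolding star_action_eq by (rule linear_on_tensor2_map)
  show "star_action \<Gamma> G M \<pi> v k ` star_space \<Gamma> M v \<subseteq> star_space \<Gamma> M v"
    unfolding star_action_eq star_space_eq
    by (rule image_subsetI)
      (rule tensor2_map_in_tensor2[OF subspace_out_space subspace_in_space out_map[OF k] in_map[OF k]])
qed

lemma \<sigma>D:
  assumes "v \<in> verts \<Gamma>" "k \<in> K v"
  shows "linear_on (S v) (\<sigma> v k)" "\<sigma> v k ` S v \<subseteq> S v"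
proof -
  have k: "k \<in> carrier (G\<lparr>carrier := K v\<rparr>)" using assms(2) by simp
  show "linear_on (S v) (\<sigma> v k)" by (rule group_repD(2)[OF \<sigma>[OF assms(1)] k])
  show "\<sigma> v k ` S v \<subseteq> S v" by (rule image_subsetI) (rule group_repD(3)[OF \<sigma>[OF assms(1)] k])
qed

lemma vertex_action:
  assumes v: "v \<in> verts \<Gamma>" and k: "k \<in> K v"
  shows "linear_on (vertex_space \<Gamma> M S v) (vertex_action \<Gamma> G M \<pi> S \<sigma> v k)"
    "vertex_action \<Gamma> G M \<pi> S \<sigma> v k ` vertex_space \<Gamma> M S v \<subseteq> vertex_space \<Gamma> M S v"
proof -
  show "linear_on (vertex_space \<Gamma> M S v) (vertex_action \<Gamma> G M \<pi> S \<sigma> v k)"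
    unfolding vertex_action_def by (rule linear_on_tensor2_map)
  show "vertex_action \<Gamma> G M \<pi> S \<sigma> v k ` vertex_space \<Gamma> M S v \<subseteq> vertex_space \<Gamma> M S v"
    unfolding vertex_action_def vertex_space_def
    by (rule image_subsetI)
      (rule tensor2_map_in_tensor2[OF subspace_star_space subspace_S[OF v]
          star_action[OF K_carrier[OF v k]] \<sigma>D[OF v k]])
qed

lemma vertex_action_one:
  assumes v: "v \<in> verts \<Gamma>" and x: "x \<in> vertex_space \<Gamma> M S v"
  shows "vertex_action \<Gamma> G M \<pi> S \<sigma> v \<one>\<^bsub>G\<^esub> x = x"
  unfolding vertex_action_def
proof (rule tensor2_map_ident[OF subspace_star_space subspace_S[OF v] _ _ x[unfolded vertex_space_def]])
  have one_S: "group (G\<lparr>carrier := K v\<rparr>)" by (rule subgroup.subgroup_is_group[OF K[OF v] G])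
  show "\<sigma> v \<one>\<^bsub>G\<^esub> y = y" if "y \<in> S v" for y
    using group_rep_one[OF one_S \<sigma>[OF v] that] by simp
  have out: "out_map v \<one>\<^bsub>G\<^esub> y = y" if "y \<in> out_space v" for y
    unfolding out_map_def tensor_rep_def
    by (rule tensor_map_ident[OF subspace_dual dual_rep_one that[unfolded out_space_def]]) simp_all
  have "in": "in_map v \<one>\<^bsub>G\<^esub> y = y" if "y \<in> in_space v" for y
    unfolding in_map_def tensor_rep_def
    by (rule tensor_map_ident[OF subspace_M group_rep_one[OF G \<pi>] that[unfolded in_space_def]]) simp_all
  show "star_action \<Gamma> G M \<pi> v \<one>\<^bsub>G\<^esub> y = y" if "y \<in> star_space \<Gamma> M v" for y
    unfolding star_action_eq
    by (rule tensor2_map_ident[OF subspace_out_space subspace_in_space out "in" that[unfolded star_space_eq]])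
qed

lemma carrier_vertex_group: "carrier (vertex_group \<Gamma> G K) = Pi\<^sub>E (verts \<Gamma>) K"
  by (simp add: vertex_group_def)

text \<open>
  The data of a pure tensor after the action of \<open>k\<close>: covectors move with the tails, vectors with
  the heads.
\<close>

definition move_dual :: "('v \<Rightarrow> 'g) \<Rightarrow> ('e \<Rightarrow> 'm \<Rightarrow> complex) \<Rightarrow> 'e \<Rightarrow> 'm \<Rightarrow> complex" where
  "move_dual k \<phi> = (\<lambda>e\<in>arcs \<Gamma>. dual_rep G (M e) (\<pi> e) (k (tail \<Gamma> e)) (\<phi> e))"

definition move_vec :: "('v \<Rightarrow> 'g) \<Rightarrow> ('e \<Rightarrow> 'm) \<Rightarrow> 'e \<Rightarrow> 'm" where
  "move_vec k m = (\<lambda>e\<in>arcs \<Gamma>. \<pi> e (k (head \<Gamma> e)) (m e))"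

definition move_vertex :: "('v \<Rightarrow> 'g) \<Rightarrow> ('v \<Rightarrow> 's) \<Rightarrow> 'v \<Rightarrow> 's" where
  "move_vertex k u = (\<lambda>v\<in>verts \<Gamma>. \<sigma> v (k v) (u v))"

lemma pure_data_move:
  assumes k: "k \<in> Pi\<^sub>E (verts \<Gamma>) K" and P: "pure_data \<phi> m u"
  shows "pure_data (move_dual k \<phi>) (move_vec k m) (move_vertex k u)"
proof -
  have kc: "k (tail \<Gamma> e) \<in> carrier G" "k (head \<Gamma> e) \<in> carrier G" if "e \<in> arcs \<Gamma>" for e
    by (rule K_carrier[OF tail_in_verts[OF that] PiE_mem[OF k tail_in_verts[OF that]]],
        rule K_carrier[OF head_in_verts[OF that] PiE_mem[OF k head_in_verts[OF that]]])
  have "\<pi> e (k (head \<Gamma> e)) (m e) \<in> M e" if "e \<in> arcs \<Gamma>" for e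
    using P that by (intro group_repD(3)[OF \<pi>] kc) (auto simp: pure_data_def)
  moreover have "\<sigma> v (k v) (u v) \<in> S v" if "v \<in> verts \<Gamma>" for v
    using P that k \<sigma>D(2)[OF that, of "k v"] by (auto simp: pure_data_def PiE_iff)
  moreover have "dual_rep G (M e) (\<pi> e) (k (tail \<Gamma> e)) (\<phi> e) \<in> dual (M e)" if "e \<in> arcs \<Gamma>" for e
    using P that by (intro dual_rep_in kc) (auto simp: pure_data_def)
  ultimately show ?thesis
    unfolding pure_data_def move_dual_def move_vec_def move_vertex_def by auto
qed

lemma vertex_action_vec:
  assumes k: "k \<in> Pi\<^sub>E (verts \<Gamma>) K" and P: "pure_data \<phi> m u" and v: "v \<in> verts \<Gamma>"
  shows "vertex_action \<Gamma> G M \<pi> S \<sigma> v (k v) (vertex_vec \<Gamma> M S \<phi> m u v) =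
    vertex_vec \<Gamma> M S (move_dual k \<phi>) (move_vec k m) (move_vertex k u) v"
proof -
  have kv: "k v \<in> K v" using k v by auto
  then have kc: "k v \<in> carrier G" by (rule K_carrier[OF v])
  let ?x = "tensor_vec (out_arcs \<Gamma> v) (\<lambda>e. dual (M e)) (restrict \<phi> (out_arcs \<Gamma> v))"
  let ?y = "tensor_vec (in_arcs \<Gamma> v) M (restrict m (in_arcs \<Gamma> v))"
  have x: "?x \<in> out_space v" and y: "?y \<in> in_space v"
    unfolding out_space_def in_space_def by (intro tensor_vec_in_tensor pure_data_at[OF P])+
  have "out_map v (k v) ?x = tensor_vec (out_arcs \<Gamma> v) (\<lambda>e. dual (M e))
      (\<lambda>e\<in>out_arcs \<Gamma> v. dual_rep G (M e) (\<pi> e) (k v) (restrict \<phi> (out_arcs \<Gamma> v) e))"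
    unfolding out_map_def tensor_rep_def
    by (rule tensor_map_vec[OF subspace_dual linear_dual_rep _ pure_data_at(1)[OF P]])
      (intro image_subsetI dual_rep_in kc; simp)
  also have "(\<lambda>e\<in>out_arcs \<Gamma> v. dual_rep G (M e) (\<pi> e) (k v) (restrict \<phi> (out_arcs \<Gamma> v) e)) =
      restrict (move_dual k \<phi>) (out_arcs \<Gamma> v)"
    by (rule restrict_ext) (auto simp: move_dual_def)
  finally have out: "out_map v (k v) ?x =
      tensor_vec (out_arcs \<Gamma> v) (\<lambda>e. dual (M e)) (restrict (move_dual k \<phi>) (out_arcs \<Gamma> v))" .
  have "in_map v (k v) ?y = tensor_vec (in_arcs \<Gamma> v) M
      (\<lambda>e\<in>in_arcs \<Gamma> v. \<pi> e (k v) (restrict m (in_arcs \<Gamma> v) e))"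
    unfolding in_map_def tensor_rep_def
    by (rule tensor_map_vec[OF subspace_M group_repD(2)[OF \<pi> kc] \<pi>_image[OF _ kc]
          pure_data_at(2)[OF P]]) simp_all
  also have "(\<lambda>e\<in>in_arcs \<Gamma> v. \<pi> e (k v) (restrict m (in_arcs \<Gamma> v) e)) =
      restrict (move_vec k m) (in_arcs \<Gamma> v)"
    by (rule restrict_ext) (auto simp: move_vec_def)
  finally have "in": "in_map v (k v) ?y =
      tensor_vec (in_arcs \<Gamma> v) M (restrict (move_vec k m) (in_arcs \<Gamma> v))" .
  have star: "star_action \<Gamma> G M \<pi> v (k v) (tensor2_vec (out_space v) (in_space v) ?x ?y) =
      tensor2_vec (out_space v) (in_space v) (out_map v (k v) ?x) (in_map v (k v) ?y)"
    unfolding star_action_eq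
    by (rule tensor2_map_vec[OF subspace_out_space subspace_in_space out_map[OF kc] in_map[OF kc] x y])
  have "vertex_action \<Gamma> G M \<pi> S \<sigma> v (k v) (vertex_vec \<Gamma> M S \<phi> m u v) =
      tensor2_vec (star_space \<Gamma> M v) (S v)
        (star_action \<Gamma> G M \<pi> v (k v) (tensor2_vec (out_space v) (in_space v) ?x ?y))
        (\<sigma> v (k v) (u v))"
    unfolding vertex_action_def vertex_vec_def out_space_def[symmetric] in_space_def[symmetric]
    by (rule tensor2_map_vec[OF subspace_star_space subspace_S[OF v] star_action[OF kc] \<sigma>D[OF v kv]
          star_vec_in[OF P] pure_data_at(3)[OF P v]])
  moreover have "\<sigma> v (k v) (u v) = move_vertex k u v" using v by (simp add: move_vertex_def)
  ultimately show ?thesis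
    unfolding star out "in" unfolding vertex_vec_def out_space_def in_space_def by (simp only:)
qed

lemma source_action_vec:
  assumes k: "k \<in> Pi\<^sub>E (verts \<Gamma>) K" and P: "pure_data \<phi> m u"
  shows "source_action \<Gamma> G M \<pi> S \<sigma> k (source_vec \<phi> m u) =
    source_vec (move_dual k \<phi>) (move_vec k m) (move_vertex k u)"
proof -
  have kv: "k v \<in> K v" if "v \<in> verts \<Gamma>" for v using k that by auto
  have "(\<lambda>v\<in>verts \<Gamma>. vertex_vec \<Gamma> M S \<phi> m u v) \<in> Pi\<^sub>E (verts \<Gamma>) (vertex_space \<Gamma> M S)"
    using vertex_vec_in[OF P] by auto
  then have "source_action \<Gamma> G M \<pi> S \<sigma> k (source_vec \<phi> m u) =
      tensor_vec (verts \<Gamma>) (vertex_space \<Gamma> M S) (\<lambda>v\<in>verts \<Gamma>.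
        vertex_action \<Gamma> G M \<pi> S \<sigma> v (k v) ((\<lambda>v\<in>verts \<Gamma>. vertex_vec \<Gamma> M S \<phi> m u v) v))"
    unfolding source_action_def source_vec_def tensor_rep_def
    by (intro tensor_map_vec subspace_vertex_space vertex_action kv)
  also have "(\<lambda>v\<in>verts \<Gamma>. vertex_action \<Gamma> G M \<pi> S \<sigma> v (k v)
        ((\<lambda>v\<in>verts \<Gamma>. vertex_vec \<Gamma> M S \<phi> m u v) v)) =
      (\<lambda>v\<in>verts \<Gamma>. vertex_vec \<Gamma> M S (move_dual k \<phi>) (move_vec k m) (move_vertex k u) v)"
    by (rule restrict_ext) (simp add: vertex_action_vec[OF k P])
  finally show ?thesis unfolding source_vec_def .
qed

lemma edge_action_inv:
  assumes k: "k \<in> Pi\<^sub>E (verts \<Gamma>) K"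
  shows "edge_action \<Gamma> G (inv\<^bsub>vertex_group \<Gamma> G K\<^esub> k) g =
    (\<lambda>e\<in>arcs \<Gamma>. inv\<^bsub>G\<^esub> (k (tail \<Gamma> e)) \<otimes>\<^bsub>G\<^esub> g e \<otimes>\<^bsub>G\<^esub> k (head \<Gamma> e))"
proof -
  have kv: "k v \<in> K v" if "v \<in> verts \<Gamma>" for v using k that by auto
  have "inv\<^bsub>vertex_group \<Gamma> G K\<^esub> k = (\<lambda>v\<in>verts \<Gamma>. inv\<^bsub>G\<lparr>carrier := K v\<rparr>\<^esub> k v)"
    unfolding vertex_group_def
    using k by (intro inv_product_group subgroup.subgroup_is_group[OF K G]) auto
  also have "\<dots> = (\<lambda>v\<in>verts \<Gamma>. inv\<^bsub>G\<^esub> k v)"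
    by (intro restrict_ext group.m_inv_consistent[OF G K kv])
  finally have "inv\<^bsub>vertex_group \<Gamma> G K\<^esub> k = (\<lambda>v\<in>verts \<Gamma>. inv\<^bsub>G\<^esub> k v)" .
  then show ?thesis
    using group.inv_inv[OF G K_carrier[OF _ kv]] by (auto simp: edge_action_def fun_eq_iff restrict_def)
qed

text \<open>
  The action on functions uses \<open>k\<^sup>-\<^sup>1 \<cdot> g\<close>, with entries
  \<open>k(tail e)\<^sup>-\<^sup>1 g\<^sub>e k(head e)\<close>. In \<open>\<phi>\<^sub>e(\<pi>\<^sub>e(k\<^sup>-\<^sup>1 g k') m\<^sub>e)\<close> the left factor is absorbed by the dual
  representation on \<open>\<phi>\<^sub>e\<close> and the right one by \<open>m\<^sub>e\<close>.
\<close>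

lemma target_action_vec:
  assumes k: "k \<in> Pi\<^sub>E (verts \<Gamma>) K" and P: "pure_data \<phi> m u"
  shows "target_action \<Gamma> G K S \<sigma> k (target_vec \<phi> m u) =
    target_vec (move_dual k \<phi>) (move_vec k m) (move_vertex k u)"
proof
  fix g
  let ?g = "edge_action \<Gamma> G (inv\<^bsub>vertex_group \<Gamma> G K\<^esub> k) g"
  interpret group G by (rule G)
  have kv: "k v \<in> K v" if "v \<in> verts \<Gamma>" for v using k that by auto
  have kc: "k v \<in> carrier G" if "v \<in> verts \<Gamma>" for v by (rule K_carrier[OF that kv[OF that]])
  show "target_action \<Gamma> G K S \<sigma> k (target_vec \<phi> m u) g =
    target_vec (move_dual k \<phi>) (move_vec k m) (move_vertex k u) g"
  proof (cases "g \<in> carrier (edge_group \<Gamma> G)")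
    case True
    then have ge: "g e \<in> carrier G" if "e \<in> arcs \<Gamma>" for e
      using that by (auto simp: edge_group_def PiE_iff)
    have g': "?g \<in> carrier (edge_group \<Gamma> G)"
      unfolding edge_action_inv[OF k] using ge kc by (simp add: edge_group_def)
    have u: "u \<in> Pi\<^sub>E (verts \<Gamma>) S" using P by (simp add: pure_data_def)
    let ?c = "\<Prod>e\<in>arcs \<Gamma>. \<phi> e (\<pi> e (?g e) (m e))"
    have eq: "move_dual k \<phi> e (\<pi> e (g e) (move_vec k m e)) = \<phi> e (\<pi> e (?g e) (m e))"
      if e: "e \<in> arcs \<Gamma>" for e
    proof -
      have m: "m e \<in> M e" and \<phi>: "\<phi> e \<in> dual (M e)" using P e by (auto simp: pure_data_def)
      note k1 = kc[OF tail_in_verts[OF e]] and k2 = kc[OF head_in_verts[OF e]]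
      note act = group_repD(4)[OF \<pi>[OF e]] and stay = group_repD(3)[OF \<pi>[OF e]]
      have "\<pi> e (?g e) (m e) = \<pi> e (inv\<^bsub>G\<^esub> (k (tail \<Gamma> e))) (\<pi> e (g e) (\<pi> e (k (head \<Gamma> e)) (m e)))"
        unfolding edge_action_inv[OF k] using e k1 k2 ge[OF e] m by (simp add: act stay)
      then show ?thesis
        using e m \<phi> stay[OF ge[OF e] stay[OF k2 m]]
        by (simp add: move_dual_def move_vec_def dual_rep_def)
    qed
    have "target_action \<Gamma> G K S \<sigma> k (target_vec \<phi> m u) g =
        tensor_rep (verts \<Gamma>) S \<sigma> k (?c *\<^sub>C tensor_vec (verts \<Gamma>) S u)"
      using True matrix_coeff_pure[OF P g']
      by (simp only: target_action_def target_vec_def fun_tensor_vec_def if_True)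
    also have "\<dots> = ?c *\<^sub>C tensor_rep (verts \<Gamma>) S \<sigma> k (tensor_vec (verts \<Gamma>) S u)"
      unfolding tensor_rep_def
      by (rule linear_on_scaleD[OF linear_on_tensor_map tensor_vec_in_tensor[OF u]])
    also have "tensor_rep (verts \<Gamma>) S \<sigma> k (tensor_vec (verts \<Gamma>) S u) =
        tensor_vec (verts \<Gamma>) S (move_vertex k u)"
      unfolding tensor_rep_def move_vertex_def
      by (intro tensor_map_vec subspace_S \<sigma>D kv u)
    also have "?c = (\<Prod>e\<in>arcs \<Gamma>. move_dual k \<phi> e (\<pi> e (g e) (move_vec k m e)))"
      by (intro prod.cong refl eq[symmetric])
    also have "\<dots> *\<^sub>C tensor_vec (verts \<Gamma>) S (move_vertex k u) =
        target_vec (move_dual k \<phi>) (move_vec k m) (move_vertex k u) g"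
      using matrix_coeff_pure[OF pure_data_move[OF k P] True]
      by (simp only: target_vec_def fun_tensor_vec_def)
    finally show ?thesis .
  next
    case False
    then show ?thesis
      by (simp only: target_action_def target_vec_def fun_tensor_vec_def matrix_coeff_def if_False
          cvec.scale_zero_left)
  qed
qed

lemma source_action_linear: "linear_on X (source_action \<Gamma> G M \<pi> S \<sigma> k)"
  unfolding source_action_def tensor_rep_def by (rule linear_on_tensor_map)

lemma source_action_in:
  assumes "k \<in> Pi\<^sub>E (verts \<Gamma>) K" "x \<in> source_space \<Gamma> M S"
  shows "source_action \<Gamma> G M \<pi> S \<sigma> k x \<in> source_space \<Gamma> M S"
  using assms unfolding source_action_def tensor_rep_def source_space_def
  by (intro tensor_map_in_tensor subspace_vertex_space vertex_action) auto

lemma target_action_linear: "linear_on X (target_action \<Gamma> G K S \<sigma> k)"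
proof (rule linear_onI; rule ext)
  note lin = linear_on_tensor_map[of UNIV "verts \<Gamma>" S S "\<lambda>v. \<sigma> v (k v)"]
  fix f h :: "('e \<Rightarrow> 'g) \<Rightarrow> ('v, 's) tens" and c g
  show "target_action \<Gamma> G K S \<sigma> k (f + h) g =
      (target_action \<Gamma> G K S \<sigma> k f + target_action \<Gamma> G K S \<sigma> k h) g"
    by (cases "g \<in> carrier (edge_group \<Gamma> G)")
      (simp_all only: target_action_def tensor_rep_def plus_fun_apply if_True if_False add_0_left
        linear_on_addD[OF lin UNIV_I UNIV_I])
  show "target_action \<Gamma> G K S \<sigma> k (c *\<^sub>C f) g = (c *\<^sub>C target_action \<Gamma> G K S \<sigma> k f) g"
    by (cases "g \<in> carrier (edge_group \<Gamma> G)")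
      (simp_all only: target_action_def tensor_rep_def scaleC_fun_apply if_True if_False
        cvec.scale_zero_right linear_on_scaleD[OF lin UNIV_I])
qed

lemma Psi_equivariant:
  assumes \<Psi>: "is_Psi \<Gamma> G M \<pi> S \<Psi>" and k: "k \<in> Pi\<^sub>E (verts \<Gamma>) K" and x: "x \<in> source_space \<Gamma> M S"
  shows "\<Psi> (source_action \<Gamma> G M \<pi> S \<sigma> k x) = target_action \<Gamma> G K S \<sigma> k (\<Psi> x)"
proof (rule source_eqI[OF _ _ _ x])
  note lin = is_PsiD(2)[OF \<Psi>]
  show "linear_on (source_space \<Gamma> M S) (\<lambda>x. \<Psi> (source_action \<Gamma> G M \<pi> S \<sigma> k x))"
    by (rule linear_on_compose[OF source_action_linear lin]) (rule image_subsetI, rule source_action_in[OF k])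
  show "linear_on (source_space \<Gamma> M S) (\<lambda>x. target_action \<Gamma> G K S \<sigma> k (\<Psi> x))"
    by (rule linear_on_compose[OF lin target_action_linear subset_UNIV])
  fix \<phi> m u assume P: "pure_data \<phi> m u"
  show "\<Psi> (source_action \<Gamma> G M \<pi> S \<sigma> k (source_vec \<phi> m u)) =
      target_action \<Gamma> G K S \<sigma> k (\<Psi> (source_vec \<phi> m u))"
    by (simp only: source_action_vec[OF k P] target_action_vec[OF k P] is_PsiD(3)[OF \<Psi> P]
        is_PsiD(3)[OF \<Psi> pure_data_move[OF k P]])
qed


subsection \<open>Restriction to invariants\<close>

text \<open>
  An equivariant bijection matches fixed points with fixed points.
\<close>

lemma Psi_invariants:
  assumes \<Psi>: "is_Psi \<Gamma> G M \<pi> S \<Psi>"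
    and iso: "linear_iso (source_space \<Gamma> M S) (target_space \<Gamma> G M \<pi> S) \<Psi>"
  shows "bij_betw \<Psi> (invariants (Pi\<^sub>E (verts \<Gamma>) K) (source_space \<Gamma> M S) (source_action \<Gamma> G M \<pi> S \<sigma>))
    (invariants (Pi\<^sub>E (verts \<Gamma>) K) (target_space \<Gamma> G M \<pi> S) (target_action \<Gamma> G K S \<sigma>))"
proof -
  have inj: "inj_on \<Psi> (source_space \<Gamma> M S)"
    and im: "\<Psi> ` source_space \<Gamma> M S = target_space \<Gamma> G M \<pi> S"
    using iso unfolding linear_iso_def bij_betw_def by blast+
  have inv_iff: "\<Psi> x \<in> invariants (Pi\<^sub>E (verts \<Gamma>) K) (target_space \<Gamma> G M \<pi> S) (target_action \<Gamma> G K S \<sigma>) \<longleftrightarrow>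
      x \<in> invariants (Pi\<^sub>E (verts \<Gamma>) K) (source_space \<Gamma> M S) (source_action \<Gamma> G M \<pi> S \<sigma>)"
    if x: "x \<in> source_space \<Gamma> M S" for x
  proof -
    have "target_action \<Gamma> G K S \<sigma> k (\<Psi> x) = \<Psi> x \<longleftrightarrow> source_action \<Gamma> G M \<pi> S \<sigma> k x = x"
      if k: "k \<in> Pi\<^sub>E (verts \<Gamma>) K" for k
      using Psi_equivariant[OF \<Psi> k x] inj_on_eq_iff[OF inj source_action_in[OF k x] x] by metis
    moreover have "\<Psi> x \<in> target_space \<Gamma> G M \<pi> S" using im x by blast
    ultimately show ?thesis using x by (simp add: invariants_def)
  qed
  show ?thesis
    unfolding bij_betw_def
  proof
    show "inj_on \<Psi> (invariants (Pi\<^sub>E (verts \<Gamma>) K) (source_space \<Gamma> M S) (source_action \<Gamma> G M \<pi> S \<sigma>))"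
      by (rule inj_on_subset[OF inj]) (auto simp: invariants_def)
    show "\<Psi> ` invariants (Pi\<^sub>E (verts \<Gamma>) K) (source_space \<Gamma> M S) (source_action \<Gamma> G M \<pi> S \<sigma>) =
        invariants (Pi\<^sub>E (verts \<Gamma>) K) (target_space \<Gamma> G M \<pi> S) (target_action \<Gamma> G K S \<sigma>)" (is "\<Psi> ` ?A = ?B")
    proof
      have "x \<in> source_space \<Gamma> M S" if "x \<in> ?A" for x using that by (simp add: invariants_def)
      then show "\<Psi> ` ?A \<subseteq> ?B" using inv_iff by blast
      show "?B \<subseteq> \<Psi> ` ?A"
      proof
        fix f assume f: "f \<in> ?B"
        then have "f \<in> target_space \<Gamma> G M \<pi> S" by (simp add: invariants_def)
        then obtain x where x: "x \<in> source_space \<Gamma> M S" "f = \<Psi> x" using im by blast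
        with f inv_iff[OF x(1)] show "f \<in> \<Psi> ` ?A" by blast
      qed
    qed
  qed
qed

lemma vertex_invariants_iso:
  "linear_iso (tensor (verts \<Gamma>) (vertex_invariants \<Gamma> G K M \<pi> S \<sigma>))
     (invariants (Pi\<^sub>E (verts \<Gamma>) K) (source_space \<Gamma> M S) (source_action \<Gamma> G M \<pi> S \<sigma>))
     (tensor_incl (verts \<Gamma>) (vertex_invariants \<Gamma> G K M \<pi> S \<sigma>) (vertex_space \<Gamma> M S))"
  unfolding source_space_def source_action_def
proof (rule tensor_invariants[OF finite_verts dual_basesD(7)[OF vertex_dual_bases] vertex_action])
  show "\<one>\<^bsub>G\<^esub> \<in> K v" if "v \<in> verts \<Gamma>" for v by (rule subgroup.one_closed[OF K[OF that]])
  show "vertex_invariants \<Gamma> G K M \<pi> S \<sigma> v =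
      invariants (K v) (vertex_space \<Gamma> M S v) (vertex_action \<Gamma> G M \<pi> S \<sigma> v)" for v
    by (rule vertex_invariants_def)
qed (assumption | erule (1) vertex_action_one)+

lemma Psi_invariants_iso:
  assumes \<Psi>: "is_Psi \<Gamma> G M \<pi> S \<Psi>"
    and iso: "linear_iso (source_space \<Gamma> M S) (target_space \<Gamma> G M \<pi> S) \<Psi>"
  shows "linear_iso (tensor (verts \<Gamma>) (vertex_invariants \<Gamma> G K M \<pi> S \<sigma>))
    (invariants (Pi\<^sub>E (verts \<Gamma>) K) (target_space \<Gamma> G M \<pi> S) (target_action \<Gamma> G K S \<sigma>))
    (\<Psi> \<circ> tensor_incl (verts \<Gamma>) (vertex_invariants \<Gamma> G K M \<pi> S \<sigma>) (vertex_space \<Gamma> M S))"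
  unfolding linear_iso_def
proof
  have incl: "linear_on (tensor (verts \<Gamma>) (vertex_invariants \<Gamma> G K M \<pi> S \<sigma>))
      (tensor_incl (verts \<Gamma>) (vertex_invariants \<Gamma> G K M \<pi> S \<sigma>) (vertex_space \<Gamma> M S))"
    "bij_betw (tensor_incl (verts \<Gamma>) (vertex_invariants \<Gamma> G K M \<pi> S \<sigma>) (vertex_space \<Gamma> M S))
      (tensor (verts \<Gamma>) (vertex_invariants \<Gamma> G K M \<pi> S \<sigma>))
      (invariants (Pi\<^sub>E (verts \<Gamma>) K) (source_space \<Gamma> M S) (source_action \<Gamma> G M \<pi> S \<sigma>))"
    using vertex_invariants_iso unfolding linear_iso_def by blast+
  have "tensor_incl (verts \<Gamma>) (vertex_invariants \<Gamma> G K M \<pi> S \<sigma>) (vertex_space \<Gamma> M S) `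
      tensor (verts \<Gamma>) (vertex_invariants \<Gamma> G K M \<pi> S \<sigma>) \<subseteq> source_space \<Gamma> M S"
    unfolding bij_betw_imp_surj_on[OF incl(2)] by (auto simp: invariants_def)
  moreover have "linear_on (source_space \<Gamma> M S) \<Psi>" using iso unfolding linear_iso_def by blast
  ultimately show "linear_on (tensor (verts \<Gamma>) (vertex_invariants \<Gamma> G K M \<pi> S \<sigma>))
      (\<Psi> \<circ> tensor_incl (verts \<Gamma>) (vertex_invariants \<Gamma> G K M \<pi> S \<sigma>) (vertex_space \<Gamma> M S))"
    unfolding comp_def by (intro linear_on_compose[OF incl(1)])
  show "bij_betw (\<Psi> \<circ> tensor_incl (verts \<Gamma>) (vertex_invariants \<Gamma> G K M \<pi> S \<sigma>) (vertex_space \<Gamma> M S))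
      (tensor (verts \<Gamma>) (vertex_invariants \<Gamma> G K M \<pi> S \<sigma>))
      (invariants (Pi\<^sub>E (verts \<Gamma>) K) (target_space \<Gamma> G M \<pi> S) (target_action \<Gamma> G K S \<sigma>))"
    by (rule bij_betw_trans[OF incl(2) Psi_invariants[OF \<Psi> iso]])
qed

end

theorem theorem4p15:
  fixes \<Gamma> :: "('v::linorder, 'e::linorder) pre_digraph"
    and G :: "'g monoid" and T :: "'g topology" and K :: "'v \<Rightarrow> 'g set"
    and M :: "'e \<Rightarrow> 'm::complex_vector set" and \<pi> :: "'e \<Rightarrow> 'g \<Rightarrow> 'm \<Rightarrow> 'm"
    and S :: "'v \<Rightarrow> 's::complex_vector set" and \<sigma> :: "'v \<Rightarrow> 'g \<Rightarrow> 's \<Rightarrow> 's"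
  assumes "fin_digraph \<Gamma>"
    and "lie_group G T" "compact_space T" "connected_space T"
    and "\<And>v. v \<in> verts \<Gamma> \<Longrightarrow> subgroup (K v) G"
    and "\<And>e. e \<in> arcs \<Gamma> \<Longrightarrow> fin_dim_space (M e)"
    and "\<And>e. e \<in> arcs \<Gamma> \<Longrightarrow> irreducible_rep G (M e) (\<pi> e)"
    and "\<And>e. e \<in> arcs \<Gamma> \<Longrightarrow> continuous_map T (GL_topology (M e)) (\<pi> e)"
    and "\<And>v. v \<in> verts \<Gamma> \<Longrightarrow> fin_dim_space (S v)"
    and "\<And>v. v \<in> verts \<Gamma> \<Longrightarrow> group_rep (G\<lparr>carrier := K v\<rparr>) (S v) (\<sigma> v)"
  shows "(\<exists>!\<Psi>. is_Psi \<Gamma> G M \<pi> S \<Psi>) \<and>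
    (\<forall>\<Psi>. is_Psi \<Gamma> G M \<pi> S \<Psi> \<longrightarrow>
       linear_iso (source_space \<Gamma> M S) (target_space \<Gamma> G M \<pi> S) \<Psi> \<and>
       (\<forall>k\<in>carrier (vertex_group \<Gamma> G K). \<forall>x\<in>source_space \<Gamma> M S.
          \<Psi> (source_action \<Gamma> G M \<pi> S \<sigma> k x) = target_action \<Gamma> G K S \<sigma> k (\<Psi> x)) \<and>
       linear_iso (tensor (verts \<Gamma>) (vertex_invariants \<Gamma> G K M \<pi> S \<sigma>))
         (invariants (carrier (vertex_group \<Gamma> G K)) (target_space \<Gamma> G M \<pi> S)
            (target_action \<Gamma> G K S \<sigma>))
         (\<Psi> \<circ> tensor_incl (verts \<Gamma>) (vertex_invariants \<Gamma> G K M \<pi> S \<sigma>) (vertex_space \<Gamma> M S)))"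
proof -
  have "\<forall>e\<in>arcs \<Gamma>. \<exists>B \<beta>. dual_bases B (M e) (\<lambda>b. b) \<beta>" using fin_dim_dual_bases assms(6) by blast
  then obtain B \<beta> where B: "\<And>e. e \<in> arcs \<Gamma> \<Longrightarrow> dual_bases (B e) (M e) (\<lambda>b. b) (\<beta> e)" by metis
  have "\<forall>v\<in>verts \<Gamma>. \<exists>C \<gamma>. dual_bases C (S v) (\<lambda>c. c) \<gamma>" using fin_dim_dual_bases assms(9) by blast
  then obtain C \<gamma> where C: "\<And>v. v \<in> verts \<Gamma> \<Longrightarrow> dual_bases (C v) (S v) (\<lambda>c. c) (\<gamma> v)" by metis
  have G: "group G" using assms(2) unfolding lie_group_def by blast
  interpret graph_representation \<Gamma> G K M \<pi> S \<sigma> B \<beta> C \<gamma>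
    by (intro graph_representation.intro graph_representation_axioms.intro) (fact assms G B C)+
  obtain \<Psi> where \<Psi>: "is_Psi \<Gamma> G M \<pi> S \<Psi>" and
      iso: "linear_iso (source_space \<Gamma> M S) (target_space \<Gamma> G M \<pi> S) \<Psi>"
    using Psi_exists by blast
  have "\<Psi>' = \<Psi>" if "is_Psi \<Gamma> G M \<pi> S \<Psi>'" for \<Psi>' by (rule Psi_unique[OF that \<Psi>])
  moreover note Psi_equivariant[OF \<Psi>] Psi_invariants_iso[OF \<Psi> iso]
  ultimately show ?thesis unfolding carrier_vertex_group using \<Psi> iso by blast
qed

end
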